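(* Let $p$ be a prime, $q=p^m$. Let $n$ be a positive integer with $n \mid (q-1)$ and fix a real number $\delta \leq 1/33$. There exists an absolute constant $\lambda > 0$ such that if $n$ satisfies $$\gcd \bigg(n, \frac{q -1}{p^\nu - 1}\bigg) \leq \lambda\, \frac{n^{\delta}q^{1-\delta}}{p^{\nu}}$$ for all integers $\nu$ with $1\leq \nu < m$, $\nu \mid m$, then we have the estimates $$\max_{a\in\mathbb{F}_q^{*}} |S_n(a)| \ll q^{(3-\delta)/4}n^{(2+\delta)/4} + q^{3/4}n^{65/132}$$ and $$\max_{a\in\mathbb{F}_q^{*}} |S_n(a)| \ll q^{(7-2\delta)/8}n^{(1+\delta)/4} + q^{7/8}n^{8/33}.$$ Moreover, both estimates hold with $\delta = 1/33$ if (instead) $n$ satisfies $$\gcd \bigg(n, \frac{q -1}{p^\nu - 1}\bigg) \ll \frac{n}{p^{\nu/2}}$$ for all integers $\nu$ with $1\leq \nu < m$, $\nu \mid m$.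
   Context: $\mathbb{F}_q$ is the finite field with $q=p^m$ elements and $\mathbb{F}_q^*=\mathbb{F}_q\setminus\{0\}$. Let $Tr(x)=\sum_{i=0}^{m-1}x^{p^i}$ (the trace to $\mathbb{F}_p$), $e_p(x)=\exp(2\pi i x/p)$, $\psi(x)=e_p(Tr(x))$ and $\psi_a(x)=\psi(ax)$ for $a\in\mathbb{F}_q$. The Gauss sum is $S_n(a)=\sum_{x\in\mathbb{F}_q}\psi_a(x^n)$. $X \ll Y$ means that there is an absolute constant $c>0$ with $X\leq cY$. When such notation appears in a hypothesis, it is understood with some fixed implied constant (uniform over all $\nu$), and the implied constants in the conclusion may depend on it, but not on $q$ or $n$. The constant $\lambda$ is absolute. *)

theory Defs
  imports Complex_Main "HOL-Algebra.Ring" "HOL-Computational_Algebra.Primes"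
begin

text \<open>
  Finite fields are records \<open>F :: 'a ring\<close> satisfying the locale predicate \<^const>\<open>field\<close>, rather
  than types of sort \<open>{field, finite}\<close>: constants that are uniform over all finite fields have to
  be quantified before the field, which is impossible when the field is a type.  For infinite
  \<open>'a\<close> (e.g. \<^typ>\<open>nat\<close>), every finite field is isomorphic to one with carrier in \<open>'a\<close>, so there
  the uniformity is over all finite fields.
\<close>

definition abs_trace :: "nat \<Rightarrow> nat \<Rightarrow> 'a ring \<Rightarrow> 'a \<Rightarrow> 'a" where
  "abs_trace p m F x = (\<Oplus>\<^bsub>F\<^esub> i \<in> {..<m}. x [^]\<^bsub>F\<^esub> (p ^ i))"

text \<open>
  The trace is an element of the prime subfield of \<open>F\<close>, which is identified with the integers
  modulo \<open>p\<close> via \<open>k \<mapsto> k \<cdot> 1\<close>.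
\<close>

definition prime_field_rep :: "nat \<Rightarrow> 'a ring \<Rightarrow> 'a \<Rightarrow> nat" where
  "prime_field_rep p F y = (THE k. k < p \<and> add_pow F k \<one>\<^bsub>F\<^esub> = y)"

definition e_p :: "nat \<Rightarrow> 'a ring \<Rightarrow> 'a \<Rightarrow> complex" where
  "e_p p F y = exp (2 * of_real pi * \<i> * of_nat (prime_field_rep p F y) / of_nat p)"

definition add_char :: "nat \<Rightarrow> nat \<Rightarrow> 'a ring \<Rightarrow> 'a \<Rightarrow> 'a \<Rightarrow> complex" where
  "add_char p m F a x = e_p p F (abs_trace p m F (a \<otimes>\<^bsub>F\<^esub> x))"

definition gauss_sum :: "nat \<Rightarrow> nat \<Rightarrow> 'a ring \<Rightarrow> nat \<Rightarrow> 'a \<Rightarrow> complex" where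
  "gauss_sum p m F n a = (\<Sum>x\<in>carrier F. add_char p m F a (x [^]\<^bsub>F\<^esub> n))"

definition max_gauss_sum :: "nat \<Rightarrow> nat \<Rightarrow> 'a ring \<Rightarrow> nat \<Rightarrow> real" where
  "max_gauss_sum p m F n = Max ((\<lambda>a. cmod (gauss_sum p m F n a)) ` (carrier F - {\<zero>\<^bsub>F\<^esub>}))"

end

theory Submission
  imports
    Defs
    "HOL-Algebra.Multiplicative_Group"
    "HOL-Analysis.Convex"
    "HOL-Analysis.Complex_Transcendental"
begin

text \<open>
  Let \<open>H\<close> be the group of nonzero \<open>n\<close>-th powers, \<open>t = (q - 1) / n\<close> its order, and let
  \<open>e\<close> be the additive energy of \<open>H\<close> divided by \<open>t\<^sup>2\<close>, that is, the average number of
  representations of \<open>a - b\<close> with \<open>a, b\<close> in \<open>H\<close> as a difference of two elements of \<open>H\<close>.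
  A Gauss sum is \<open>1 + n T\<close>, where \<open>T\<close> is an additive character sum over a coset of \<open>H\<close>.
  The fourth moment of such sums gives \<open>\<bar>T\<bar>\<^sup>4 \<le> q e t\<close>, and a second use of the invariance of
  \<open>\<bar>T\<bar>\<close> under \<open>H\<close> together with two Cauchy--Schwarz steps gives \<open>\<bar>T\<bar>\<^sup>8 \<le> q e\<^sup>2 t\<^sup>4\<close>
  (\<open>norm_char_sum_fourth\<close>, \<open>norm_char_sum_eighth\<close>).  With \<open>t\<close> about \<open>q / n\<close>, both estimates of
  the theorem follow once \<open>e\<close> is at most a constant times
  \<open>(q / n) powr (1 - \<delta>) + (q / n) * n powr (- 1/33)\<close>.

  The bound for \<open>e\<close> is a sum-product statement: if \<open>e ^ 33\<close> exceeds a constant times \<open>t ^ 32\<close>,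
  then a subfield \<open>L\<close> with \<open>\<bar>L\<bar> \<lless> t ^ 7 / e ^ 6\<close> contains at least \<open>e / 4\<close> elements of \<open>H\<close>
  (\<open>large_energy_imp_subfield\<close>).  If \<open>L\<close> is the whole field, its size bounds \<open>e\<close>; if \<open>L\<close> is
  proper, the gcd hypothesis does, because \<open>\<bar>H \<inter> L\<bar>\<close> is at most
  \<open>\<bar>L\<^sup>*\<bar> * gcd n ((q - 1) / \<bar>L\<^sup>*\<bar>) / n\<close>.

  The subfield is found as follows.  For a suitable shift \<open>s\<close>, almost all differences of elements of
  \<open>A = H \<inter> (H - s)\<close> are popular, i.e. have many representations as differences of \<open>H\<close>
  (\<open>popular_intersection\<close>).  Popular differences form few cosets of \<open>H\<close>.  After pruning, all
  differences of \<open>A\<close> are sums of two popular ones, so the ratio set \<open>R = (B - B) / (B - B)\<close> of a large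
  part \<open>B\<close> of \<open>A\<close> is small.  An element \<open>\<rho>\<close> lies in \<open>R\<close> iff the map
  \<open>(x, y) \<mapsto> x + \<rho> y\<close> is not injective on \<open>B \<times> B\<close>.  The decisive point is that for
  \<open>\<rho>\<close> in \<open>R\<close> this map has a collision on every \<^emph>\<open>large\<close> set of pairs (\<open>collision\<close>): writing
  \<open>\<rho> = (b1 - b2) / (b3 - b4)\<close>, each of \<open>(b3 - b4) x\<close> and \<open>(b1 - b2) y\<close> lies in one fixed
  translate of one fixed dilate of \<open>A\<close> for a not too small proportion of all \<open>x\<close> and \<open>y\<close>
  (\<open>capture\<close>), so the values are confined to a set of the size of \<open>A - A\<close>.  Applied to
  well chosen sets of pairs, this shows that \<open>R\<close> is closed under adding \<open>1\<close> and under multiplication by quotients of elements of a large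
  part \<open>C\<close> of \<open>B\<close>.  A finite set with these closure properties contains a subfield that contains
  those quotients.
\<close>

section \<open>Counting with finite relations\<close>

lemma card_rel_eq_sum:
  assumes "finite A" "finite B"
  shows "card {(a, b) \<in> A \<times> B. Q a b} = (\<Sum>a\<in>A. card {b \<in> B. Q a b})"
proof -
  have "{(a, b) \<in> A \<times> B. Q a b} = Sigma A (\<lambda>a. {b \<in> B. Q a b})" by auto
  then show ?thesis using assms by simp
qed

lemma card_rel_swap:
  "card {(a, b) \<in> A \<times> B. Q a b} = card {(b, a) \<in> B \<times> A. Q a b}"
proof -
  have eq: "{(b, a) \<in> B \<times> A. Q a b} = prod.swap ` {(a, b) \<in> A \<times> B. Q a b}"
    by (simp add: set_eq_iff image_def) blast
  show ?thesis by (subst eq, rule card_image[symmetric]) (rule inj_on_subset[OF inj_swap subset_UNIV])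
qed

lemma card_many_partners:
  assumes "finite A" "finite B" "0 \<le> M"
  shows "real (card {a \<in> A. M < real (card {b \<in> B. Q a b})}) * M \<le> real (card {(a, b) \<in> A \<times> B. Q a b})"
proof -
  let ?S = "{a \<in> A. M < real (card {b \<in> B. Q a b})}"
  have "real (card ?S) * M = (\<Sum>a\<in>?S. M)" by simp
  also have "\<dots> \<le> (\<Sum>a\<in>?S. real (card {b \<in> B. Q a b}))" by (rule sum_mono) auto
  also have "\<dots> \<le> (\<Sum>a\<in>A. real (card {b \<in> B. Q a b}))"
    using assms by (intro sum_mono2) auto
  finally show ?thesis using card_rel_eq_sum[OF assms(1,2), of Q] by simp
qed

lemma card_le_by_fibres:
  assumes "finite Z" "f ` S \<subseteq> Z" "finite S" "\<And>z. z \<in> f ` S \<Longrightarrow> real (card {p \<in> S. f p = z}) \<le> M" "0 \<le> M"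
  shows "real (card S) \<le> real (card Z) * M"
proof -
  have "S = (\<Union>z\<in>f ` S. {p \<in> S. f p = z})" by auto
  then have "card S = (\<Sum>z\<in>f ` S. card {p \<in> S. f p = z})"
    using assms(3) by (subst (1) \<open>S = _\<close>, subst card_UN_disjoint) auto
  then have "real (card S) \<le> (\<Sum>z\<in>f ` S. M)"
    using assms(4) sum_mono[of "f ` S" "\<lambda>z. real (card {p \<in> S. f p = z})" "\<lambda>_. M"] by simp
  also have "\<dots> \<le> real (card Z) * M"
    using assms(1,2,5) by (simp add: card_mono mult_right_mono)
  finally show ?thesis .
qed

lemma card_ge_by_fibres:
  assumes "finite Z" "finite S" "f ` S \<subseteq> Z" "Z' \<subseteq> Z" "\<And>z. z \<in> Z' \<Longrightarrow> M \<le> real (card {p \<in> S. f p = z})"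
  shows "real (card Z') * M \<le> real (card S)"
proof -
  have "real (card Z') * M \<le> (\<Sum>z\<in>Z'. real (card {p \<in> S. f p = z}))"
    using assms(5) sum_mono[of Z' "\<lambda>_. M"] by simp
  also have "\<dots> = real (card (\<Union>z\<in>Z'. {p \<in> S. f p = z}))"
    using assms by (subst card_UN_disjoint) (auto intro: finite_subset)
  also have "\<dots> \<le> real (card S)" using assms by (intro of_nat_mono card_mono) auto
  finally show ?thesis .
qed

text \<open>Averaging over the columns of a bipartite relation; it fixes the auxiliary parameters in the pivot
argument, at the cost of keeping only a proportion of the objects.\<close>

lemma popular_column:
  assumes "finite X" "finite T" "T \<noteq> {}" "\<And>x. x \<in> X \<Longrightarrow> \<kappa> \<le> real (card {\<theta> \<in> T. Q x \<theta>})"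
  shows "\<exists>\<theta>\<in>T. real (card X) * \<kappa> \<le> real (card T) * real (card {x \<in> X. Q x \<theta>})"
proof (rule ccontr)
  assume "\<not> ?thesis"
  then have *: "real (card T) * real (card {x \<in> X. Q x \<theta>}) < real (card X) * \<kappa>" if "\<theta> \<in> T" for \<theta>
    using that by force
  have cT: "0 < card T" using assms by (simp add: card_gt_0_iff)
  have "real (card X) * \<kappa> \<le> (\<Sum>x\<in>X. real (card {\<theta> \<in> T. Q x \<theta>}))"
    using assms(4) sum_mono[of X "\<lambda>_. \<kappa>"] by simp
  also have "\<dots> = (\<Sum>\<theta>\<in>T. real (card {x \<in> X. Q x \<theta>}))"
  proof -
    have "(\<Sum>x\<in>X. card {\<theta> \<in> T. Q x \<theta>}) = card {(x, \<theta>) \<in> X \<times> T. Q x \<theta>}"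
      using assms by (intro card_rel_eq_sum[symmetric])
    also have "\<dots> = card {(\<theta>, x) \<in> T \<times> X. Q x \<theta>}" by (rule card_rel_swap)
    also have "\<dots> = (\<Sum>\<theta>\<in>T. card {x \<in> X. Q x \<theta>})"
      using assms by (intro card_rel_eq_sum)
    finally show ?thesis by (simp flip: of_nat_sum)
  qed
  finally have "real (card T) * (real (card X) * \<kappa>) \<le> (\<Sum>\<theta>\<in>T. real (card T) * real (card {x \<in> X. Q x \<theta>}))"
    by (simp add: sum_distrib_left [symmetric] mult_left_mono)
  also have "\<dots> < (\<Sum>\<theta>\<in>T. real (card X) * \<kappa>)"
    using assms(2,3) * by (intro sum_strict_mono) auto
  finally show False by simp
qed

text \<open>Cauchy--Schwarz in the form used for energies: a map into a small set has many collisions.\<close>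

lemma card_square_le_collisions:
  assumes "finite S" "finite Z" "f ` S \<subseteq> Z"
  shows "(real (card S))\<^sup>2 \<le> real (card Z) * real (card {(p, p') \<in> S \<times> S. f p = f p'})"
proof -
  let ?c = "\<lambda>z. card {p \<in> S. f p = z}"
  have S: "card S = (\<Sum>z\<in>Z. ?c z)"
  proof -
    have "S = (\<Union>z\<in>Z. {p \<in> S. f p = z})" using assms by auto
    then show ?thesis using assms by (subst (1) \<open>S = _\<close>, subst card_UN_disjoint) auto
  qed
  have "card {(p, p') \<in> S \<times> S. f p = f p'} = (\<Sum>p\<in>S. ?c (f p))"
    using card_rel_eq_sum[OF assms(1,1), of "\<lambda>p p'. f p' = f p"] by (simp add: eq_commute)
  also have "\<dots> = (\<Sum>z\<in>Z. \<Sum>p\<in>{p \<in> S. f p = z}. ?c (f p))"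
    using assms by (intro sum.group[symmetric]) auto
  also have "\<dots> = (\<Sum>z\<in>Z. ?c z ^ 2)" by (intro sum.cong) (auto simp: power2_eq_square)
  finally have C: "card {(p, p') \<in> S \<times> S. f p = f p'} = (\<Sum>z\<in>Z. ?c z ^ 2)" .
  have "(\<Sum>z\<in>Z. real (?c z))\<^sup>2 \<le> (\<Sum>z\<in>Z. (real (?c z))\<^sup>2) * real (card Z)"
    using sum_squared_le_sum_of_squares[of "\<lambda>z. real (?c z)" Z] by simp
  then show ?thesis unfolding S C by (simp add: mult.commute)
qed

text \<open>All combinatorial arguments concern a subgroup \<open>H\<close> of the multiplicative group of a finite field;
that \<open>H\<close> consists of \<open>n\<close>-th powers matters only for the final estimates.\<close>

locale finite_field_subgroup = field R for R (structure) +
  fixes H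
  assumes fin: "finite (carrier R)" and H: "subgroup H (mult_of R)"
begin

lemma H_sub: "H \<subseteq> carrier R - {\<zero>}" using subgroup.subset[OF H] by simp
lemma H_car[simp]: "h \<in> H \<Longrightarrow> h \<in> carrier R" using H_sub by auto
lemma H_car'[simp]: "H \<subseteq> carrier R" using H_sub by auto
lemma H_nz[simp]: "h \<in> H \<Longrightarrow> h \<noteq> \<zero>" using H_sub by auto
lemma H_one[simp]: "\<one> \<in> H" using subgroup.one_closed[OF H] by simp
lemma H_mult[simp]: "h \<in> H \<Longrightarrow> k \<in> H \<Longrightarrow> h \<otimes> k \<in> H"
  using subgroup.m_closed[OF H] by simp
lemma H_unit[simp]: "h \<in> H \<Longrightarrow> h \<in> Units R" using H_sub field_Units by auto
lemma H_inv[simp]: "h \<in> H \<Longrightarrow> inv h \<in> H"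
  using subgroup.m_inv_closed[OF H, of h] H_sub m_inv_mult_of[of h] by (metis carrier_mult_of subsetD)
lemma H_fin[simp]: "finite H" using fin H_sub finite_subset by blast
lemma H_inv_car[simp]: "h \<in> H \<Longrightarrow> inv h \<in> carrier R" by (intro H_car H_inv)
lemma H_inv_l[simp]: "h \<in> H \<Longrightarrow> inv h \<otimes> h = \<one>" by simp
lemma H_inv_r[simp]: "h \<in> H \<Longrightarrow> h \<otimes> inv h = \<one>" by simp
lemma H_inv_cancel[simp]:
  assumes "h \<in> H" "x \<in> carrier R"
  shows "inv h \<otimes> (h \<otimes> x) = x" "h \<otimes> (inv h \<otimes> x) = x"
  using assms by (metis H_inv_l H_inv_r H_car H_inv_car l_one m_assoc)+

definition t where "t = card H"
lemma t_pos: "0 < t" unfolding t_def card_gt_0_iff using H_one H_fin by blast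

definition diff_reps where "diff_reps X z = card {b \<in> X. b \<oplus> z \<in> X}"
definition quot_reps where "quot_reps X g = card {x \<in> X. g \<otimes> x \<in> X}"

lemma fin_sub: "X \<subseteq> carrier R \<Longrightarrow> finite X" using fin finite_subset by blast

lemma diff_reps_diff_fibre:
  assumes "X \<subseteq> carrier R" "z \<in> carrier R"
  shows "card {p \<in> X \<times> X. fst p \<ominus> snd p = z} = diff_reps X z"
  unfolding diff_reps_def
proof (rule bij_betw_same_card[where f = snd])
  have 1: "a = b \<oplus> (a \<ominus> b)" if "a \<in> carrier R" "b \<in> carrier R" for a b
    using that by algebra
  have 2: "b \<oplus> z \<ominus> b = z" if "b \<in> carrier R" for b
    using that assms(2) by algebra
  show "bij_betw snd {p \<in> X \<times> X. fst p \<ominus> snd p = z} {b \<in> X. b \<oplus> z \<in> X}"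
  proof (rule bij_betwI[where g = "\<lambda>b. (b \<oplus> z, b)"])
    show "snd \<in> {p \<in> X \<times> X. fst p \<ominus> snd p = z} \<rightarrow> {b \<in> X. b \<oplus> z \<in> X}"
      using assms 1 by (auto simp: subset_iff)
    show "(\<lambda>b. (b \<oplus> z, b)) \<in> {b \<in> X. b \<oplus> z \<in> X} \<rightarrow> {p \<in> X \<times> X. fst p \<ominus> snd p = z}"
      using assms 2 by (auto simp: subset_iff)
    show "\<And>x. x \<in> {p \<in> X \<times> X. fst p \<ominus> snd p = z} \<Longrightarrow> (snd x \<oplus> z, snd x) = x"
      using assms 1 by (auto simp: subset_iff)
  qed simp
qed

lemma sum_diff_reps:
  assumes "X \<subseteq> carrier R"
  shows "(\<Sum>z\<in>carrier R. diff_reps X z) = (card X)\<^sup>2"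
proof -
  have "(card X)\<^sup>2 = card (X \<times> X)" by (simp add: power2_eq_square card_cartesian_product)
  also have "X \<times> X = (\<Union>z\<in>carrier R. {p \<in> X \<times> X. fst p \<ominus> snd p = z})"
    using assms by (auto intro!: minus_closed)
  also have "card \<dots> = (\<Sum>z\<in>carrier R. card {p \<in> X \<times> X. fst p \<ominus> snd p = z})"
    using fin fin_sub[OF assms] by (subst card_UN_disjoint) auto
  finally show ?thesis using diff_reps_diff_fibre[OF assms] by simp
qed

lemma diff_reps_minus:
  assumes "X \<subseteq> carrier R" "z \<in> carrier R"
  shows "diff_reps X (\<ominus> z) = diff_reps X z"
  unfolding diff_reps_def
proof (rule bij_betw_same_card[where f = "\<lambda>b. b \<ominus> z"])
  have 1: "b \<ominus> z \<oplus> z = b" "b \<oplus> z \<ominus> z = b" "b \<oplus> \<ominus> z = b \<ominus> z" if "b \<in> carrier R" for b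
    using that assms(2) by algebra+
  show "bij_betw (\<lambda>b. b \<ominus> z) {b \<in> X. b \<oplus> \<ominus> z \<in> X} {b \<in> X. b \<oplus> z \<in> X}"
    by (rule bij_betwI[where g = "\<lambda>b. b \<oplus> z"]) (use assms 1 in \<open>auto simp: subset_iff\<close>)
qed

lemma diff_reps_swap:
  assumes "X \<subseteq> carrier R" "a \<in> carrier R" "b \<in> carrier R"
  shows "diff_reps X (a \<ominus> b) = diff_reps X (b \<ominus> a)"
proof -
  have "a \<ominus> b = \<ominus> (b \<ominus> a)" using assms by algebra
  then show ?thesis using diff_reps_minus[OF assms(1), of "b \<ominus> a"] assms by simp
qed

text \<open>The invariance behind the whole argument: multiplication by \<open>H\<close> permutes the representations of
differences of \<open>H\<close>, so a set defined by such numbers of representations consists of cosets of \<open>H\<close>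
and possibly \<open>0\<close>.\<close>

lemma diff_reps_H_scale:
  assumes "h \<in> H" "z \<in> carrier R"
  shows "diff_reps H (h \<otimes> z) = diff_reps H z"
  unfolding diff_reps_def
proof (rule sym, rule bij_betw_same_card[where f = "\<lambda>b. h \<otimes> b"])
  have 1: "h \<otimes> b \<oplus> h \<otimes> z = h \<otimes> (b \<oplus> z)" if "b \<in> carrier R" for b
    using that assms H_car by algebra
  have 2: "inv h \<otimes> b \<oplus> z = inv h \<otimes> (b \<oplus> h \<otimes> z)" if "b \<in> carrier R" for b
    using that assms by (simp add: r_distr)
  show "bij_betw (\<lambda>b. h \<otimes> b) {b \<in> H. b \<oplus> z \<in> H} {b \<in> H. b \<oplus> h \<otimes> z \<in> H}"
    by (rule bij_betwI[where g = "\<lambda>b. inv h \<otimes> b"]) (use assms 1 2 in auto)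
qed

lemma quot_reps_fibre:
  assumes "X \<subseteq> H" "g \<in> carrier R"
  shows "card {p \<in> X \<times> X. fst p \<otimes> inv (snd p) = g} = quot_reps X g"
  unfolding quot_reps_def
proof (rule bij_betw_same_card[where f = snd])
  have X: "x \<in> H" if "x \<in> X" for x using that assms by auto
  have 1: "a \<otimes> inv b \<otimes> b = a" if "a \<in> X" "b \<in> X" for a b
    using X[OF that(1)] X[OF that(2)] by (simp add: m_assoc)
  have 2: "g \<otimes> b \<otimes> inv b = g" if "b \<in> X" for b
    using X[OF that] assms by (simp add: m_assoc)
  show "bij_betw snd {p \<in> X \<times> X. fst p \<otimes> inv (snd p) = g} {x \<in> X. g \<otimes> x \<in> X}"
    by (rule bij_betwI[where g = "\<lambda>b. (g \<otimes> b, b)"]) (auto simp: 1 2)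
qed

lemma quot_reps_inv:
  assumes "X \<subseteq> H" "g \<in> H"
  shows "quot_reps X (inv g) = quot_reps X g"
proof -
  have X: "x \<in> H" if "x \<in> X" for x using that assms by auto
  show ?thesis unfolding quot_reps_def
    by (rule bij_betw_same_card[where f = "\<lambda>x. inv g \<otimes> x"],
        rule bij_betwI[where g = "\<lambda>x. g \<otimes> x"]) (use X assms(2) in auto)
qed

end

section \<open>Additive energy and popular differences\<close>

context finite_field_subgroup begin

text \<open>The additive energy of \<open>H\<close> divided by the number of pairs.  Dividing by \<open>t\<^sup>2\<close> makes it a number
between \<open>0\<close> and \<open>t\<close> that can be compared with \<open>t powr (32/33)\<close>.\<close>

definition avg_energy :: real where
  "avg_energy = real (\<Sum>z\<in>carrier R. (diff_reps H z)\<^sup>2) / (real t)\<^sup>2"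

definition popular where "popular \<tau> = {z \<in> carrier R. \<tau> \<le> real (diff_reps H z)}"

lemma popular_sub: "popular \<tau> \<subseteq> carrier R" by (auto simp: popular_def)
lemma popular_car: "z \<in> popular \<tau> \<Longrightarrow> z \<in> carrier R" by (auto simp: popular_def)
lemma popular_fin[simp]: "finite (popular \<tau>)" using fin popular_sub finite_subset by blast

lemma popular_scale: "h \<in> H \<Longrightarrow> z \<in> popular \<tau> \<Longrightarrow> h \<otimes> z \<in> popular \<tau>"
  by (simp add: popular_def diff_reps_H_scale)

lemma popular_swap: "a \<in> carrier R \<Longrightarrow> b \<in> carrier R \<Longrightarrow> a \<ominus> b \<in> popular \<tau> \<longleftrightarrow> b \<ominus> a \<in> popular \<tau>"
  using diff_reps_swap[OF H_car', of a b] by (simp add: popular_def)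

lemma card_popular:
  shows "real (card (popular \<tau>)) * \<tau> \<le> (real t)\<^sup>2"
proof -
  have "real (card (popular \<tau>)) * \<tau> = (\<Sum>z\<in>popular \<tau>. \<tau>)" by simp
  also have "\<dots> \<le> (\<Sum>z\<in>popular \<tau>. real (diff_reps H z))" by (rule sum_mono) (auto simp: popular_def)
  also have "\<dots> \<le> (\<Sum>z\<in>carrier R. real (diff_reps H z))"
    using fin popular_sub by (intro sum_mono2) auto
  also have "\<dots> = (real t)\<^sup>2" using sum_diff_reps[OF H_car'] by (simp add: t_def flip: of_nat_sum)
  finally show ?thesis .
qed

lemma card_common_shifts:
  assumes "a \<in> H" "b \<in> H"
  shows "card {s \<in> carrier R. a \<oplus> s \<in> H \<and> b \<oplus> s \<in> H} \<le> diff_reps H (a \<ominus> b)"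
  unfolding diff_reps_def
proof (rule card_inj_on_le[where f = "\<lambda>s. b \<oplus> s"])
  have 1: "b \<oplus> s \<oplus> (a \<ominus> b) = a \<oplus> s" if "s \<in> carrier R" for s
    using that assms H_car by algebra
  show "(\<lambda>s. b \<oplus> s) ` {s \<in> carrier R. a \<oplus> s \<in> H \<and> b \<oplus> s \<in> H} \<subseteq> {c \<in> H. c \<oplus> (a \<ominus> b) \<in> H}"
    using 1 by auto
  show "inj_on (\<lambda>s. b \<oplus> s) {s \<in> carrier R. a \<oplus> s \<in> H \<and> b \<oplus> s \<in> H}"
    using assms by (auto simp: inj_on_def)
qed simp

text \<open>Counting triples \<open>(s, a, b)\<close> with \<open>a, b, a + s, b + s\<close> in \<open>H\<close> by their pair \<open>(a, b)\<close> first: the number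
of admissible \<open>s\<close> is at most the number of representations of \<open>a - b\<close>, which is below \<open>\<tau>\<close> for
an unpopular pair.\<close>

lemma sum_unpopular_pairs:
  assumes "0 \<le> \<tau>"
  shows "(\<Sum>s\<in>carrier R. real (card {(a, b) \<in> {b \<in> H. b \<oplus> s \<in> H} \<times> {b \<in> H. b \<oplus> s \<in> H}. a \<ominus> b \<notin> popular \<tau>}))
    \<le> (real t)\<^sup>2 * \<tau>"
proof -
  define U where "U = {(a, b) \<in> H \<times> H. a \<ominus> b \<notin> popular \<tau>}"
  have fU: "finite U" unfolding U_def by (rule finite_subset[of _ "H \<times> H"]) auto
  have cU: "card U \<le> t\<^sup>2"
    unfolding U_def t_def by (rule order_trans[OF card_mono[of "H \<times> H"]]) (auto simp: power2_eq_square)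
  have cU': "real (card U) \<le> (real t)\<^sup>2" using cU by (metis of_nat_le_iff of_nat_power)
  have "(\<Sum>s\<in>carrier R. card {(a, b) \<in> {b \<in> H. b \<oplus> s \<in> H} \<times> {b \<in> H. b \<oplus> s \<in> H}. a \<ominus> b \<notin> popular \<tau>})
      = (\<Sum>s\<in>carrier R. card {p \<in> U. fst p \<oplus> s \<in> H \<and> snd p \<oplus> s \<in> H})"
    by (intro sum.cong refl arg_cong[where f = card]) (auto simp: U_def)
  also have "\<dots> = card {(s, p) \<in> carrier R \<times> U. fst p \<oplus> s \<in> H \<and> snd p \<oplus> s \<in> H}"
    using fin fU by (intro card_rel_eq_sum[symmetric])
  also have "\<dots> = card {(p, s) \<in> U \<times> carrier R. fst p \<oplus> s \<in> H \<and> snd p \<oplus> s \<in> H}"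
    by (rule card_rel_swap)
  also have "\<dots> = (\<Sum>p\<in>U. card {s \<in> carrier R. fst p \<oplus> s \<in> H \<and> snd p \<oplus> s \<in> H})"
    using fin fU by (intro card_rel_eq_sum)
  also have "\<dots> \<le> (\<Sum>p\<in>U. diff_reps H (fst p \<ominus> snd p))"
    by (intro sum_mono card_common_shifts) (auto simp: U_def)
  finally have "real (\<Sum>s\<in>carrier R. card {(a, b) \<in> {b \<in> H. b \<oplus> s \<in> H} \<times> {b \<in> H. b \<oplus> s \<in> H}. a \<ominus> b \<notin> popular \<tau>})
      \<le> real (\<Sum>p\<in>U. diff_reps H (fst p \<ominus> snd p))" by (intro of_nat_mono)
  also have "\<dots> \<le> (\<Sum>p\<in>U. \<tau>)"
    unfolding of_nat_sum by (rule sum_mono) (auto simp: U_def popular_def)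
  also have "\<dots> \<le> (real t)\<^sup>2 * \<tau>"
    using cU' assms by (simp add: mult_right_mono)
  finally show ?thesis by simp
qed

lemma avg_energy_pos: "0 < avg_energy"
proof -
  have "diff_reps H \<zero> = card H"
    unfolding diff_reps_def by (rule arg_cong[where f = card]) auto
  then have "0 < (diff_reps H \<zero>)\<^sup>2" using t_pos by (simp add: t_def)
  also have "\<dots> \<le> (\<Sum>z\<in>carrier R. (diff_reps H z)\<^sup>2)"
    using fin by (intro member_le_sum) auto
  finally have "0 < real (\<Sum>z\<in>carrier R. (diff_reps H z)\<^sup>2)" by (simp only: of_nat_0_less_iff)
  then show ?thesis using t_pos unfolding avg_energy_def by (intro divide_pos_pos) auto
qed

lemma diff_reps_le: "diff_reps H z \<le> t" unfolding diff_reps_def t_def by (intro card_mono) auto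

lemma avg_energy_le: "avg_energy \<le> t"
proof -
  have "(\<Sum>z\<in>carrier R. (diff_reps H z)\<^sup>2) \<le> (\<Sum>z\<in>carrier R. t * diff_reps H z)"
    by (intro sum_mono) (simp add: power2_eq_square diff_reps_le mult_right_mono)
  also have "\<dots> = t * t\<^sup>2" using sum_diff_reps[OF H_car'] by (simp add: t_def flip: sum_distrib_left)
  finally have "real (\<Sum>z\<in>carrier R. (diff_reps H z)\<^sup>2) \<le> real (t * t\<^sup>2)" by (rule of_nat_mono)
  then show ?thesis using t_pos unfolding avg_energy_def by (subst divide_le_eq) auto
qed

text \<open>An observation of Schoen on the Balog--Szemeredi--Gowers theorem.  The sets \<open>H \<inter> (H - s)\<close> have
total squared size equal to the energy, while \<open>sum_unpopular_pairs\<close> makes the unpopular pairs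
inside them a small proportion of this total, so some \<open>s\<close> gives a large intersection with few
unpopular pairs.  Popularity is measured against \<open>avg_energy\<close> itself, which is what keeps the
exponents small.  Two thresholds are needed at once: an absolute one for counting, and a much
smaller one for which even a thin subset of the intersection sees mostly popular differences.\<close>

lemma popular_intersection:
  fixes \<epsilon> \<epsilon>' :: real
  assumes "0 < \<epsilon>" "0 < \<epsilon>'"
  obtains A where "A \<subseteq> H" "avg_energy / 2 \<le> card A"
    "real (card {(a, b) \<in> A \<times> A. a \<ominus> b \<notin> popular (\<epsilon> * avg_energy)}) \<le> 8 * \<epsilon> * (real (card A))\<^sup>2"
    "real (card {(a, b) \<in> A \<times> A. a \<ominus> b \<notin> popular (\<epsilon>' * avg_energy)}) \<le> 8 * \<epsilon>' * (real (card A))\<^sup>2"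
proof -
  define A where "A s = {b \<in> H. b \<oplus> s \<in> H}" for s
  define bad where "bad \<epsilon> s = real (card {(a, b) \<in> A s \<times> A s. a \<ominus> b \<notin> popular (\<epsilon> * avg_energy)})" for \<epsilon> s
  define E where "E = real (\<Sum>z\<in>carrier R. (diff_reps H z)\<^sup>2)"
  have E1: "E = avg_energy * (real t)\<^sup>2"
    using t_pos by (simp add: E_def avg_energy_def)
  then have E: "E = avg_energy * (real t)\<^sup>2" "0 < E"
    using t_pos avg_energy_pos by auto
  have cA: "card (A s) = diff_reps H s" for s by (simp add: A_def diff_reps_def)
  \<comment> \<open>Weighted by \<open>1 / (8 * \<eta>)\<close>, the unpopular pairs for either threshold use up an eighth of the
    energy; intersections of size below \<open>avg_energy / 2\<close> use up at most half of it.\<close>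
  have sb: "(\<Sum>s\<in>carrier R. bad \<eta> s) / (8 * \<eta>) \<le> E / 8" if "0 < \<eta>" for \<eta>
    using sum_unpopular_pairs[of "\<eta> * avg_energy"] that avg_energy_pos
    by (simp add: bad_def A_def E field_simps)
  have "\<exists>s\<in>carrier R. avg_energy / 2 \<le> diff_reps H s \<and> bad \<epsilon> s \<le> 8 * \<epsilon> * (real (diff_reps H s))\<^sup>2 \<and> bad \<epsilon>' s \<le> 8 * \<epsilon>' * (real (diff_reps H s))\<^sup>2"
  proof (rule ccontr)
    assume neg: "\<not> ?thesis"
    have nn: "0 \<le> bad \<eta> s" for \<eta> s by (simp add: bad_def)
    have "(real (diff_reps H s))\<^sup>2 \<le> avg_energy / 2 * diff_reps H s + bad \<epsilon> s / (8 * \<epsilon>) + bad \<epsilon>' s / (8 * \<epsilon>')" if "s \<in> carrier R" for s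
    proof -
      consider "diff_reps H s < avg_energy / 2" | "8 * \<epsilon> * (real (diff_reps H s))\<^sup>2 < bad \<epsilon> s" | "8 * \<epsilon>' * (real (diff_reps H s))\<^sup>2 < bad \<epsilon>' s"
        using neg \<open>s \<in> carrier R\<close> by force
      then show ?thesis
      proof cases
        case 1
        then have "(real (diff_reps H s))\<^sup>2 \<le> avg_energy / 2 * diff_reps H s"
          unfolding power2_eq_square by (intro mult_right_mono) auto
        moreover have "0 \<le> bad \<epsilon> s / (8 * \<epsilon>)" "0 \<le> bad \<epsilon>' s / (8 * \<epsilon>')"
          using nn assms by auto
        ultimately show ?thesis by linarith
      next
        case 2
        then have "(real (diff_reps H s))\<^sup>2 \<le> bad \<epsilon> s / (8 * \<epsilon>)" using assms by (simp add: field_simps)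
        moreover have "0 \<le> avg_energy / 2 * diff_reps H s" "0 \<le> bad \<epsilon>' s / (8 * \<epsilon>')"
          using avg_energy_pos nn assms by auto
        ultimately show ?thesis by linarith
      next
        case 3
        then have "(real (diff_reps H s))\<^sup>2 \<le> bad \<epsilon>' s / (8 * \<epsilon>')" using assms by (simp add: field_simps)
        moreover have "0 \<le> avg_energy / 2 * diff_reps H s" "0 \<le> bad \<epsilon> s / (8 * \<epsilon>)"
          using avg_energy_pos nn assms by auto
        ultimately show ?thesis by linarith
      qed
    qed
    then have "E \<le> (\<Sum>s\<in>carrier R. avg_energy / 2 * diff_reps H s + bad \<epsilon> s / (8 * \<epsilon>) + bad \<epsilon>' s / (8 * \<epsilon>'))"
      unfolding E_def of_nat_sum of_nat_power by (rule sum_mono)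
    also have "\<dots> = avg_energy / 2 * (\<Sum>s\<in>carrier R. real (diff_reps H s)) + (\<Sum>s\<in>carrier R. bad \<epsilon> s) / (8 * \<epsilon>) + (\<Sum>s\<in>carrier R. bad \<epsilon>' s) / (8 * \<epsilon>')"
      by (simp add: sum.distrib sum_distrib_left sum_divide_distrib)
    also have "(\<Sum>s\<in>carrier R. real (diff_reps H s)) = (real t)\<^sup>2"
      using sum_diff_reps[OF H_car'] by (simp add: t_def flip: of_nat_sum)
    also have "avg_energy / 2 * (real t)\<^sup>2 = E / 2" by (simp add: E)
    finally show False using sb[OF assms(1)] sb[OF assms(2)] E(2) by linarith
  qed
  then obtain s where "s \<in> carrier R" "avg_energy / 2 \<le> diff_reps H s" "bad \<epsilon> s \<le> 8 * \<epsilon> * (real (diff_reps H s))\<^sup>2" "bad \<epsilon>' s \<le> 8 * \<epsilon>' * (real (diff_reps H s))\<^sup>2"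
    by auto
  then show ?thesis using that[of "A s"] by (auto simp: cA bad_def) (auto simp: A_def)
qed

text \<open>Passing from few unpopular pairs to few unpopular partners of every element, by discarding the
elements that have too many.\<close>

lemma cluster_exists:
  fixes \<epsilon> :: real
  assumes "0 < \<epsilon>"
  obtains A where "A \<subseteq> H" "3 / 8 * avg_energy \<le> card A"
    "\<And>a. a \<in> A \<Longrightarrow> real (card {b \<in> A. a \<ominus> b \<notin> popular (avg_energy / 512)}) \<le> card A / 6"
    "\<And>a. a \<in> A \<Longrightarrow> real (card {b \<in> A. a \<ominus> b \<notin> popular (\<epsilon> * avg_energy)}) \<le> 86 * \<epsilon> * card A"
proof -
  obtain A where A: "A \<subseteq> H" "avg_energy / 2 \<le> card A"
    "real (card {(a, b) \<in> A \<times> A. a \<ominus> b \<notin> popular (1 / 512 * avg_energy)}) \<le> 8 * (1 / 512) * (real (card A))\<^sup>2"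
    "real (card {(a, b) \<in> A \<times> A. a \<ominus> b \<notin> popular (\<epsilon> * avg_energy)}) \<le> 8 * \<epsilon> * (real (card A))\<^sup>2"
    using popular_intersection[of "1 / 512" \<epsilon>] assms by auto
  have fA: "finite A" by (rule finite_subset[OF A(1) H_fin])
  define \<alpha> where "\<alpha> = real (card A)"
  have \<alpha>: "0 < \<alpha>" using A(2) avg_energy_pos by (simp add: \<alpha>_def)
  \<comment> \<open>The factor \<open>64 = 8 * 8\<close> makes each set of discarded elements at most an eighth of
    \<open>A\<close>.\<close>
  define V where "V \<eta> = {a \<in> A. 64 * \<eta> * \<alpha> < real (card {b \<in> A. a \<ominus> b \<notin> popular (\<eta> * avg_energy)})}" for \<eta>
  have V: "card (V \<eta>) \<le> \<alpha> / 8" if "0 < \<eta>" "real (card {(a, b) \<in> A \<times> A. a \<ominus> b \<notin> popular (\<eta> * avg_energy)}) \<le> 8 * \<eta> * \<alpha>\<^sup>2" for \<eta>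
  proof -
    have "real (card (V \<eta>)) * (64 * \<eta> * \<alpha>) \<le> 8 * \<eta> * \<alpha>\<^sup>2"
      unfolding V_def by (rule order_trans[OF card_many_partners that(2)]) (use fA \<alpha> that in auto)
    then have "card (V \<eta>) * (64 * \<eta> * \<alpha>) \<le> \<alpha> / 8 * (64 * \<eta> * \<alpha>)" by (simp add: power2_eq_square)
    then show ?thesis using \<alpha> that(1) by (subst (asm) mult_le_cancel_right_pos) auto
  qed
  define A' where "A' = A - (V (1/512) \<union> V \<epsilon>)"
  have fV: "finite (V \<eta>)" for \<eta> using fA by (simp add: V_def)
  have "card (V (1/512) \<union> V \<epsilon>) \<le> card (V (1/512)) + card (V \<epsilon>)" by (rule card_Un_le)
  then have "card (V (1/512) \<union> V \<epsilon>) \<le> \<alpha> / 4"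
    using V[of "1/512"] V[of \<epsilon>] A(3,4) assms by (simp add: \<alpha>_def)
  moreover have "card A \<le> card A' + card (V (1/512) \<union> V \<epsilon>)"
    using diff_card_le_card_Diff[of "V (1/512) \<union> V \<epsilon>" A] fV unfolding A'_def by simp
  ultimately have c: "3 / 4 * \<alpha> \<le> card A'" by (simp add: \<alpha>_def)
  have sub: "A' \<subseteq> A" by (auto simp: A'_def)
  have le: "real (card {b \<in> A'. Q b}) \<le> card {b \<in> A. Q b}" for Q
    using sub fA by (intro of_nat_mono card_mono) auto
  \<comment> \<open>For \<open>\<epsilon> = 1/512\<close> the bound \<open>64 * \<epsilon> * \<alpha>\<close> is \<open>\<alpha> /
    8\<close>, a sixth of the guaranteed size \<open>3/4 * \<alpha>\<close> of the pruned set.\<close>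
  have 1: "real (card {b \<in> A'. a \<ominus> b \<notin> popular (avg_energy / 512)}) \<le> card A' / 6" if "a \<in> A'" for a
  proof -
    have "real (card {b \<in> A. a \<ominus> b \<notin> popular (1/512 * avg_energy)}) \<le> 64 * (1/512) * \<alpha>"
      using that by (auto simp: A'_def V_def)
    then show ?thesis using le[of "\<lambda>b. a \<ominus> b \<notin> popular (avg_energy / 512)"] c by simp
  qed
  have 2: "real (card {b \<in> A'. a \<ominus> b \<notin> popular (\<epsilon> * avg_energy)}) \<le> 86 * \<epsilon> * card A'" if "a \<in> A'" for a
  proof -
    have "real (card {b \<in> A. a \<ominus> b \<notin> popular (\<epsilon> * avg_energy)}) \<le> 64 * \<epsilon> * \<alpha>"
      using that by (auto simp: A'_def V_def)
    also have "64 * \<alpha> \<le> 86 * real (card A')" using c by simp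
    then have "64 * \<epsilon> * \<alpha> \<le> 86 * \<epsilon> * card A'" using assms by (simp add: mult.commute mult.left_commute)
    finally show ?thesis using le[of "\<lambda>b. a \<ominus> b \<notin> popular (\<epsilon> * avg_energy)"] by simp
  qed
  show ?thesis using that[of A'] 1 2 sub A(1,2) c by (auto simp: \<alpha>_def)
qed

end

section \<open>Multiplicative closeness and popular sums\<close>

context finite_field_subgroup begin

text \<open>For \<open>a\<close> and \<open>b\<close> in \<open>H\<close> the right-hand side is the size of the intersection of the dilates \<open>a X\<close> and
\<open>b X\<close>.  Since all dilates lie in \<open>H\<close>, its average over \<open>a, b\<close> in \<open>X\<close> is at least \<open>\<bar>X\<bar>\<^sup>2 / t\<close>.\<close>

definition close where "close X a b \<longleftrightarrow> (real (card X))\<^sup>2 / (64 * real t) \<le> real (quot_reps X (a \<otimes> inv b))"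

definition core where "core X = {a \<in> X. real (card {b \<in> X. \<not> close X a b}) \<le> card X / 8}"

lemma core_sub: "core X \<subseteq> X" by (auto simp: core_def)

lemma close_sym:
  assumes "X \<subseteq> H" "a \<in> H" "b \<in> H"
  shows "close X a b \<longleftrightarrow> close X b a"
proof -
  have "inv (a \<otimes> inv b) = b \<otimes> inv a"
  proof (rule inv_unique'[symmetric])
    show "a \<otimes> inv b \<otimes> (b \<otimes> inv a) = \<one>" "b \<otimes> inv a \<otimes> (a \<otimes> inv b) = \<one>"
      using assms by (simp_all add: m_assoc)
  qed (use assms in auto)
  then show ?thesis using quot_reps_inv[OF assms(1), of "a \<otimes> inv b"] assms(2,3) by (simp add: close_def)
qed

text \<open>The quotients \<open>a / b\<close> take at most \<open>t\<close> values, so quotients with few representations account for few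
pairs.  Hence closeness fails rarely, and no power of the density is lost in passing to the core.\<close>

lemma card_core:
  assumes "X \<subseteq> H"
  shows "7 / 8 * real (card X) \<le> card (core X)"
proof (cases "X = {}")
  case False
  have fX: "finite X" by (rule finite_subset[OF assms H_fin])
  define c where "c = real (card X)"
  have c: "0 < c" using False fX by (simp add: c_def card_gt_0_iff)
  define M where "M = c\<^sup>2 / (64 * real t)"
  have XH: "x \<in> H" if "x \<in> X" for x using that assms by auto
  let ?S = "{(a, b) \<in> X \<times> X. \<not> close X a b}"
  have fS: "finite ?S" by (rule finite_subset[of _ "X \<times> X"]) (use fX in auto)
  have "real (card ?S) \<le> real (card H) * M"
  proof (rule card_le_by_fibres[where f = "\<lambda>p. fst p \<otimes> inv (snd p)"])
    show "(\<lambda>p. fst p \<otimes> inv (snd p)) ` ?S \<subseteq> H" using XH by auto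
    fix z assume z: "z \<in> (\<lambda>p. fst p \<otimes> inv (snd p)) ` ?S"
    then have "z \<in> H" using XH by auto
    have "card {p \<in> ?S. fst p \<otimes> inv (snd p) = z} \<le> card {p \<in> X \<times> X. fst p \<otimes> inv (snd p) = z}"
      using fX by (intro card_mono) auto
    also have "\<dots> = quot_reps X z" using quot_reps_fibre[OF assms] \<open>z \<in> H\<close> by simp
    finally show "real (card {p \<in> ?S. fst p \<otimes> inv (snd p) = z}) \<le> M"
      using z by (auto simp: close_def M_def c_def)
  qed (use fS in \<open>auto simp: M_def\<close>)
  also have "\<dots> = c / 8 * (c / 8)" using t_pos by (auto simp: M_def t_def power2_eq_square)
  finally have S: "real (card ?S) \<le> c / 8 * (c / 8)" .
  let ?V = "{a \<in> X. c / 8 < real (card {b \<in> X. \<not> close X a b})}"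
  have "real (card ?V) * (c / 8) \<le> real (card ?S)"
    by (rule card_many_partners) (use fX c in auto)
  then have "real (card ?V) * (c / 8) \<le> c / 8 * (c / 8)" using S by linarith
  then have V: "card ?V \<le> c / 8" using c by (subst (asm) mult_le_cancel_right_pos) auto
  have "core X = X - ?V" by (auto simp: core_def c_def)
  then have "card (core X) = card X - card ?V" using fX by (simp add: card_Diff_subset)
  moreover have "card ?V \<le> card X" using fX by (intro card_mono) auto
  ultimately show ?thesis using V by (simp add: c_def)
qed simp

text \<open>Each element of the core is close to at least \<open>7/8\<close> of the set, so boundedly many elements of the core have a
common close element.  This replaces a fixed centre by one adapted to the elements at hand.\<close>

lemma common_close:
  assumes "X \<subseteq> H" "X \<noteq> {}" "finite F" "F \<subseteq> core X" "card F \<le> 7"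
  obtains b where "b \<in> X" "\<And>a. a \<in> F \<Longrightarrow> close X a b"
proof -
  have fX: "finite X" by (rule finite_subset[OF assms(1) H_fin])
  let ?U = "\<Union>a\<in>F. {b \<in> X. \<not> close X a b}"
  have "real (card ?U) \<le> real (\<Sum>a\<in>F. card {b \<in> X. \<not> close X a b})"
    using assms(3) by (intro of_nat_mono card_UN_le)
  also have "\<dots> \<le> (\<Sum>a\<in>F. card X / 8)"
    unfolding of_nat_sum using assms(4) by (intro sum_mono) (auto simp: core_def)
  also have "\<dots> = real (card F) * (card X / 8)" by simp
  also have "\<dots> \<le> 7 * (card X / 8)" using assms(5) by (intro mult_right_mono) auto
  also have "\<dots> < card X" using assms(2) fX by (simp add: card_gt_0_iff)
  finally have "card ?U < card X" by simp
  moreover have "finite ?U" using assms(3) fX by simp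
  ultimately have "\<not> X \<subseteq> ?U" using card_mono[of ?U X] by linarith
  then show ?thesis using that by auto
qed

text \<open>For suitable \<open>\<tau>\<close> and \<open>m\<close> this set contains \<open>A - A\<close>, is not much larger, and has the advantage over
\<open>A - A\<close> itself that it is invariant under multiplication by \<open>H\<close>.\<close>

definition popular_sums where
  "popular_sums \<tau> m = {z \<in> carrier R. m \<le> real (card {p \<in> popular \<tau> \<times> popular \<tau>. fst p \<oplus> snd p = z})}"

lemma card_popular_sums: "real (card (popular_sums \<tau> m)) * m \<le> (real (card (popular \<tau>)))\<^sup>2"
proof -
  have "real (card (popular_sums \<tau> m)) * m \<le> real (card (popular \<tau> \<times> popular \<tau>))"
    by (rule card_ge_by_fibres[where Z = "carrier R" and f = "\<lambda>p. fst p \<oplus> snd p"])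
       (use fin in \<open>auto simp: popular_sums_def intro!: a_closed dest!: popular_car\<close>)
  then show ?thesis by (simp add: card_cartesian_product power2_eq_square)
qed

lemma popular_sums_scale:
  assumes "h \<in> H" "z \<in> popular_sums \<tau> m"
  shows "h \<otimes> z \<in> popular_sums \<tau> m"
proof -
  have z: "z \<in> carrier R" using assms by (simp add: popular_sums_def)
  have car: "y \<in> carrier R" if "y \<in> popular \<tau>" for y using that by (rule popular_car)
  have can: "y = y'" if "h \<otimes> y = h \<otimes> y'" "y \<in> popular \<tau>" "y' \<in> popular \<tau>" for y y'
    using that(1) car[OF that(2)] car[OF that(3)] H_inv_cancel(1)[OF assms(1)] by metis
  have dist: "h \<otimes> y \<oplus> h \<otimes> y' = h \<otimes> (y \<oplus> y')" if "y \<in> popular \<tau>" "y' \<in> popular \<tau>" for y y'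
    using car[OF that(1)] car[OF that(2)] H_car[OF assms(1)] by (simp add: r_distr)
  have "card {p \<in> popular \<tau> \<times> popular \<tau>. fst p \<oplus> snd p = z} \<le> card {p \<in> popular \<tau> \<times> popular \<tau>. fst p \<oplus> snd p = h \<otimes> z}"
  proof (rule card_inj_on_le[where f = "\<lambda>p. (h \<otimes> fst p, h \<otimes> snd p)"])
    show "inj_on (\<lambda>p. (h \<otimes> fst p, h \<otimes> snd p)) {p \<in> popular \<tau> \<times> popular \<tau>. fst p \<oplus> snd p = z}"
      using can by (intro inj_onI) auto
    show "(\<lambda>p. (h \<otimes> fst p, h \<otimes> snd p)) ` {p \<in> popular \<tau> \<times> popular \<tau>. fst p \<oplus> snd p = z}
      \<subseteq> {p \<in> popular \<tau> \<times> popular \<tau>. fst p \<oplus> snd p = h \<otimes> z}"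
      using popular_scale[OF assms(1)] dist by auto
  qed (rule finite_subset[of _ "popular \<tau> \<times> popular \<tau>"], auto)
  then show ?thesis using assms z by (simp add: popular_sums_def)
qed

text \<open>Two elements of \<open>A\<close> share most of their popular partners \<open>w\<close>, and each such \<open>w\<close> gives the representation
\<open>a - b = (a - w) + (w - b)\<close>.\<close>

lemma diff_in_popular_sums:
  assumes "A \<subseteq> H" "\<And>a. a \<in> A \<Longrightarrow> real (card {b \<in> A. a \<ominus> b \<notin> popular \<tau>}) \<le> card A / 6" "a \<in> A" "b \<in> A"
  shows "a \<ominus> b \<in> popular_sums \<tau> (2 / 3 * card A)"
proof -
  have fA: "finite A" by (rule finite_subset[OF assms(1) H_fin])
  have AH: "x \<in> carrier R" if "x \<in> A" for x using that assms(1) by (auto intro: H_car)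
  let ?W = "{w \<in> A. a \<ominus> w \<in> popular \<tau> \<and> b \<ominus> w \<in> popular \<tau>}"
  have "A = ?W \<union> ({w \<in> A. a \<ominus> w \<notin> popular \<tau>} \<union> {w \<in> A. b \<ominus> w \<notin> popular \<tau>})" by auto
  then have "card A \<le> card ?W + (card {w \<in> A. a \<ominus> w \<notin> popular \<tau>} + card {w \<in> A. b \<ominus> w \<notin> popular \<tau>})"
    by (metis (no_types, lifting) add_left_mono card_Un_le order_trans)
  then have "2 / 3 * card A \<le> card ?W" using assms(2)[OF assms(3)] assms(2)[OF assms(4)] by linarith
  also have "card ?W \<le> card {p \<in> popular \<tau> \<times> popular \<tau>. fst p \<oplus> snd p = a \<ominus> b}"
  proof (rule card_inj_on_le[where f = "\<lambda>w. (a \<ominus> w, w \<ominus> b)"])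
    have "w = a \<ominus> (a \<ominus> w)" if "w \<in> A" for w using AH[OF that] AH[OF assms(3)] by algebra
    then show "inj_on (\<lambda>w. (a \<ominus> w, w \<ominus> b)) ?W" by (intro inj_onI) (metis (no_types, lifting) mem_Collect_eq prod.inject)
    have "a \<ominus> w \<oplus> (w \<ominus> b) = a \<ominus> b" if "w \<in> A" for w
      using AH[OF that] AH[OF assms(3)] AH[OF assms(4)] by algebra
    then show "(\<lambda>w. (a \<ominus> w, w \<ominus> b)) ` ?W \<subseteq> {p \<in> popular \<tau> \<times> popular \<tau>. fst p \<oplus> snd p = a \<ominus> b}"
      using popular_swap[OF _ AH[OF assms(4)]] AH by auto
  qed (rule finite_subset[of _ "popular \<tau> \<times> popular \<tau>"], auto)
  finally show ?thesis using AH assms(3,4) by (simp add: popular_sums_def)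
qed

text \<open>The step that makes \<open>(b - b') x\<close> predictable.  If \<open>b z = b0 u\<close> and \<open>b' z' = b0 u'\<close> with all of
\<open>z, z', u, u'\<close> in \<open>A\<close>, then \<open>(b - b') x = b (x - z) - b' (x - z') + b0 (u - u')\<close>.  Here
\<open>b (x - z)\<close> and \<open>b' (x - z')\<close> are popular differences for most choices, and \<open>u - u'\<close> can usually be
rewritten as \<open>v - w\<close> with \<open>v, w\<close> in \<open>A\<close> in at least \<open>\<eta>\<close> ways.  So each \<open>x\<close> lies in a
not too small proportion of the sets of all \<open>x\<close> with \<open>(b - b') x \<in> \<theta>1 - \<theta>2 + b0 \<theta>3 - b0 A\<close>, with two popular
differences \<open>\<theta>1, \<theta>2\<close> and an element \<open>\<theta>3\<close> of \<open>A\<close> as parameters.\<close>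

lemma capture:
  assumes "A \<subseteq> H" "b \<in> H" "b' \<in> H" "b0 \<in> H" "0 \<le> \<mu>" "0 \<le> \<eta>"
    and good: "\<And>a. a \<in> A \<Longrightarrow> real (card {c \<in> A. a \<ominus> c \<notin> popular \<tau>}) \<le> \<mu> / 8"
    and cl: "\<mu> \<le> real (quot_reps A (b \<otimes> inv b0))" "\<mu> \<le> real (quot_reps A (b' \<otimes> inv b0))"
    and \<eta>: "real (card (popular \<tau>)) * \<eta> \<le> \<mu>\<^sup>2 / 8"
    and x: "x \<in> A"
  shows "\<mu>\<^sup>2 / 2 * \<eta> \<le> real (card {\<theta> \<in> popular \<tau> \<times> popular \<tau> \<times> A. \<exists>w\<in>A.
    (b \<ominus> b') \<otimes> x \<oplus> b0 \<otimes> w = fst \<theta> \<ominus> fst (snd \<theta>) \<oplus> b0 \<otimes> snd (snd \<theta>)})" (is "_ \<le> real (card ?C)")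
proof -
  have fA: "finite A" by (rule finite_subset[OF assms(1) H_fin])
  have AH: "x \<in> H" if "x \<in> A" for x using that assms(1) by auto
  define u u' where "u = b \<otimes> inv b0" and "u' = b' \<otimes> inv b0"
  have uH: "u \<in> H" "u' \<in> H" using assms by (auto simp: u_def u'_def)
  have b0u: "b0 \<otimes> (u \<otimes> z) = b \<otimes> z" "b0 \<otimes> (u' \<otimes> z) = b' \<otimes> z" if "z \<in> A" for z
  proof -
    have "b0 \<otimes> (v \<otimes> inv b0 \<otimes> z) = v \<otimes> z" if "v \<in> H" for v
      using that AH[OF \<open>z \<in> A\<close>] assms(4) m_lcomm[of b0 v "inv b0 \<otimes> z"] by (simp add: m_assoc)
    then show "b0 \<otimes> (u \<otimes> z) = b \<otimes> z" "b0 \<otimes> (u' \<otimes> z) = b' \<otimes> z" using assms by (auto simp: u_def u'_def)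
  qed
  define G where "G v = {z \<in> A. v \<otimes> z \<in> A \<and> x \<ominus> z \<in> popular \<tau>}" for v
  have fG: "finite (G v)" for v using fA by (simp add: G_def)
  have cG: "7 / 8 * \<mu> \<le> card (G v)" if "\<mu> \<le> real (quot_reps A v)" for v
  proof -
    have "quot_reps A v \<le> card (G v \<union> {c \<in> A. x \<ominus> c \<notin> popular \<tau>})"
      unfolding quot_reps_def using fA fG by (intro card_mono) (auto simp: G_def)
    also have "\<dots> \<le> card (G v) + card {c \<in> A. x \<ominus> c \<notin> popular \<tau>}" by (rule card_Un_le)
    finally show ?thesis using that good[OF x] by linarith
  qed
  have inj: "inj_on ((\<otimes>) v) A" if "v \<in> H" for v
    using that AH by (auto simp: inj_on_def m_lcancel)
  \<comment> \<open>The pairs lost because the difference of \<open>u z\<close> and its primed counterpart is not popular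
    (\<open>N1\<close>), or popular but with few representations as a difference of \<open>A\<close>
    (\<open>N2\<close>).\<close>
  define N1 where "N1 = {(z, z') \<in> G u \<times> G u'. u \<otimes> z \<ominus> u' \<otimes> z' \<notin> popular \<tau>}"
  define N2 where "N2 = {(z, z') \<in> G u \<times> G u'. u \<otimes> z \<ominus> u' \<otimes> z' \<in> popular \<tau> \<and> real (diff_reps A (u \<otimes> z \<ominus> u' \<otimes> z')) < \<eta>}"
  define Q where "Q = {(z, z') \<in> G u \<times> G u'. \<eta> \<le> real (diff_reps A (u \<otimes> z \<ominus> u' \<otimes> z'))}"
  have fin3: "finite N1" "finite N2" "finite Q"
    by (rule finite_subset[of _ "G u \<times> G u'"], use fG in \<open>auto simp: N1_def N2_def Q_def\<close>)+
  have "real (card N1) \<le> real (card (G u)) * (\<mu> / 8)"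
  proof -
    have "card N1 = (\<Sum>z\<in>G u. card {z' \<in> G u'. u \<otimes> z \<ominus> u' \<otimes> z' \<notin> popular \<tau>})"
      unfolding N1_def using fG by (intro card_rel_eq_sum)
    then have "real (card N1) = (\<Sum>z\<in>G u. real (card {z' \<in> G u'. u \<otimes> z \<ominus> u' \<otimes> z' \<notin> popular \<tau>}))"
      by simp
    also have "\<dots> \<le> (\<Sum>z\<in>G u. \<mu> / 8)"
    proof (rule sum_mono)
      fix z assume z: "z \<in> G u"
      have "card {z' \<in> G u'. u \<otimes> z \<ominus> u' \<otimes> z' \<notin> popular \<tau>} \<le> card {c \<in> A. u \<otimes> z \<ominus> c \<notin> popular \<tau>}"
        by (rule card_inj_on_le[where f = "(\<otimes>) u'"])
           (use fA in \<open>auto simp: G_def intro: inj_on_subset[OF inj[OF uH(2)]]\<close>)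
      also have "real \<dots> \<le> \<mu> / 8" using z by (intro good) (auto simp: G_def)
      finally show "real (card {z' \<in> G u'. u \<otimes> z \<ominus> u' \<otimes> z' \<notin> popular \<tau>}) \<le> \<mu> / 8" by simp
    qed
    finally show ?thesis by simp
  qed
  moreover have "real (card N2) \<le> \<mu>\<^sup>2 / 8"
  proof -
    let ?S = "{p \<in> A \<times> A. fst p \<ominus> snd p \<in> popular \<tau> \<and> real (diff_reps A (fst p \<ominus> snd p)) < \<eta>}"
    have fS: "finite ?S" using fA by simp
    have "card N2 \<le> card ?S"
      by (rule card_inj_on_le[where f = "\<lambda>p. (u \<otimes> fst p, u' \<otimes> snd p)"])
         (use fS inj[OF uH(1)] inj[OF uH(2)] in \<open>auto simp: N2_def G_def inj_on_def\<close>)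
    also have "real (card ?S) \<le> real (card (popular \<tau>)) * \<eta>"
    proof (rule card_le_by_fibres[where f = "\<lambda>p. fst p \<ominus> snd p"])
      fix z assume z: "z \<in> (\<lambda>p. fst p \<ominus> snd p) ` ?S"
      then have "z \<in> carrier R" "real (diff_reps A z) < \<eta>" using popular_car by auto
      have "card {p \<in> ?S. fst p \<ominus> snd p = z} \<le> card {p \<in> A \<times> A. fst p \<ominus> snd p = z}"
        using fA by (intro card_mono) auto
      also have "\<dots> = diff_reps A z" using \<open>z \<in> carrier R\<close> AH by (intro diff_reps_diff_fibre) auto
      finally show "real (card {p \<in> ?S. fst p \<ominus> snd p = z}) \<le> \<eta>"
        using \<open>real (diff_reps A z) < \<eta>\<close> by linarith
    qed (use fS assms in auto)
    finally show ?thesis using \<eta> by simp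
  qed
  moreover have "real (card (G u)) * real (card (G u')) \<le> card Q + (card N1 + card N2)"
  proof -
    have "card (G u) * card (G u') = card (G u \<times> G u')" by (simp add: card_cartesian_product)
    also have "\<dots> \<le> card (Q \<union> (N1 \<union> N2))"
      using fin3 by (intro card_mono) (auto simp: Q_def N1_def N2_def)
    also have "\<dots> \<le> card Q + (card N1 + card N2)"
      by (meson add_left_mono card_Un_le order_trans)
    finally show ?thesis by (metis of_nat_add of_nat_le_iff of_nat_mult)
  qed
  moreover have "\<mu>\<^sup>2 / 2 + real (card (G u)) * (\<mu> / 8) + \<mu>\<^sup>2 / 8 \<le> real (card (G u)) * real (card (G u'))"
  proof -
    have "(7 / 8 * \<mu>) * (7 / 8 * \<mu> - \<mu> / 8) \<le> real (card (G u)) * (real (card (G u')) - \<mu> / 8)"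
      using cG[of u] cG[of u'] cl assms(5) by (intro mult_mono) (auto simp: u_def u'_def)
    moreover have "\<mu>\<^sup>2 / 2 + \<mu>\<^sup>2 / 8 \<le> (7 / 8 * \<mu>) * (7 / 8 * \<mu> - \<mu> / 8)"
      by (simp add: power2_eq_square)
    ultimately show ?thesis unfolding right_diff_distrib by linarith
  qed
  \<comment> \<open>Each remaining pair, together with one of its representations, is one choice of the three parameters, and the
    parameters determine it.\<close>
  ultimately have cQ: "\<mu>\<^sup>2 / 2 \<le> card Q" by linarith
  define W where "W = (\<lambda>(z, z'). {w \<in> A. w \<oplus> (u \<otimes> z \<ominus> u' \<otimes> z') \<in> A})"
  have fW: "finite (W p)" for p using fA by (simp add: W_def split: prod.split)
  have "\<mu>\<^sup>2 / 2 * \<eta> \<le> real (card Q) * \<eta>" using cQ assms(6) by (intro mult_right_mono)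
  also have "\<dots> = (\<Sum>p\<in>Q. \<eta>)" by simp
  also have "\<dots> \<le> (\<Sum>p\<in>Q. real (card (W p)))"
    by (rule sum_mono) (auto simp: Q_def W_def diff_reps_def)
  also have "\<dots> = real (card (Sigma Q W))" using fin3(3) fW by simp
  also have "card (Sigma Q W) \<le> card ?C"
  proof (rule card_inj_on_le[where f = "\<lambda>((z, z'), w). (b \<otimes> (x \<ominus> z), b' \<otimes> (x \<ominus> z'), w \<oplus> (u \<otimes> z \<ominus> u' \<otimes> z'))"])
    have zz: "z = x \<ominus> (x \<ominus> z)" if "z \<in> A" for z using AH[OF that] AH[OF x] H_car by algebra
    show "inj_on (\<lambda>((z, z'), w). (b \<otimes> (x \<ominus> z), b' \<otimes> (x \<ominus> z'), w \<oplus> (u \<otimes> z \<ominus> u' \<otimes> z'))) (Sigma Q W)"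
    proof (rule inj_onI)
      fix p p' :: "('a \<times> 'a) \<times> 'a"
      assume p: "p \<in> Sigma Q W" "p' \<in> Sigma Q W"
        and pe: "(case p of (x', w) \<Rightarrow> (case x' of (z, z') \<Rightarrow> \<lambda>w. (b \<otimes> (x \<ominus> z), b' \<otimes> (x \<ominus> z'), w \<oplus> (u \<otimes> z \<ominus> u' \<otimes> z'))) w)
          = (case p' of (x', w) \<Rightarrow> (case x' of (z, z') \<Rightarrow> \<lambda>w. (b \<otimes> (x \<ominus> z), b' \<otimes> (x \<ominus> z'), w \<oplus> (u \<otimes> z \<ominus> u' \<otimes> z'))) w)"
      obtain z z' w y y' v where pp: "p = ((z, z'), w)" "p' = ((y, y'), v)" by (metis surj_pair)
      have q: "(z, z') \<in> Q" "w \<in> W (z, z')" "(y, y') \<in> Q" "v \<in> W (y, y')"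
        using p pp by auto
      have e: "b \<otimes> (x \<ominus> z) = b \<otimes> (x \<ominus> y)" "b' \<otimes> (x \<ominus> z') = b' \<otimes> (x \<ominus> y')"
          "w \<oplus> (u \<otimes> z \<ominus> u' \<otimes> z') = v \<oplus> (u \<otimes> y \<ominus> u' \<otimes> y')"
        using pe pp by auto
      have A: "z \<in> A" "z' \<in> A" "y \<in> A" "y' \<in> A" "w \<in> A" "v \<in> A"
        using q by (auto simp: Q_def G_def W_def)
      note C = this[THEN AH, THEN H_car]
      have "x \<ominus> z = x \<ominus> y" "x \<ominus> z' = x \<ominus> y'"
        using e(1,2) C AH[OF x] assms(2,3) by (auto simp: m_lcancel)
      then have 1: "z = y" "z' = y'" using zz A by metis+
      moreover have "w = v" using e(3) C uH unfolding 1 by simp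
      ultimately show "p = p'" using pp by simp
    qed
    show "(\<lambda>((z, z'), w). (b \<otimes> (x \<ominus> z), b' \<otimes> (x \<ominus> z'), w \<oplus> (u \<otimes> z \<ominus> u' \<otimes> z'))) ` (Sigma Q W) \<subseteq> ?C"
    proof (rule image_subsetI)
      fix p assume p: "p \<in> Sigma Q W"
      obtain z z' w where pp: "p = ((z, z'), w)" by (metis surj_pair)
      have q: "(z, z') \<in> Q" "w \<in> W (z, z')" using p pp by auto
      then have A: "z \<in> A" "z' \<in> A" "w \<in> A" and P: "x \<ominus> z \<in> popular \<tau>" "x \<ominus> z' \<in> popular \<tau>"
        and W: "w \<oplus> (u \<otimes> z \<ominus> u' \<otimes> z') \<in> A"
        by (auto simp: Q_def G_def W_def)
      define c c' where "c = u \<otimes> z" and "c' = u' \<otimes> z'"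
      have C: "z \<in> carrier R" "z' \<in> carrier R" "w \<in> carrier R" "x \<in> carrier R" "b \<in> carrier R" "b' \<in> carrier R" "b0 \<in> carrier R"
          "c \<in> carrier R" "c' \<in> carrier R"
        using A x AH assms uH by (auto simp: c_def c'_def)
      have "b \<otimes> (x \<ominus> z) \<ominus> b' \<otimes> (x \<ominus> z') \<oplus> b0 \<otimes> (w \<oplus> (c \<ominus> c'))
          = (b \<ominus> b') \<otimes> x \<oplus> b0 \<otimes> w \<oplus> (b0 \<otimes> c \<ominus> b \<otimes> z) \<ominus> (b0 \<otimes> c' \<ominus> b' \<otimes> z')"
        using C by algebra
      also have "\<dots> = (b \<ominus> b') \<otimes> x \<oplus> b0 \<otimes> w"
        using C b0u A by (simp add: c_def c'_def a_minus_def r_neg)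
      finally have "(b \<ominus> b') \<otimes> x \<oplus> b0 \<otimes> w = b \<otimes> (x \<ominus> z) \<ominus> b' \<otimes> (x \<ominus> z') \<oplus> b0 \<otimes> (w \<oplus> (c \<ominus> c'))" ..
      then show "(case p of (x', w) \<Rightarrow> (case x' of (z, z') \<Rightarrow> \<lambda>w. (b \<otimes> (x \<ominus> z), b' \<otimes> (x \<ominus> z'), w \<oplus> (u \<otimes> z \<ominus> u' \<otimes> z'))) w) \<in> ?C"
        using A W popular_scale[OF assms(2) P(1)] popular_scale[OF assms(3) P(2)] pp by (auto simp: c_def c'_def)
    qed
    show "finite ?C" by (rule finite_subset[of _ "popular \<tau> \<times> popular \<tau> \<times> A"]) (use fA in auto)
  qed
  finally show ?thesis by simp
qed

end

section \<open>Ratio sets and the pivot argument\<close>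

context finite_field_subgroup begin

text \<open>Two applications of \<open>capture\<close>, one for each coordinate, and averaging over the parameters confine
the values of \<open>(b3 - b4) x + (b1 - b2) y\<close> on a proportion of \<open>\<Omega>\<close> to a translate of \<open>b0 (A - A)\<close>,
which is smaller than that proportion of \<open>\<Omega>\<close>.  Bounding iterated sumsets is avoided
altogether; this is where the exponent \<open>33\<close> is decided.\<close>

lemma collision:
  assumes A: "A \<subseteq> H" "A \<noteq> {}" and b: "b1 \<in> core A" "b2 \<in> core A" "b3 \<in> core A" "b4 \<in> core A"
    and \<mu>: "\<mu> = (real (card A))\<^sup>2 / (64 * real t)" and "0 \<le> \<eta>"
    and good: "\<And>a. a \<in> A \<Longrightarrow> real (card {c \<in> A. a \<ominus> c \<notin> popular \<tau>}) \<le> \<mu> / 8"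
    and \<eta>: "real (card (popular \<tau>)) * \<eta> \<le> \<mu>\<^sup>2 / 8"
    and D: "finite D" "\<And>a a'. a \<in> A \<Longrightarrow> a' \<in> A \<Longrightarrow> a \<ominus> a' \<in> D"
    and \<Omega>: "\<Omega> \<subseteq> A \<times> A"
    and large: "((real (card (popular \<tau>)))\<^sup>2 * card A)\<^sup>2 * card D < card \<Omega> * (\<mu>\<^sup>2 / 2 * \<eta>)\<^sup>2"
  shows "\<exists>p\<in>\<Omega>. \<exists>p'\<in>\<Omega>. p \<noteq> p' \<and> (b3 \<ominus> b4) \<otimes> fst p \<oplus> (b1 \<ominus> b2) \<otimes> snd p = (b3 \<ominus> b4) \<otimes> fst p' \<oplus> (b1 \<ominus> b2) \<otimes> snd p'"
proof -
  have fA: "finite A" by (rule finite_subset[OF A(1) H_fin])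
  have AH: "x \<in> H" if "x \<in> A" for x using that A(1) by auto
  have bA: "b1 \<in> A" "b2 \<in> A" "b3 \<in> A" "b4 \<in> A" using b core_sub by auto
  have "card {b1, b2, b3, b4} \<le> 7" by (simp add: card_insert_if)
  then obtain b0 where b0: "b0 \<in> A" "\<And>a. a \<in> {b1, b2, b3, b4} \<Longrightarrow> close A a b0"
    using common_close[OF A, of "{b1, b2, b3, b4}"] b by auto
  have "0 \<le> \<mu>" by (simp add: \<mu>)
  define T where "T = popular \<tau> \<times> popular \<tau> \<times> A"
  define g where "g \<theta> = fst \<theta> \<ominus> fst (snd \<theta>) \<oplus> b0 \<otimes> snd (snd \<theta>)" for \<theta>
  define C where "C b b' x = {\<theta> \<in> T. \<exists>w\<in>A. (b \<ominus> b') \<otimes> x \<oplus> b0 \<otimes> w = g \<theta>}" for b b' x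
  define \<kappa> where "\<kappa> = \<mu>\<^sup>2 / 2 * \<eta>"
  have \<kappa>0: "0 \<le> \<kappa>" using \<open>0 \<le> \<eta>\<close> by (simp add: \<kappa>_def)
  have fT: "finite T" using fA by (simp add: T_def)
  have cT: "real (card T) = (real (card (popular \<tau>)))\<^sup>2 * card A"
    by (simp add: T_def card_cartesian_product power2_eq_square)
  have cap: "\<kappa> \<le> real (card (C b b' x))" if "b \<in> {b1, b2, b3, b4}" "b' \<in> {b1, b2, b3, b4}" "x \<in> A" for b b' x
    unfolding \<kappa>_def C_def T_def g_def
    by (rule capture[OF A(1) _ _ AH[OF b0(1)] \<open>0 \<le> \<mu>\<close> \<open>0 \<le> \<eta>\<close> good _ _ \<eta> that(3)])
       (use that bA AH b0(2)[OF that(1)] b0(2)[OF that(2)] in \<open>auto simp: close_def \<mu>\<close>)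
  \<comment> \<open>The second coordinate is captured with \<open>b2 - b1\<close>, so that subtracting the two captured relations
    yields a difference of \<open>A\<close>, whereas \<open>b1 - b2\<close> would yield a sum.\<close>
  define Q where "Q p \<theta> \<longleftrightarrow> fst \<theta> \<in> C b3 b4 (fst p) \<and> snd \<theta> \<in> C b2 b1 (snd p)" for p \<theta>
  have f\<Omega>: "finite \<Omega>" using \<Omega> fA finite_subset by blast
  have QC: "\<kappa>\<^sup>2 \<le> real (card {\<theta> \<in> T \<times> T. Q p \<theta>})" if "p \<in> \<Omega>" for p
  proof -
    have "{\<theta> \<in> T \<times> T. Q p \<theta>} = C b3 b4 (fst p) \<times> C b2 b1 (snd p)"
      by (auto simp: Q_def C_def)
    then have "real (card {\<theta> \<in> T \<times> T. Q p \<theta>}) = real (card (C b3 b4 (fst p))) * real (card (C b2 b1 (snd p)))"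
      by (simp add: card_cartesian_product)
    moreover have "fst p \<in> A" "snd p \<in> A" using that \<Omega> by auto
    ultimately show ?thesis using cap \<kappa>0 by (auto simp: power2_eq_square intro!: mult_mono)
  qed
  have pos: "0 < card \<Omega> * \<kappa>\<^sup>2" by (rule le_less_trans[OF _ large[folded \<kappa>_def]]) simp
  then have "\<Omega> \<noteq> {}" "0 < \<kappa>\<^sup>2" using \<kappa>0 by (auto simp: zero_less_mult_iff)
  then obtain p where "p \<in> \<Omega>" by auto
  have "T \<noteq> {}"
  proof
    assume "T = {}"
    then show False using QC[OF \<open>p \<in> \<Omega>\<close>] \<open>0 < \<kappa>\<^sup>2\<close> by simp
  qed
  then have "\<exists>\<theta>\<in>T \<times> T. real (card \<Omega>) * \<kappa>\<^sup>2 \<le> real (card (T \<times> T)) * real (card {p \<in> \<Omega>. Q p \<theta>})"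
    using fT by (intro popular_column[OF f\<Omega> _ _ QC]) auto
  then obtain \<theta> where \<theta>: "\<theta> \<in> T \<times> T"
     "real (card \<Omega>) * \<kappa>\<^sup>2 \<le> real (card (T \<times> T)) * real (card {p \<in> \<Omega>. Q p \<theta>})"
    by blast
  define \<Omega>' where "\<Omega>' = {p \<in> \<Omega>. Q p \<theta>}"
  define val where "val p = (b3 \<ominus> b4) \<otimes> fst p \<oplus> (b1 \<ominus> b2) \<otimes> snd p" for p
  have "(real (card T))\<^sup>2 * card D < (real (card T))\<^sup>2 * card \<Omega>'"
    using le_less_trans[OF _ less_le_trans[OF large[folded cT \<kappa>_def] \<theta>(2)], OF order_refl]
    by (simp add: \<Omega>'_def card_cartesian_product power2_eq_square)
  then have less: "card D < card \<Omega>'" by (simp add: mult_less_cancel_left)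
  have val: "val p \<in> (\<lambda>z. g (fst \<theta>) \<ominus> g (snd \<theta>) \<oplus> b0 \<otimes> z) ` D" if p: "p \<in> \<Omega>'" for p
  proof -
    have pA: "fst p \<in> A" "snd p \<in> A" using p \<Omega> by (auto simp: \<Omega>'_def)
    obtain w w' where w: "w \<in> A" "w' \<in> A" "(b3 \<ominus> b4) \<otimes> fst p \<oplus> b0 \<otimes> w = g (fst \<theta>)"
        "(b2 \<ominus> b1) \<otimes> snd p \<oplus> b0 \<otimes> w' = g (snd \<theta>)"
      using p by (auto simp: \<Omega>'_def Q_def C_def)
    have "g (fst \<theta>) \<ominus> g (snd \<theta>) \<oplus> b0 \<otimes> (w' \<ominus> w) = val p"
      using w(1,2) pA bA b0(1) AH H_car unfolding w(3,4)[symmetric] val_def by algebra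
    then show ?thesis using D(2)[OF w(2,1)] by (metis image_eqI)
  qed
  have "card (val ` \<Omega>') \<le> card D"
    using val D(1) by (meson card_image_le card_mono finite_imageI image_subsetI order_trans)
  then have "\<not> inj_on val \<Omega>'" using less card_image by fastforce
  then show ?thesis unfolding inj_on_def val_def \<Omega>'_def by blast
qed

definition ratios where
  "ratios B = {\<rho> \<in> carrier R. \<exists>b1\<in>B. \<exists>b2\<in>B. \<exists>b3\<in>B. \<exists>b4\<in>B. b3 \<noteq> b4 \<and> \<rho> \<otimes> (b3 \<ominus> b4) = b1 \<ominus> b2}"

text \<open>Membership in \<open>ratios B\<close> means a single collision of \<open>(x, y) \<mapsto> x + \<rho> y\<close> on \<open>B \<times> B\<close>.  The predicate
says that one collision forces a collision on every set of more than \<open>N\<close> pairs; this gap turns the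
following closure properties into exact ones.\<close>

definition colliding where
  "colliding N B \<longleftrightarrow> (\<forall>\<rho>\<in>ratios B. \<forall>\<Omega>. \<Omega> \<subseteq> B \<times> B \<longrightarrow> N < real (card \<Omega>) \<longrightarrow>
     (\<exists>p\<in>\<Omega>. \<exists>p'\<in>\<Omega>. p \<noteq> p' \<and> fst p \<oplus> \<rho> \<otimes> snd p = fst p' \<oplus> \<rho> \<otimes> snd p'))"

lemma ratiosI:
  assumes "B \<subseteq> carrier R" "x \<in> B" "x' \<in> B" "y \<in> B" "y' \<in> B" "\<rho> \<in> carrier R" "(x, y) \<noteq> (x', y')"
    "x \<oplus> \<rho> \<otimes> y = x' \<oplus> \<rho> \<otimes> y'"
  shows "\<rho> \<in> ratios B"
proof -
  have C: "x \<in> carrier R" "x' \<in> carrier R" "y \<in> carrier R" "y' \<in> carrier R" using assms by auto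
  have "y' \<noteq> y"
  proof
    assume "y' = y"
    then have "x = x'" using assms(8) C assms(6) by simp
    then show False using assms(7) \<open>y' = y\<close> by simp
  qed
  moreover have "\<rho> \<otimes> (y' \<ominus> y) = x \<ominus> x'"
  proof -
    have "\<rho> \<otimes> (y' \<ominus> y) = (x' \<oplus> \<rho> \<otimes> y') \<ominus> x' \<ominus> \<rho> \<otimes> y" using C assms(6) by algebra
    also have "\<dots> = (x \<oplus> \<rho> \<otimes> y) \<ominus> x' \<ominus> \<rho> \<otimes> y" using assms(8) by simp
    also have "\<dots> = x \<ominus> x'" using C assms(6) by algebra
    finally show ?thesis .
  qed
  ultimately show ?thesis using assms unfolding ratios_def by blast
qed

text \<open>A collision of \<open>(w, y) \<mapsto> w + \<rho> y\<close> becomes one of \<open>(x, y) \<mapsto> x + (1 + \<rho>) y\<close> after the substitution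
\<open>x = w - y + s\<close>, which must stay inside \<open>B\<close>.\<close>

lemma ratios_add_one:
  assumes B: "B \<subseteq> carrier R" and "colliding N B" "\<rho> \<in> ratios B" "s \<in> B"
    and N: "N < real (card {p \<in> B \<times> B. fst p \<ominus> snd p \<oplus> s \<in> B})"
  shows "\<one> \<oplus> \<rho> \<in> ratios B"
proof -
  have \<rho>: "\<rho> \<in> carrier R" using assms by (simp add: ratios_def)
  let ?\<Omega> = "{p \<in> B \<times> B. fst p \<ominus> snd p \<oplus> s \<in> B}"
  obtain p p' where p: "p \<in> ?\<Omega>" "p' \<in> ?\<Omega>" "p \<noteq> p'" "fst p \<oplus> \<rho> \<otimes> snd p = fst p' \<oplus> \<rho> \<otimes> snd p'"
    using assms(2,3) N unfolding colliding_def by (metis (no_types, lifting) mem_Collect_eq subsetI)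
  obtain w y w' y' where pp: "p = (w, y)" "p' = (w', y')" by (metis surj_pair)
  have m: "w \<in> B" "y \<in> B" "w' \<in> B" "y' \<in> B" using p pp by auto
  have C: "w \<in> carrier R" "w' \<in> carrier R" "y \<in> carrier R" "y' \<in> carrier R" "s \<in> carrier R"
    using m B assms(4) by auto
  have e: "w \<oplus> \<rho> \<otimes> y = w' \<oplus> \<rho> \<otimes> y'" using p pp by simp
  show ?thesis
  proof (rule ratiosI[OF B, of "w \<ominus> y \<oplus> s" "w' \<ominus> y' \<oplus> s" y y'])
    have "w \<ominus> y \<oplus> s \<oplus> (\<one> \<oplus> \<rho>) \<otimes> y = (w \<oplus> \<rho> \<otimes> y) \<oplus> s" using C \<rho> by algebra
    also have "\<dots> = (w' \<oplus> \<rho> \<otimes> y') \<oplus> s" using e by simp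
    also have "\<dots> = w' \<ominus> y' \<oplus> s \<oplus> (\<one> \<oplus> \<rho>) \<otimes> y'" using C \<rho> by algebra
    finally show "w \<ominus> y \<oplus> s \<oplus> (\<one> \<oplus> \<rho>) \<otimes> y = w' \<ominus> y' \<oplus> s \<oplus> (\<one> \<oplus> \<rho>) \<otimes> y'" .
    show "(w \<ominus> y \<oplus> s, y) \<noteq> (w' \<ominus> y' \<oplus> s, y')"
    proof
      assume "(w \<ominus> y \<oplus> s, y) = (w' \<ominus> y' \<oplus> s, y')"
      then have "y = y'" by simp
      then have "w = w'" using e C \<rho> by simp
      then show False using \<open>y = y'\<close> p(3) pp by simp
    qed
  qed (use p pp m \<rho> in auto)
qed

text \<open>A collision on pairs \<open>(x, u y)\<close> for \<open>\<rho>\<close> is a collision on pairs \<open>(x, y)\<close> for \<open>u \<rho>\<close>.\<close>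

lemma ratios_mult:
  assumes B: "B \<subseteq> H" and "colliding N B" "\<rho> \<in> ratios B" "u \<in> H"
    and N: "N < real (card B) * real (quot_reps B u)"
  shows "u \<otimes> \<rho> \<in> ratios B"
proof -
  have BH: "x \<in> H" if "x \<in> B" for x using that B by auto
  have \<rho>: "\<rho> \<in> carrier R" using assms by (simp add: ratios_def)
  let ?Y = "{y \<in> B. u \<otimes> y \<in> B}"
  let ?\<Omega> = "B \<times> ((\<otimes>) u ` ?Y)"
  have "inj_on ((\<otimes>) u) ?Y" using assms(4) BH by (auto simp: inj_on_def m_lcancel)
  then have "card ?\<Omega> = card B * quot_reps B u" by (simp add: card_cartesian_product quot_reps_def card_image)
  then have "N < real (card ?\<Omega>)" using N by simp
  moreover have "?\<Omega> \<subseteq> B \<times> B" by auto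
  ultimately have "\<exists>p\<in>?\<Omega>. \<exists>p'\<in>?\<Omega>. p \<noteq> p' \<and> fst p \<oplus> \<rho> \<otimes> snd p = fst p' \<oplus> \<rho> \<otimes> snd p'"
    using assms(2)[unfolded colliding_def, rule_format, OF assms(3), of ?\<Omega>] by fast
  then obtain p p' where p: "p \<in> ?\<Omega>" "p' \<in> ?\<Omega>" "p \<noteq> p'" "fst p \<oplus> \<rho> \<otimes> snd p = fst p' \<oplus> \<rho> \<otimes> snd p'"
    by (elim bexE conjE)
  obtain x y x' y' where pp: "p = (x, u \<otimes> y)" "p' = (x', u \<otimes> y')" "x \<in> B" "y \<in> B" "x' \<in> B" "y' \<in> B"
    using p(1,2) by auto
  have C: "y \<in> carrier R" "y' \<in> carrier R" "u \<in> carrier R" using pp BH assms(4) by auto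
  have "u \<otimes> \<rho> \<otimes> y = \<rho> \<otimes> (u \<otimes> y)" "u \<otimes> \<rho> \<otimes> y' = \<rho> \<otimes> (u \<otimes> y')" using C \<rho> by algebra+
  then have "x \<oplus> u \<otimes> \<rho> \<otimes> y = x' \<oplus> u \<otimes> \<rho> \<otimes> y'" using p pp by simp
  then show ?thesis
    using pp p(3) C \<rho> B H_car' by (intro ratiosI[of B x x' y y']) auto
qed

text \<open>Supplies the \<open>s\<close> for \<open>ratios_add_one\<close>: the popular differences are few, so \<open>B\<close> has many
additive quadruples \<open>w - y = x - s\<close>, and some \<open>s\<close> occurs in many of them.\<close>

lemma popular_translate:
  assumes B: "B \<subseteq> H" and S: "(real (card B))\<^sup>2 / 2 \<le> real (card {p \<in> B \<times> B. fst p \<ominus> snd p \<in> popular \<tau>})"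
    and "0 \<le> N" "real (card (popular \<tau>)) * (real (card B) * N) < ((real (card B))\<^sup>2 / 2)\<^sup>2"
  shows "\<exists>s\<in>B. N < real (card {p \<in> B \<times> B. fst p \<ominus> snd p \<oplus> s \<in> B})"
proof (rule ccontr)
  assume "\<not> ?thesis"
  then have le: "real (card {p \<in> B \<times> B. fst p \<ominus> snd p \<oplus> s \<in> B}) \<le> N" if "s \<in> B" for s using that by force
  have fB: "finite B" by (rule finite_subset[OF B H_fin])
  have BC: "x \<in> carrier R" if "x \<in> B" for x using that B by (auto intro: H_car)
  let ?S = "{p \<in> B \<times> B. fst p \<ominus> snd p \<in> popular \<tau>}"
  let ?K = "{(p, p') \<in> ?S \<times> ?S. fst p \<ominus> snd p = fst p' \<ominus> snd p'}"
  have fS: "finite ?S" using fB by simp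
  have fK: "finite ?K" by (rule finite_subset[of _ "?S \<times> ?S"]) (use fS in auto)
  have "real (card ?K) \<le> real (card B) * N"
  proof (rule card_le_by_fibres[where f = "\<lambda>(p, p'). snd p'"])
    fix s assume "s \<in> (\<lambda>(p, p'). snd p') ` ?K"
    then have s: "s \<in> B" by auto
    have eq: "fst p' = fst p \<ominus> snd p \<oplus> s" if "p \<in> B \<times> B" "p' \<in> B \<times> B" "fst p \<ominus> snd p = fst p' \<ominus> snd p'" "snd p' = s" for p p'
    proof -
      have C: "fst p' \<in> carrier R" "snd p' \<in> carrier R" using BC that(2) by auto
      have "fst p' = fst p' \<ominus> snd p' \<oplus> snd p'" using C by algebra
      then show ?thesis using that by simp
    qed
    have "card {q \<in> ?K. (\<lambda>(p, p'). snd p') q = s} \<le> card {p \<in> B \<times> B. fst p \<ominus> snd p \<oplus> s \<in> B}"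
    proof (rule card_inj_on_le[where f = fst])
      show "inj_on fst {q \<in> ?K. (\<lambda>(p, p'). snd p') q = s}"
      proof (rule inj_onI)
        fix q r assume q: "q \<in> {q \<in> ?K. (\<lambda>(p, p'). snd p') q = s}" "r \<in> {q \<in> ?K. (\<lambda>(p, p'). snd p') q = s}" "fst q = fst r"
        have "fst (snd q) = fst (fst q) \<ominus> snd (fst q) \<oplus> s" using q(1) by (intro eq) auto
        moreover have "fst (snd r) = fst (fst r) \<ominus> snd (fst r) \<oplus> s" using q(2) by (intro eq) auto
        ultimately show "q = r" using q by (auto simp: prod_eq_iff)
      qed
      show "fst ` {q \<in> ?K. (\<lambda>(p, p'). snd p') q = s} \<subseteq> {p \<in> B \<times> B. fst p \<ominus> snd p \<oplus> s \<in> B}"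
      proof (rule image_subsetI)
        fix q assume q: "q \<in> {q \<in> ?K. (\<lambda>(p, p'). snd p') q = s}"
        have "fst (snd q) = fst (fst q) \<ominus> snd (fst q) \<oplus> s" using q by (intro eq) auto
        then show "fst q \<in> {p \<in> B \<times> B. fst p \<ominus> snd p \<oplus> s \<in> B}" using q by (auto simp: mem_Times_iff)
      qed
    qed (use fB in auto)
    then show "real (card {q \<in> ?K. (\<lambda>(p, p'). snd p') q = s}) \<le> N" using le[OF s] by linarith
  qed (use fB fK assms(3) in auto)
  then have "real (card (popular \<tau>)) * real (card ?K) \<le> real (card (popular \<tau>)) * (real (card B) * N)"
    by (intro mult_left_mono) auto
  moreover have "(real (card ?S))\<^sup>2 \<le> real (card (popular \<tau>)) * real (card ?K)"
    by (rule card_square_le_collisions) (use fS in auto)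
  moreover have "((real (card B))\<^sup>2 / 2)\<^sup>2 \<le> (real (card ?S))\<^sup>2" using S by (intro power_mono) auto
  ultimately show False using assms(4) by linarith
qed

text \<open>If the differences lie in a union \<open>D\<close> of cosets of \<open>H\<close>, each ratio arises from at least \<open>t\<close> pairs of \<open>D\<close>, all
scaled by a common element of \<open>H\<close>.\<close>

lemma card_ratios:
  assumes "B \<subseteq> carrier R" "\<And>a b. a \<in> B \<Longrightarrow> b \<in> B \<Longrightarrow> a \<ominus> b \<in> D" "\<And>h z. h \<in> H \<Longrightarrow> z \<in> D \<Longrightarrow> h \<otimes> z \<in> D" "D \<subseteq> carrier R"
  shows "real (card (ratios B)) * real t \<le> (real (card D))\<^sup>2"
proof -
  have fD: "finite D" using fin assms(4) finite_subset by blast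
  let ?S = "{p \<in> D \<times> D. snd p \<noteq> \<zero>}"
  have "real (card (ratios B)) * real t \<le> real (card ?S)"
  proof (rule card_ge_by_fibres[where f = "\<lambda>p. fst p \<otimes> inv (snd p)" and Z = "carrier R"])
    show "finite ?S" using fD by simp
    show "(\<lambda>p. fst p \<otimes> inv (snd p)) ` ?S \<subseteq> carrier R"
    proof (rule image_subsetI)
      fix p assume "p \<in> ?S"
      then have "fst p \<in> carrier R" "snd p \<in> Units R" using assms(4) field_Units by auto
      then show "fst p \<otimes> inv (snd p) \<in> carrier R" by simp
    qed
    fix \<rho> assume "\<rho> \<in> ratios B"
    then obtain b1 b2 b3 b4 where b: "b1 \<in> B" "b2 \<in> B" "b3 \<in> B" "b4 \<in> B" "b3 \<noteq> b4" "\<rho> \<otimes> (b3 \<ominus> b4) = b1 \<ominus> b2"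
      and \<rho>: "\<rho> \<in> carrier R" by (auto simp: ratios_def)
    define z where "z = b3 \<ominus> b4"
    have C: "b3 \<in> carrier R" "b4 \<in> carrier R" using b assms(1) by auto
    have z: "z \<in> D" "z \<in> carrier R" "\<rho> \<otimes> z \<in> D" using assms(2) b C by (auto simp: z_def)
    have z0: "z \<noteq> \<zero>" using b(5) C by (simp add: z_def r_right_minus_eq)
    have "card H \<le> card {p \<in> ?S. fst p \<otimes> inv (snd p) = \<rho>}"
    proof (rule card_inj_on_le[where f = "\<lambda>h. (h \<otimes> (\<rho> \<otimes> z), h \<otimes> z)"])
      show "inj_on (\<lambda>h. (h \<otimes> (\<rho> \<otimes> z), h \<otimes> z)) H"
        using z z0 m_rcancel by (auto simp: inj_on_def)
      show "(\<lambda>h. (h \<otimes> (\<rho> \<otimes> z), h \<otimes> z)) ` H \<subseteq> {p \<in> ?S. fst p \<otimes> inv (snd p) = \<rho>}"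
      proof (rule image_subsetI)
        fix h assume h: "h \<in> H"
        have hz: "h \<otimes> z \<in> carrier R" "h \<otimes> z \<noteq> \<zero>" using h z z0 integral_iff by auto
        then have "h \<otimes> z \<in> Units R" using field_Units by auto
        moreover have "h \<otimes> (\<rho> \<otimes> z) = \<rho> \<otimes> (h \<otimes> z)" using H_car[OF h] \<rho> z(2) by (rule m_lcomm)
        ultimately have "h \<otimes> (\<rho> \<otimes> z) \<otimes> inv (h \<otimes> z) = \<rho>" using \<rho> hz by (simp add: m_assoc)
        then show "(h \<otimes> (\<rho> \<otimes> z), h \<otimes> z) \<in> {p \<in> ?S. fst p \<otimes> inv (snd p) = \<rho>}"
          using assms(3)[OF h] z hz by auto
      qed
    qed (use fD in auto)
    then show "real t \<le> real (card {p \<in> ?S. fst p \<otimes> inv (snd p) = \<rho>})" by (simp add: t_def)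
  qed (use fin in \<open>auto simp: ratios_def\<close>)
  also have "real (card ?S) \<le> real (card (D \<times> D))" using fD by (intro of_nat_mono card_mono) auto
  finally show ?thesis by (simp add: card_cartesian_product power2_eq_square)
qed

end

text \<open>Let \<open>St\<close> be the set of all \<open>x\<close> with \<open>S + x \<subseteq> S\<close>.  It is closed under addition, contains \<open>1\<close>, and is
mapped into itself by each \<open>u\<close> in \<open>U\<close>, because by finiteness \<open>u S = S\<close> and \<open>r + u x = u (r / u + x)\<close>.
The multipliers of \<open>St\<close> then form a finite subring, which is therefore a field; it lies in \<open>St\<close>
since \<open>1 \<in> St\<close>, and in \<open>S\<close> since \<open>0 \<in> S\<close>.\<close>

lemma (in field) finite_add_mult_closed_subfield:
  assumes S: "finite S" "S \<subseteq> carrier R" "\<zero> \<in> S" "\<And>x. x \<in> S \<Longrightarrow> \<one> \<oplus> x \<in> S"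
    and U: "U \<subseteq> carrier R - {\<zero>}" "\<And>u x. u \<in> U \<Longrightarrow> x \<in> S \<Longrightarrow> u \<otimes> x \<in> S"
  obtains L where "L \<subseteq> S" "U \<subseteq> L" "subgroup L (add_monoid R)" "subgroup (L - {\<zero>}) (mult_of R)"
proof -
  define St where "St = {x \<in> carrier R. \<forall>r\<in>S. r \<oplus> x \<in> S}"
  define L where "L = {x \<in> carrier R. \<forall>y\<in>St. x \<otimes> y \<in> St}"
  have Sc: "x \<in> carrier R" if "x \<in> S" for x using that S by auto
  have Stc: "x \<in> carrier R" if "x \<in> St" for x using that by (simp add: St_def)
  have Lc: "x \<in> carrier R" if "x \<in> L" for x using that by (simp add: L_def)
  have one_St: "\<one> \<in> St" using S(4) Sc by (auto simp: St_def a_comm)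
  have zero_St: "\<zero> \<in> St" using Sc by (auto simp: St_def)
  have add_St: "x \<oplus> y \<in> St" if "x \<in> St" "y \<in> St" for x y
    using that Sc by (auto simp: St_def simp flip: a_assoc)
  have U_St: "u \<otimes> x \<in> St" if u: "u \<in> U" and x: "x \<in> St" for u x
  proof -
    have uc: "u \<in> carrier R" "u \<noteq> \<zero>" using u U(1) by auto
    have "inj_on ((\<otimes>) u) S" using uc Sc by (auto simp: inj_on_def m_lcancel)
    moreover have "(\<otimes>) u ` S \<subseteq> S" using U(2)[OF u] by auto
    ultimately have surj: "(\<otimes>) u ` S = S" using S(1) by (simp add: endo_inj_surj)
    have "r \<oplus> u \<otimes> x \<in> S" if "r \<in> S" for r
    proof -
      have "r \<in> (\<otimes>) u ` S" using that surj by simp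
      then obtain r' where r': "r' \<in> S" "r = u \<otimes> r'" by (elim imageE)
      have "r \<oplus> u \<otimes> x = u \<otimes> (r' \<oplus> x)" using r' uc Sc Stc[OF x] by (simp add: r_distr)
      then show ?thesis using U(2)[OF u] r'(1) x by (simp add: St_def)
    qed
    then show ?thesis using uc Stc[OF x] by (simp add: St_def)
  qed
  have L_St: "L \<subseteq> St" using one_St by (auto simp: L_def)
  have St_S: "St \<subseteq> S" using S(3) by (auto simp: St_def)
  have LS: "L \<subseteq> S" using L_St St_S by auto
  have fL: "finite L" using LS S(1) finite_subset by auto
  have one_L: "\<one> \<in> L" using Stc by (auto simp: L_def)
  have zero_L: "\<zero> \<in> L" using Stc zero_St by (auto simp: L_def)
  have add_L: "x \<oplus> y \<in> L" if "x \<in> L" "y \<in> L" for x y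
    using that Stc add_St by (auto simp: L_def l_distr)
  have mult_L: "x \<otimes> y \<in> L" if "x \<in> L" "y \<in> L" for x y
    using that Stc by (auto simp: L_def m_assoc)
  have minus_L: "\<ominus> x \<in> L" if x: "x \<in> L" for x
  proof -
    have "inj_on ((\<oplus>) x) L" using x Lc by (auto simp: inj_on_def)
    moreover have "(\<oplus>) x ` L \<subseteq> L" using add_L x by auto
    ultimately have "(\<oplus>) x ` L = L" using fL by (simp add: endo_inj_surj)
    then obtain y where "y \<in> L" "x \<oplus> y = \<zero>" using zero_L by (metis imageE)
    then show ?thesis using Lc x minus_equality a_comm by metis
  qed
  have inv_L: "inv x \<in> L - {\<zero>}" if x: "x \<in> L - {\<zero>}" for x
  proof -
    have "inj_on ((\<otimes>) x) L" using x Lc by (auto simp: inj_on_def m_lcancel)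
    moreover have "(\<otimes>) x ` L \<subseteq> L" using mult_L x by auto
    ultimately have "(\<otimes>) x ` L = L" using fL by (simp add: endo_inj_surj)
    then obtain y where y: "y \<in> L" "x \<otimes> y = \<one>" using one_L by (metis imageE)
    then have "y = inv x" using Lc x by (metis DiffD1 comm_inv_char)
    moreover have "y \<noteq> \<zero>" using y x Lc by auto
    ultimately show ?thesis using y by auto
  qed
  have "subgroup L (add_monoid R)"
    by (rule add.subgroupI) (use Lc add_L minus_L zero_L in \<open>auto simp: a_inv_def[symmetric]\<close>)
  moreover have "subgroup (L - {\<zero>}) (mult_of R)"
  proof (rule group.subgroupI[OF field_mult_group])
    show "inv\<^bsub>mult_of R\<^esub> a \<in> L - {\<zero>}" if "a \<in> L - {\<zero>}" for a
      using that Lc inv_L[OF that] m_inv_mult_of[of a] by auto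
    show "a \<otimes>\<^bsub>mult_of R\<^esub> b \<in> L - {\<zero>}" if "a \<in> L - {\<zero>}" "b \<in> L - {\<zero>}" for a b
      using that Lc mult_L integral_iff by auto
  qed (use Lc one_L in auto)
  moreover have "U \<subseteq> L" using U(1) U_St by (auto simp: L_def)
  ultimately show ?thesis using that LS by blast
qed

section \<open>Large energy forces a large intersection with a subfield\<close>

text \<open>The numerical condition for \<open>collision\<close> on sets of pairs of the size that occurs below.  Here \<open>a\<close> is the
size of the cluster, \<open>p\<close> bounds the number of popular differences for the small threshold and \<open>d\<close>
that of popular sums.  After inserting them the condition reads
\<open>2 ^ 190 t ^ 32 < a ^ 17 e ^ 16\<close>, and \<open>a \<ge> e / 4\<close>.\<close>

lemma threshold_arith:
  fixes a e t :: real
  assumes e: "0 < e" "e \<le> t" and a: "3 / 8 * e \<le> a" and big: "2 ^ 224 * t ^ 32 < e ^ 33"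
  defines "\<mu> \<equiv> a\<^sup>2 / (64 * t)" and "p \<equiv> 2 ^ 17 * t ^ 3 / e\<^sup>2" and "d \<equiv> 2 ^ 20 * t ^ 4 / e ^ 3"
  shows "(p\<^sup>2 * a)\<^sup>2 * d / (\<mu>\<^sup>2 / 2 * (\<mu>\<^sup>2 / (8 * p)))\<^sup>2 < a ^ 3 * e / (4096 * t\<^sup>2)"
proof -
  have pos: "0 < t" "0 < a" using e a by auto
  have "(p\<^sup>2 * a)\<^sup>2 * d / (\<mu>\<^sup>2 / 2 * (\<mu>\<^sup>2 / (8 * p)))\<^sup>2 = 2 ^ 178 * t ^ 30 / (e ^ 15 * a ^ 14)"
    using e(1) pos unfolding \<mu>_def p_def d_def
    by (simp add: power_divide power_mult_distrib divide_simps flip: power_mult power_add)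
       (simp add: power_add[of t 12 18, simplified] power_add[of e 11 4, simplified]
          power_add[of a 2 14, simplified] mult_ac)
  also have "\<dots> < a ^ 3 * e / (4096 * t\<^sup>2)"
  proof -
    have "(e / 4) ^ 17 \<le> a ^ 17" using a e by (intro power_mono) auto
    then have "e ^ 17 \<le> 2 ^ 34 * a ^ 17" by (simp add: power_divide divide_le_eq)
    then have "e ^ 17 * e ^ 16 \<le> 2 ^ 34 * a ^ 17 * e ^ 16" using e by (intro mult_right_mono) auto
    then have "2 ^ 224 * t ^ 32 < 2 ^ 34 * (a ^ 17 * e ^ 16)" using big by (simp add: mult.assoc flip: power_add)
    then have "2 ^ 190 * t ^ 32 < a ^ 17 * e ^ 16" by simp
    then have "2 ^ 178 * t ^ 30 * (4096 * t\<^sup>2) < a ^ 3 * e * (e ^ 15 * a ^ 14)"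
      by (simp add: power_add[of t 30 2, simplified] mult_ac power_add[of a 3 14, simplified] power_add[of e 1 15, simplified])
    then show ?thesis using pos e by (simp add: divide_simps mult_ac)
  qed
  finally show ?thesis .
qed

context finite_field_subgroup begin

text \<open>The sum-product theorem for multiplicative subgroups.  The three nested sets of the proof serve
different purposes: differences of \<open>A\<close> are controlled, elements of \<open>B\<close> are multiplicatively close to most of
\<open>A\<close> (for \<open>capture\<close>), and elements of \<open>C\<close> are multiplicatively close to most of \<open>B\<close> (for \<open>ratios_mult\<close>).\<close>

theorem large_energy_imp_subfield:
  assumes big: "2 ^ 224 * real t ^ 32 < avg_energy ^ 33"
  obtains L where "subgroup L (add_monoid R)" "subgroup (L - {\<zero>}) (mult_of R)"
    "real (card L) \<le> 2 ^ 40 * real t ^ 7 / avg_energy ^ 6" "avg_energy / 4 \<le> card (H \<inter> L)"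
proof -
  define e where "e = avg_energy"
  have e: "0 < e" "e \<le> t" using avg_energy_pos avg_energy_le by (auto simp: e_def)
  have t1: "1 \<le> real t" using t_pos by simp
  \<comment> \<open>Needed only to provide two distinct elements of \<open>B\<close>.\<close>
  have e64: "64 < e"
  proof (rule ccontr)
    assume "\<not> 64 < e"
    then have "e ^ 33 \<le> 64 ^ 33" using e by (intro power_mono) auto
    also have "(64::real) ^ 33 \<le> 2 ^ 224 * 1" by simp
    also have "\<dots> \<le> 2 ^ 224 * real t ^ 32" using t1 by (intro mult_left_mono one_le_power) auto
    finally show False using big by (simp add: e_def)
  qed
  \<comment> \<open>Small enough that the unpopular partners of an element fill at most an eighth of any intersection \<open>b A
    \<inter> b0 A\<close> of close dilates, whose size is at least \<open>\<mu> = \<alpha>\<^sup>2 / (64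
    t)\<close>.\<close>
  define \<epsilon> where "\<epsilon> = e / (2 ^ 17 * real t)"
  have \<epsilon>: "0 < \<epsilon>" using e t_pos by (simp add: \<epsilon>_def)
  obtain A where A: "A \<subseteq> H" "3 / 8 * e \<le> card A"
    "\<And>a. a \<in> A \<Longrightarrow> real (card {b \<in> A. a \<ominus> b \<notin> popular (e / 512)}) \<le> card A / 6"
    "\<And>a. a \<in> A \<Longrightarrow> real (card {b \<in> A. a \<ominus> b \<notin> popular (\<epsilon> * e)}) \<le> 86 * \<epsilon> * card A"
    using cluster_exists[OF \<epsilon>] unfolding e_def by blast
  define \<alpha> where "\<alpha> = real (card A)"
  have \<alpha>: "3 / 8 * e \<le> \<alpha>" "0 < \<alpha>" using A(2) e by (auto simp: \<alpha>_def)
  have Ane: "A \<noteq> {}" using \<alpha> by (auto simp: \<alpha>_def)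
  have fA: "finite A" by (rule finite_subset[OF A(1) H_fin])
  define \<mu> where "\<mu> = \<alpha>\<^sup>2 / (64 * real t)"
  have \<mu>: "0 < \<mu>" using \<alpha> t_pos by (simp add: \<mu>_def)
  define p where "p = 2 ^ 17 * real t ^ 3 / e\<^sup>2"
  have p: "0 < p" using e t_pos by (simp add: p_def)
  define d where "d = 2 ^ 20 * real t ^ 4 / e ^ 3"
  \<comment> \<open>Popular differences with fewer than \<open>\<eta>\<close> representations in \<open>A\<close> spoil at most
    \<open>p * \<eta> = \<mu>\<^sup>2 / 8\<close> pairs.\<close>
  define \<eta> where "\<eta> = \<mu>\<^sup>2 / (8 * p)"
  have \<eta>: "0 < \<eta>" using \<mu> p by (simp add: \<eta>_def)
  define \<tau> where "\<tau> = \<epsilon> * e"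
  have P: "real (card (popular \<tau>)) \<le> p"
  proof -
    have "\<tau> * p = (real t)\<^sup>2" using e t_pos by (simp add: \<tau>_def \<epsilon>_def p_def field_simps power2_eq_square power3_eq_cube)
    then have "real (card (popular \<tau>)) * \<tau> \<le> p * \<tau>" using card_popular[of \<tau>] by (simp add: mult.commute)
    moreover have "0 < \<tau>" using \<epsilon> e by (simp add: \<tau>_def)
    ultimately show ?thesis by simp
  qed
  have Pc: "real (card (popular (e / 512))) \<le> 512 * (real t)\<^sup>2 / e"
    using card_popular[of "e / 512"] e by (simp add: field_simps)
  have good: "real (card {c \<in> A. a \<ominus> c \<notin> popular \<tau>}) \<le> \<mu> / 8" if "a \<in> A" for a
  proof -
    have "real (card {c \<in> A. a \<ominus> c \<notin> popular \<tau>}) \<le> 86 * \<epsilon> * \<alpha>" using A(4)[OF that] by (simp add: \<tau>_def \<alpha>_def)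
    also have "86 * \<epsilon> \<le> \<alpha> / (512 * real t)"
      using \<alpha>(1) e t_pos by (simp add: \<epsilon>_def field_simps)
    then have "86 * \<epsilon> * \<alpha> \<le> \<alpha> / (512 * real t) * \<alpha>" using \<alpha> by (intro mult_right_mono) auto
    also have "\<dots> = \<mu> / 8" by (simp add: \<mu>_def power2_eq_square)
    finally show ?thesis by simp
  qed
  define D where "D = popular_sums (e / 512) (2 / 3 * card A)"
  have Dc: "D \<subseteq> carrier R" by (auto simp: D_def popular_sums_def)
  have fD: "finite D" using fin Dc finite_subset by auto
  have AD: "a \<ominus> a' \<in> D" if "a \<in> A" "a' \<in> A" for a a'
    unfolding D_def by (rule diff_in_popular_sums[OF A(1) A(3) that])
  have d: "real (card D) \<le> d"
  proof -
    have "real (card D) * (2 / 3 * \<alpha>) \<le> (real (card (popular (e / 512))))\<^sup>2"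
      using card_popular_sums[of "e / 512" "2 / 3 * card A"] by (simp add: D_def \<alpha>_def)
    also have "\<dots> \<le> (512 * (real t)\<^sup>2 / e)\<^sup>2" using Pc by (intro power_mono) auto
    also have "\<dots> = d * (e / 4)" using e
      by (simp add: d_def power_divide field_simps power2_eq_square power3_eq_cube eval_nat_numeral)
    also have "\<dots> \<le> d * (2 / 3 * \<alpha>)" using \<alpha> e by (intro mult_left_mono) (auto simp: d_def)
    finally show ?thesis using \<alpha> by simp
  qed
  define B where "B = core A"
  define C where "C = core B"
  have BA: "B \<subseteq> A" by (simp add: B_def core_sub)
  have BH: "B \<subseteq> H" using BA A(1) by auto
  have BR: "B \<subseteq> carrier R" using BH H_car' by (rule order_trans)
  have CB: "C \<subseteq> B" by (simp add: C_def core_sub)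
  have fB: "finite B" by (rule finite_subset[OF BA fA])
  define \<beta> where "\<beta> = real (card B)"
  have \<beta>: "7 / 8 * \<alpha> \<le> \<beta>" using card_core[OF A(1)] by (simp add: B_def \<alpha>_def \<beta>_def)
  have cC: "7 / 8 * \<beta> \<le> card C" using card_core[OF BH] by (simp add: C_def \<beta>_def)
  have Ce: "e / 4 \<le> card C" using cC \<beta> \<alpha> e by linarith
  \<comment> \<open>The size above which \<open>collision\<close> applies to a set of pairs.\<close>
  define N where "N = (p\<^sup>2 * \<alpha>)\<^sup>2 * d / (\<mu>\<^sup>2 / 2 * \<eta>)\<^sup>2"
  have N0: "0 \<le> N" using p e by (simp add: N_def d_def)
  have Nless: "N < \<beta> ^ 3 * e / (2048 * (real t)\<^sup>2)"
  proof -
    have "N < \<alpha> ^ 3 * e / (4096 * (real t)\<^sup>2)"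
      unfolding N_def \<eta>_def \<mu>_def p_def d_def
      by (rule threshold_arith[OF e \<alpha>(1)]) (use big in \<open>simp add: e_def\<close>)
    also have "\<dots> \<le> \<beta> ^ 3 * e / (2048 * (real t)\<^sup>2)"
    proof -
      have "(7 / 8 * \<alpha>) ^ 3 \<le> \<beta> ^ 3" using \<beta> \<alpha> by (intro power_mono) auto
      moreover have "\<alpha> ^ 3 / 2 \<le> (7 / 8 * \<alpha>) ^ 3" using \<alpha> by (simp add: power_mult_distrib power_divide)
      ultimately have "\<alpha> ^ 3 / 2 \<le> \<beta> ^ 3" by linarith
      then have "\<alpha> ^ 3 / 2 * (e / (2048 * (real t)\<^sup>2)) \<le> \<beta> ^ 3 * (e / (2048 * (real t)\<^sup>2))"
        using e by (intro mult_right_mono) auto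
      then show ?thesis by simp
    qed
    finally show ?thesis .
  qed
  have coll: "colliding N B"
    unfolding colliding_def
  proof (intro ballI allI impI)
    fix \<rho> \<Omega> assume \<rho>: "\<rho> \<in> ratios B" and \<Omega>: "\<Omega> \<subseteq> B \<times> B" "N < real (card \<Omega>)"
    obtain b1 b2 b3 b4 where b: "b1 \<in> B" "b2 \<in> B" "b3 \<in> B" "b4 \<in> B" "b3 \<noteq> b4" "\<rho> \<otimes> (b3 \<ominus> b4) = b1 \<ominus> b2"
      and \<rho>c: "\<rho> \<in> carrier R" using \<rho> by (auto simp: ratios_def)
    have bc: "b1 \<in> carrier R" "b2 \<in> carrier R" "b3 \<in> carrier R" "b4 \<in> carrier R" using b BR by auto
    define z where "z = b3 \<ominus> b4"
    have z: "z \<in> carrier R" "z \<noteq> \<zero>" using b(5) bc by (auto simp: z_def r_right_minus_eq)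
    have "((real (card (popular \<tau>)))\<^sup>2 * card A)\<^sup>2 * card D \<le> (p\<^sup>2 * \<alpha>)\<^sup>2 * d"
      using P d p \<alpha> by (intro mult_mono power_mono) (auto simp: \<alpha>_def)
    also have "\<dots> = N * (\<mu>\<^sup>2 / 2 * \<eta>)\<^sup>2" using \<mu> \<eta> by (simp add: N_def)
    also have "\<dots> < card \<Omega> * (\<mu>\<^sup>2 / 2 * \<eta>)\<^sup>2" using \<Omega>(2) \<mu> \<eta> by (intro mult_strict_right_mono) auto
    finally have large: "((real (card (popular \<tau>)))\<^sup>2 * card A)\<^sup>2 * card D < card \<Omega> * (\<mu>\<^sup>2 / 2 * \<eta>)\<^sup>2" .
    have "real (card (popular \<tau>)) * \<eta> \<le> p * \<eta>" using P \<eta> by (intro mult_right_mono) auto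
    then have \<eta>P: "real (card (popular \<tau>)) * \<eta> \<le> \<mu>\<^sup>2 / 8" using p by (simp add: \<eta>_def)
    have \<Omega>A: "\<Omega> \<subseteq> A \<times> A" using \<Omega>(1) BA by auto
    obtain q q' where q: "q \<in> \<Omega>" "q' \<in> \<Omega>" "q \<noteq> q'"
      "(b3 \<ominus> b4) \<otimes> fst q \<oplus> (b1 \<ominus> b2) \<otimes> snd q = (b3 \<ominus> b4) \<otimes> fst q' \<oplus> (b1 \<ominus> b2) \<otimes> snd q'"
      using collision[OF A(1) Ane b(1-4)[unfolded B_def] \<mu>_def[unfolded \<alpha>_def] _ good \<eta>P fD AD \<Omega>A large] \<eta> by auto
    have qc: "fst q \<in> carrier R" "snd q \<in> carrier R" "fst q' \<in> carrier R" "snd q' \<in> carrier R"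
      using subsetD[OF \<Omega>(1) q(1)] subsetD[OF \<Omega>(1) q(2)] BR by auto
    have "z \<otimes> (fst r \<oplus> \<rho> \<otimes> snd r) = z \<otimes> fst r \<oplus> (\<rho> \<otimes> z) \<otimes> snd r" if "fst r \<in> carrier R" "snd r \<in> carrier R" for r
      using that z \<rho>c by algebra
    then have "z \<otimes> (fst q \<oplus> \<rho> \<otimes> snd q) = z \<otimes> (fst q' \<oplus> \<rho> \<otimes> snd q')"
      using qc q(4) b(6) by (simp add: z_def)
    then have "fst q \<oplus> \<rho> \<otimes> snd q = fst q' \<oplus> \<rho> \<otimes> snd q'"
      using qc z \<rho>c by (subst (asm) m_lcancel) auto
    then show "\<exists>q\<in>\<Omega>. \<exists>q'\<in>\<Omega>. q \<noteq> q' \<and> fst q \<oplus> \<rho> \<otimes> snd q = fst q' \<oplus> \<rho> \<otimes> snd q'" using q by blast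
  qed
  have \<beta>0: "0 < \<beta>" using \<beta> \<alpha> by linarith
  obtain s where s: "s \<in> B" "N < real (card {q \<in> B \<times> B. fst q \<ominus> snd q \<oplus> s \<in> B})"
  proof -
    have "(real (card B))\<^sup>2 / 2 \<le> real (card {q \<in> B \<times> B. fst q \<ominus> snd q \<in> popular (e / 512)})"
    proof -
      have "(\<Sum>a\<in>B. \<beta> / 2) \<le> (\<Sum>a\<in>B. real (card {b \<in> B. a \<ominus> b \<in> popular (e / 512)}))"
      proof (rule sum_mono)
        fix a assume a: "a \<in> B"
        have BB: "{b \<in> B. a \<ominus> b \<in> popular (e / 512)} \<union> {b \<in> B. a \<ominus> b \<notin> popular (e / 512)} = B" by auto
        have "card B \<le> card {b \<in> B. a \<ominus> b \<in> popular (e / 512)} + card {b \<in> B. a \<ominus> b \<notin> popular (e / 512)}"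
          using card_Un_le[of "{b \<in> B. a \<ominus> b \<in> popular (e / 512)}" "{b \<in> B. a \<ominus> b \<notin> popular (e / 512)}"]
          unfolding BB .
        moreover have "card {b \<in> B. a \<ominus> b \<notin> popular (e / 512)} \<le> card {b \<in> A. a \<ominus> b \<notin> popular (e / 512)}"
          using BA fA by (intro card_mono) auto
        moreover have "real (card {b \<in> A. a \<ominus> b \<notin> popular (e / 512)}) \<le> \<alpha> / 6" using A(3) a BA by (auto simp: \<alpha>_def)
        ultimately show "\<beta> / 2 \<le> real (card {b \<in> B. a \<ominus> b \<in> popular (e / 512)})"
          using \<beta> \<alpha> unfolding \<beta>_def by linarith
      qed
      also have "\<dots> = real (card {(a, b) \<in> B \<times> B. a \<ominus> b \<in> popular (e / 512)})"
        by (subst card_rel_eq_sum[OF fB fB]) simp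
      also have "{(a, b) \<in> B \<times> B. a \<ominus> b \<in> popular (e / 512)} = {q \<in> B \<times> B. fst q \<ominus> snd q \<in> popular (e / 512)}" by auto
      finally show ?thesis by (simp add: \<beta>_def power2_eq_square)
    qed
    moreover have "real (card (popular (e / 512))) * (real (card B) * N) < ((real (card B))\<^sup>2 / 2)\<^sup>2"
    proof -
      have "real (card (popular (e / 512))) * (\<beta> * N) \<le> 512 * (real t)\<^sup>2 / e * (\<beta> * N)"
        using Pc \<beta>0 N0 by (intro mult_right_mono) auto
      also have "\<dots> < 512 * (real t)\<^sup>2 / e * (\<beta> * (\<beta> ^ 3 * e / (2048 * (real t)\<^sup>2)))"
        using Nless e \<beta>0 t_pos by (intro mult_strict_left_mono) auto
      also have "\<dots> = (\<beta>\<^sup>2 / 2)\<^sup>2"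
        using e t_pos by (simp add: power_divide eval_nat_numeral)
      finally show ?thesis by (simp add: \<beta>_def)
    qed
    ultimately show ?thesis using popular_translate[OF BH _ N0] that by blast
  qed
  have add1: "\<one> \<oplus> \<rho> \<in> ratios B" if "\<rho> \<in> ratios B" for \<rho>
    by (rule ratios_add_one[OF BR coll that s])
  have mult: "a \<otimes> inv b \<otimes> \<rho> \<in> ratios B" if "\<rho> \<in> ratios B" "close B a b" "a \<in> B" "b \<in> B" for \<rho> a b
  proof (rule ratios_mult[OF BH coll that(1)])
    show "a \<otimes> inv b \<in> H" using subsetD[OF BH that(3)] subsetD[OF BH that(4)] by simp
    have "N < \<beta> * (\<beta>\<^sup>2 / (64 * real t))"
    proof -
      have "\<beta> ^ 3 * e / (2048 * (real t)\<^sup>2) \<le> \<beta> ^ 3 * real t / (2048 * (real t)\<^sup>2)"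
        using e \<beta>0 by (intro divide_right_mono mult_left_mono) auto
      also have "\<dots> \<le> \<beta> * (\<beta>\<^sup>2 / (64 * real t))"
        using t_pos \<beta>0 by (simp add: power2_eq_square power3_eq_cube field_simps)
      finally show ?thesis using Nless by linarith
    qed
    also have "\<dots> \<le> \<beta> * real (quot_reps B (a \<otimes> inv b))"
      using that(2) \<beta>0 by (intro mult_left_mono) (auto simp: close_def \<beta>_def)
    finally show "N < real (card B) * real (quot_reps B (a \<otimes> inv b))" by (simp add: \<beta>_def)
  qed
  have Bne: "B \<noteq> {}" using \<beta>0 by (auto simp: \<beta>_def)
  have "C \<noteq> {}" using Ce e by auto
  then obtain c0 where c0: "c0 \<in> C" by auto
  define U where "U = (\<lambda>c. c \<otimes> inv c0) ` C"
  have CH: "c \<in> H" if "c \<in> C" for c using that CB BH by auto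
  have UH: "U \<subseteq> H" using CH c0 by (auto simp: U_def)
  have multU: "u \<otimes> \<rho> \<in> ratios B" if u: "u \<in> U" and r: "\<rho> \<in> ratios B" for u \<rho>
  proof -
    obtain c where c: "c \<in> C" "u = c \<otimes> inv c0" using u unfolding U_def by blast
    \<comment> \<open>The elements \<open>c\<close> and \<open>c0\<close> need not be close to each other, but both are close to a
      common \<open>b\<close>, and \<open>c / c0 = (c / b) * (b / c0)\<close>.\<close>
    have "card {c, c0} \<le> 7" by (simp add: card_insert_if)
    then obtain b where b: "b \<in> B" "\<And>a. a \<in> {c, c0} \<Longrightarrow> close B a b"
      using common_close[OF BH Bne, of "{c, c0}"] c(1) c0 by (auto simp: C_def)
    have bH: "b \<in> H" using b BH by auto
    have "close B b c0" using b(2)[of c0] close_sym[OF BH, of c0 b] CH c0 bH by auto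
    then have "b \<otimes> inv c0 \<otimes> \<rho> \<in> ratios B" using mult[OF r] b(1) c0 CB by auto
    then have "c \<otimes> inv b \<otimes> (b \<otimes> inv c0 \<otimes> \<rho>) \<in> ratios B" using mult b(1) b(2)[of c] c(1) CB by auto
    moreover have "c \<otimes> inv b \<otimes> (b \<otimes> inv c0 \<otimes> \<rho>) = u \<otimes> \<rho>"
    proof -
      have cc: "c \<in> carrier R" "inv b \<in> carrier R" "b \<in> carrier R" "inv c0 \<in> carrier R" "\<rho> \<in> carrier R"
        using CH[OF c(1)] CH[OF c0] bH r by (auto simp: ratios_def)
      have "c \<otimes> inv b \<otimes> (b \<otimes> inv c0 \<otimes> \<rho>) = (inv b \<otimes> b) \<otimes> (c \<otimes> inv c0 \<otimes> \<rho>)" using cc by algebra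
      then show ?thesis using H_inv_l[OF bH] cc by (simp add: c(2))
    qed
    ultimately show ?thesis by simp
  qed
  have "1 < \<beta>" using \<beta> \<alpha> e64 by linarith
  then have "1 < card B" by (simp add: \<beta>_def)
  then obtain x y where xy: "x \<in> B" "y \<in> B" "x \<noteq> y"
    by (metis card_le_Suc0_iff_eq fB One_nat_def leD)
  have "x \<in> carrier R" "y \<in> carrier R" using xy BR by auto
  then have "\<zero> \<otimes> (x \<ominus> y) = x \<ominus> x" by (simp add: r_neg a_minus_def)
  then have zero: "\<zero> \<in> ratios B"
    unfolding ratios_def using xy by blast
  have fr: "finite (ratios B)" "ratios B \<subseteq> carrier R"
    using fin by (auto simp: ratios_def)
  have Usub: "U \<subseteq> carrier R - {\<zero>}" using UH H_sub by (rule order_trans)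
  obtain L where L: "L \<subseteq> ratios B" "U \<subseteq> L" "subgroup L (add_monoid R)" "subgroup (L - {\<zero>}) (mult_of R)"
    by (rule finite_add_mult_closed_subfield[OF fr zero add1 Usub multU])
  have "real (card L) \<le> real (card (ratios B))" using L(1) fr by (intro of_nat_mono card_mono)
  also have "\<dots> \<le> d\<^sup>2 / real t"
  proof -
    have "real (card (ratios B)) * real t \<le> (real (card D))\<^sup>2"
      by (rule card_ratios[OF BR _ _ Dc]) (use AD BA popular_sums_scale in \<open>auto simp: D_def\<close>)
    also have "\<dots> \<le> d\<^sup>2" using d by (intro power_mono) auto
    finally show ?thesis using t_pos by (simp add: le_divide_eq)
  qed
  also have "\<dots> = 2 ^ 40 * real t ^ 7 / e ^ 6"
    using t_pos e by (simp add: d_def power_divide power_mult_distrib divide_simps flip: power_mult)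
       (simp add: power_add[of "real t" 7 1, simplified])
  finally have 1: "real (card L) \<le> 2 ^ 40 * real t ^ 7 / avg_energy ^ 6" by (simp add: e_def)
  have "inj_on (\<lambda>c. c \<otimes> inv c0) C"
  proof (rule inj_onI)
    fix c c' assume c: "c \<in> C" "c' \<in> C" "c \<otimes> inv c0 = c' \<otimes> inv c0"
    then show "c = c'" using CH[OF c0] CH[OF c(1)] CH[OF c(2)] m_rcancel[of "inv c0" c c'] by simp
  qed
  then have "card U = card C" by (simp add: U_def card_image)
  moreover have "card U \<le> card (H \<inter> L)" using UH L(2) by (intro card_mono) auto
  ultimately have 2: "avg_energy / 4 \<le> card (H \<inter> L)" using Ce by (simp add: e_def)
  show ?thesis using that L(3,4) 1 2 by blast
qed

end

section \<open>Frobenius and the prime field\<close>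

context cring begin

lemma binomial_theorem:
  assumes x: "x \<in> carrier R" and y: "y \<in> carrier R"
  shows "(x \<oplus> y) [^] (n::nat) = (\<Oplus>i\<in>{..n}. add_pow R (n choose i) (x [^] i \<otimes> y [^] (n - i)))"
proof (induction n)
  case 0
  then show ?case using x y by simp
next
  case (Suc n)
  let ?f = "\<lambda>i. add_pow R (n choose i) (x [^] i \<otimes> y [^] (n - i))"
  let ?g = "\<lambda>i. add_pow R (n choose i) (x [^] i \<otimes> y [^] (Suc n - i))"
  let ?h = "\<lambda>i. if i = 0 then \<zero> else add_pow R (n choose (i - 1)) (x [^] i \<otimes> y [^] (Suc n - i))"
  have f: "?f i \<in> carrier R" for i using x y by simp
  have g: "?g i \<in> carrier R" for i using x y by simp
  have h: "?h i \<in> carrier R" for i using x y by simp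
  have 1: "(\<Oplus>i\<in>{..n}. ?f i) \<otimes> y = (\<Oplus>i\<in>{..Suc n}. ?g i)"
  proof -
    have "(\<Oplus>i\<in>{..n}. ?f i) \<otimes> y = (\<Oplus>i\<in>{..n}. ?f i \<otimes> y)" using f y by (intro finsum_ldistr) auto
    also have "\<dots> = (\<Oplus>i\<in>{..n}. ?g i)"
    proof (rule finsum_cong')
      fix i assume "i \<in> {..n}"
      then have e: "Suc n - i = Suc (n - i)" by auto
      show "?f i \<otimes> y = ?g i"
        unfolding e using x y by (simp add: add_pow_ldistr m_assoc)
    qed (use x y in auto)
    also have "\<dots> = ?g (Suc n) \<oplus> (\<Oplus>i\<in>{..n}. ?g i)"
      using g finsum_closed[of ?g "{..n}"] by (simp add: binomial_eq_0 Pi_def)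
    also have "\<dots> = (\<Oplus>i\<in>{..Suc n}. ?g i)" using g by (intro finsum_Suc[symmetric]) auto
    finally show ?thesis .
  qed
  have 2: "(\<Oplus>i\<in>{..n}. ?f i) \<otimes> x = (\<Oplus>i\<in>{..Suc n}. ?h i)"
  proof -
    have "(\<Oplus>i\<in>{..n}. ?f i) \<otimes> x = (\<Oplus>i\<in>{..n}. ?f i \<otimes> x)" using f x by (intro finsum_ldistr) auto
    also have "\<dots> = (\<Oplus>i\<in>{..n}. ?h (Suc i))"
    proof (rule finsum_cong')
      fix i
      have "x [^] i \<otimes> y [^] (n - i) \<otimes> x = x [^] Suc i \<otimes> y [^] (n - i)"
        using x y by (simp add: m_ac)
      then show "?f i \<otimes> x = ?h (Suc i)" using x y by (simp add: add_pow_ldistr)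
    qed (use x y in auto)
    also have "\<dots> = (\<Oplus>i\<in>{..n}. ?h (Suc i)) \<oplus> ?h 0" using x y by simp
    also have "\<dots> = (\<Oplus>i\<in>{..Suc n}. ?h i)" using h by (intro finsum_Suc2[symmetric]) auto
    finally show ?thesis .
  qed
  have "(x \<oplus> y) [^] Suc n = (\<Oplus>i\<in>{..n}. ?f i) \<otimes> (x \<oplus> y)" using Suc x y by simp
  also have "\<dots> = (\<Oplus>i\<in>{..n}. ?f i) \<otimes> x \<oplus> (\<Oplus>i\<in>{..n}. ?f i) \<otimes> y"
    using f x y by (intro r_distr finsum_closed) auto
  also have "\<dots> = (\<Oplus>i\<in>{..Suc n}. ?h i \<oplus> ?g i)" unfolding 1 2
    using g h by (intro finsum_addf[symmetric]) auto
  also have "\<dots> = (\<Oplus>i\<in>{..Suc n}. add_pow R (Suc n choose i) (x [^] i \<otimes> y [^] (Suc n - i)))"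
  proof (rule finsum_cong')
    fix i show "?h i \<oplus> ?g i = add_pow R (Suc n choose i) (x [^] i \<otimes> y [^] (Suc n - i))"
      using x y by (cases i) (simp_all add: add.nat_pow_mult)
  qed (use x y in auto)
  finally show ?case .
qed

end

text \<open>The type of \<open>R\<close> is restricted to plain ring records because the trace is defined for these.\<close>

locale field_of_prime_power = field R for R :: "'a ring" (structure) +
  fixes p m :: nat
  assumes p: "Factorial_Ring.prime p" and m: "1 \<le> m" and card: "card (carrier R) = p ^ m"
begin

lemma p0[simp]: "0 < p" using p by (rule prime_gt_0_nat)
lemma p1: "1 < p" using p by (rule prime_gt_1_nat)

lemma fin: "finite (carrier R)"
  using card p0 by (metis card.infinite power_eq_0_iff less_numeral_extra(3))

lemma char_p: "add_pow R p \<one> = \<zero>"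
proof -
  have "add_pow R (order (add_monoid R)) \<one> = \<zero>"
    using group.pow_order_eq_1[OF add.group_axioms, of \<one>] by (simp add: add_pow_def)
  then have "add_pow R (p ^ m) \<one> = \<zero>" by (simp add: order_def card)
  moreover have "add_pow R (p ^ k) \<one> = (add_pow R p \<one>) [^] k" for k
  proof (induction k)
    case (Suc k)
    have "add_pow R (p ^ Suc k) \<one> = add_pow R p (add_pow R (p ^ k) \<one>)"
      by (simp add: add.nat_pow_pow mult.commute)
    also have "\<dots> = add_pow R p (\<one> \<otimes> add_pow R (p ^ k) \<one>)" by simp
    also have "\<dots> = add_pow R p \<one> \<otimes> add_pow R (p ^ k) \<one>"
      by (intro add_pow_ldistr[symmetric]) auto
    finally show ?case using Suc by (simp add: m_comm)
  qed simp
  ultimately have "(add_pow R p \<one>) [^] m = \<zero>" by simp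
  moreover have "a = \<zero>" if "a \<in> carrier R" "a [^] k = \<zero>" for a and k :: nat
    using that by (induction k) (auto simp: integral_iff)
  ultimately show ?thesis by (meson add.nat_pow_closed one_closed)
qed

lemma add_pow_dvd: "p dvd k \<Longrightarrow> x \<in> carrier R \<Longrightarrow> add_pow R k x = \<zero>"
proof -
  assume "p dvd k" and x: "x \<in> carrier R"
  then obtain j where j: "k = p * j" by auto
  have "add_pow R k x = add_pow R j (add_pow R p x)" using x by (simp add: j add.nat_pow_pow)
  also have "add_pow R p x = add_pow R p \<one> \<otimes> x" using x by (subst add_pow_ldistr) auto
  also have "\<dots> = \<zero>" using x by (simp add: char_p)
  finally show ?thesis by simp
qed

lemma frobenius_add:
  assumes x: "x \<in> carrier R" and y: "y \<in> carrier R"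
  shows "(x \<oplus> y) [^] p = x [^] p \<oplus> y [^] p"
proof -
  let ?f = "\<lambda>i. add_pow R (p choose i) (x [^] i \<otimes> y [^] (p - i))"
  have f: "?f i \<in> carrier R" for i using x y by simp
  have "(x \<oplus> y) [^] p = (\<Oplus>i\<in>{..p}. ?f i)" using x y by (rule binomial_theorem)
  also have "\<dots> = (\<Oplus>i\<in>{0, p}. ?f i)"
  proof (rule add.finprod_mono_neutral_cong_right)
    fix i assume "i \<in> {..p} - {0, p}"
    then have "0 < i" "i < p" by auto
    then have "p dvd (p choose i)" using p by (intro dvd_choose_prime) auto
    then show "?f i = \<zero>" using x y by (intro add_pow_dvd) auto
  qed (use f in auto)
  also have "\<dots> = ?f 0 \<oplus> (\<Oplus>i\<in>{p}. ?f i)" by (rule finsum_insert) (use x y p1 in auto)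
  also have "(\<Oplus>i\<in>{p}. ?f i) = ?f p \<oplus> (\<Oplus>i\<in>{}. ?f i)" by (rule finsum_insert) (use x y in auto)
  also have "?f 0 \<oplus> \<dots> = x [^] p \<oplus> y [^] p" using x y by (simp add: a_comm)
  finally show ?thesis .
qed

lemma frobenius_power_add:
  assumes x: "x \<in> carrier R" and y: "y \<in> carrier R"
  shows "(x \<oplus> y) [^] (p ^ k) = x [^] (p ^ k) \<oplus> y [^] (p ^ k)"
proof (induction k)
  case (Suc k)
  have e: "z [^] (p ^ Suc k) = (z [^] (p ^ k)) [^] p" if "z \<in> carrier R" for z
    using that by (simp add: nat_pow_pow mult.commute)
  show ?case using Suc x y by (simp add: e frobenius_add del: power_Suc)
qed (use x y in simp)

lemma frobenius_finsum:
  assumes "finite I" "f \<in> I \<rightarrow> carrier R"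
  shows "(\<Oplus>i\<in>I. f i) [^] p = (\<Oplus>i\<in>I. f i [^] p)"
  using assms
proof (induction I rule: finite_induct)
  case empty
  then show ?case using p1 by (simp add: nat_pow_zero)
next
  case (insert i I)
  then show ?case by (simp add: frobenius_add finsum_closed Pi_def)
qed

lemma pow_card: "x \<in> carrier R \<Longrightarrow> x [^] (p ^ m) = x"
proof (cases "x = \<zero>")
  case True
  then show ?thesis using p1 by (simp add: nat_pow_zero)
next
  case False
  assume x: "x \<in> carrier R"
  have "x [^]\<^bsub>mult_of R\<^esub> order (mult_of R) = \<one>\<^bsub>mult_of R\<^esub>"
    using group.pow_order_eq_1[OF field_mult_group, of x] x False by simp
  then have 1: "x [^] (p ^ m - 1) = \<one>"
    using order_mult_of[OF fin] by (simp add: order_def card nat_pow_mult_of)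
  have "x [^] (p ^ m) = x [^] (p ^ m - 1) \<otimes> x"
    using x p0 by (metis Suc_pred' nat_pow_Suc zero_less_power)
  then show ?thesis using 1 x by simp
qed

definition prime_field where "prime_field = (\<lambda>k. add_pow R k \<one>) ` {..<p}"

lemma inj_prime_field: "inj_on (\<lambda>k. add_pow R k \<one>) {..<p}"
proof -
  have ne: "add_pow R k \<one> \<noteq> \<zero>" if "0 < k" "k < p" for k
  proof
    assume z: "add_pow R k \<one> = \<zero>"
    have "coprime k p" using that p by (metis coprime_commute nat_dvd_not_less prime_imp_coprime)
    then obtain a b where ab: "k * a = Suc (p * b)"
      using coprime_bezout_strong[of k p] p1 by auto
    have "add_pow R (k * a) \<one> = \<zero>" using z by (simp add: add.nat_pow_pow[symmetric])
    moreover have "add_pow R (Suc (p * b)) \<one> = \<one>" using add_pow_dvd[of "p * b" \<one>] by simp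
    ultimately show False using ab by simp
  qed
  have ne2: "add_pow R i \<one> \<noteq> add_pow R j \<one>" if "i < j" "j < p" for i j
  proof
    assume e: "add_pow R i \<one> = add_pow R j \<one>"
    have "add_pow R i \<one> \<oplus> add_pow R (j - i) \<one> = add_pow R j \<one>"
      using that by (simp add: add.nat_pow_mult)
    then have "add_pow R (j - i) \<one> = \<zero>"
      using e add.r_cancel_one'[of "add_pow R i \<one>" "add_pow R (j - i) \<one>"] by simp
    then show False using ne[of "j - i"] that by simp
  qed
  show ?thesis
  proof (rule inj_onI)
    fix i j assume "i \<in> {..<p}" "j \<in> {..<p}" "add_pow R i \<one> = add_pow R j \<one>"
    then show "i = j" using ne2[of i j] ne2[of j i] by (metis lessThan_iff linorder_neqE_nat)
  qed
qed

text \<open>By Frobenius every multiple of \<open>1\<close> is a root of \<open>y ^ p = y\<close>, and this equation has at most \<open>p\<close> roots.\<close>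

lemma prime_field_eq: "prime_field = {y \<in> carrier R. y [^] p = y}"
proof (rule card_seteq)
  show "finite {y \<in> carrier R. y [^] p = y}" using fin by simp
  have "add_pow R k \<one> [^] p = add_pow R k \<one>" for k :: nat
  proof (induction k)
    case 0 then show ?case using p1 by (simp add: nat_pow_zero)
  next
    case (Suc k)
    have "add_pow R (Suc k) \<one> = add_pow R k \<one> \<oplus> \<one>" by simp
    then show ?case using Suc frobenius_add[of "add_pow R k \<one>" \<one>] by simp
  qed
  then show "prime_field \<subseteq> {y \<in> carrier R. y [^] p = y}" by (auto simp: prime_field_def)
  have "{y \<in> carrier R. y [^] p = y} \<subseteq> insert \<zero> {y \<in> carrier R. y [^] (p - 1) = \<one>}"
  proof
    fix y assume "y \<in> {y \<in> carrier R. y [^] p = y}"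
    then have yp: "y \<in> carrier R" "y [^] p = y" by auto
    have "y [^] (p - 1) \<otimes> y = y [^] Suc (p - 1)" by (rule nat_pow_Suc[symmetric])
    also have "\<dots> = \<one> \<otimes> y" using yp p0 by simp
    finally have y: "y \<in> carrier R" "y [^] (p - 1) \<otimes> y = \<one> \<otimes> y" using yp by auto
    show "y \<in> insert \<zero> {y \<in> carrier R. y [^] (p - 1) = \<one>}"
    proof (cases "y = \<zero>")
      case False
      then show ?thesis using y by (subst (asm) m_rcancel) auto
    qed simp
  qed
  then have "card {y \<in> carrier R. y [^] p = y} \<le> card (insert \<zero> {y \<in> carrier R. y [^] (p - 1) = \<one>})"
    using fin by (intro card_mono) auto
  also have "\<dots> \<le> Suc (card {y \<in> carrier R. y [^] (p - 1) = \<one>})" by (rule card_insert_le_m1) auto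
  also have "\<dots> \<le> Suc (p - 1)" using num_roots_le_deg[OF fin, of "p - 1"] p1 by simp
  also have "\<dots> = card prime_field" using p0 inj_prime_field by (simp add: prime_field_def card_image)
  finally show "card {y \<in> carrier R. y [^] p = y} \<le> card prime_field" .
qed

end

section \<open>The trace character\<close>

context field_of_prime_power begin

lemma prime_field_rep:
  assumes "y \<in> prime_field"
  shows "prime_field_rep p R y < p" "add_pow R (prime_field_rep p R y) \<one> = y"
proof -
  have "\<exists>!k. k < p \<and> add_pow R k \<one> = y"
    using assms inj_prime_field by (fastforce simp: prime_field_def inj_on_def)
  from theI'[OF this] show "prime_field_rep p R y < p" "add_pow R (prime_field_rep p R y) \<one> = y"
    by (auto simp: prime_field_rep_def)
qed

lemma exp_mod_p: "exp (2 * of_real pi * \<i> * of_nat (k mod p) / of_nat p) = exp (2 * of_real pi * \<i> * of_nat k / of_nat p)"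
proof -
  have "of_nat k = (of_nat (k mod p) + of_nat p * of_nat (k div p) :: complex)"
    by (metis mod_mult_div_eq of_nat_add of_nat_mult)
  then have "2 * of_real pi * \<i> * of_nat k / of_nat p
      = 2 * of_real pi * \<i> * of_nat (k mod p) / of_nat p + 2 * of_real pi * \<i> * of_nat (k div p)"
    using p0 by (simp add: field_simps)
  moreover have "exp (2 * of_real pi * \<i> * of_nat (k div p)) = (1 :: complex)"
    using exp_integer_2pi[of "of_nat (k div p)"] by (simp add: mult_ac)
  ultimately show ?thesis by (simp add: exp_add)
qed

lemma e_p_add_pow: "e_p p R (add_pow R k \<one>) = exp (2 * of_real pi * \<i> * of_nat k / of_nat p)"
proof -
  have "k = p * (k div p) + k mod p" by simp
  then have "add_pow R k \<one> = add_pow R (p * (k div p)) \<one> \<oplus> add_pow R (k mod p) \<one>"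
    by (metis add.nat_pow_mult one_closed)
  then have 1: "add_pow R k \<one> = add_pow R (k mod p) \<one>" using add_pow_dvd[of "p * (k div p)" \<one>] by simp
  then have "add_pow R k \<one> \<in> prime_field" by (auto simp: prime_field_def)
  from prime_field_rep[OF this] have "prime_field_rep p R (add_pow R k \<one>) = k mod p"
    using inj_onD[OF inj_prime_field, of "prime_field_rep p R (add_pow R k \<one>)" "k mod p"] 1 by auto
  then show ?thesis by (simp add: e_p_def exp_mod_p)
qed

lemma e_p_add:
  assumes "y \<in> prime_field" "z \<in> prime_field"
  shows "e_p p R (y \<oplus> z) = e_p p R y * e_p p R z"
proof -
  obtain i j :: nat where "y = add_pow R i \<one>" "z = add_pow R j \<one>" using assms unfolding prime_field_def by blast
  then show ?thesis
    using e_p_add_pow[of "i + j"] by (simp add: e_p_add_pow add.nat_pow_mult ring_distribs add_divide_distrib exp_add)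
qed

lemma e_p_nontrivial:
  assumes "y \<in> prime_field" "y \<noteq> \<zero>"
  shows "e_p p R y \<noteq> 1"
proof
  assume 1: "e_p p R y = 1"
  obtain k where k: "k < p" "y = add_pow R k \<one>" using assms by (auto simp: prime_field_def)
  have "exp (2 * of_real pi * \<i> * of_nat k / of_nat p) = 1" using 1 k by (simp add: e_p_add_pow)
  then obtain n :: int where n: "Im (2 * of_real pi * \<i> * of_nat k / of_nat p) = of_int (2 * n) * pi"
    by (auto simp: exp_eq_1)
  have "Im (2 * of_real pi * \<i> * of_nat k / of_nat p) = 2 * pi * real k / real p" by simp
  then have "real k = of_int n * real p" using n p0 by (simp add: field_simps)
  then have "int k = n * int p" by (metis of_int_eq_iff of_int_mult of_int_of_nat_eq)
  then have "p dvd k" by (metis dvd_triv_right int_dvd_int_iff)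
  then have "k = 0" using k(1) by (meson dvd_imp_le leD neq0_conv)
  then show False using k assms by simp
qed

lemma trace_closed[simp]: "x \<in> carrier R \<Longrightarrow> abs_trace p m R x \<in> carrier R"
  unfolding abs_trace_def by (intro finsum_closed) auto

lemma trace_add:
  assumes "x \<in> carrier R" "y \<in> carrier R"
  shows "abs_trace p m R (x \<oplus> y) = abs_trace p m R x \<oplus> abs_trace p m R y"
proof -
  have "abs_trace p m R (x \<oplus> y) = (\<Oplus>i\<in>{..<m}. x [^] (p ^ i) \<oplus> y [^] (p ^ i))"
    unfolding abs_trace_def by (rule finsum_cong') (use assms in \<open>auto simp: frobenius_power_add\<close>)
  also have "\<dots> = abs_trace p m R x \<oplus> abs_trace p m R y"
    unfolding abs_trace_def by (rule finsum_addf) (use assms in auto)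
  finally show ?thesis .
qed

text \<open>Frobenius permutes the conjugates \<open>x ^ (p ^ i)\<close> cyclically, so it fixes their sum.\<close>

lemma trace_in_prime_field:
  assumes x: "x \<in> carrier R"
  shows "abs_trace p m R x \<in> prime_field"
proof -
  obtain k where k: "m = Suc k" using m by (cases m) auto
  have "abs_trace p m R x [^] p = (\<Oplus>i\<in>{..k}. (x [^] (p ^ i)) [^] p)"
    unfolding abs_trace_def k lessThan_Suc_atMost by (rule frobenius_finsum) (use x in auto)
  also have "\<dots> = (\<Oplus>i\<in>{..k}. x [^] (p ^ Suc i))"
    by (rule finsum_cong') (use x in \<open>auto simp: nat_pow_pow mult.commute\<close>)
  also have "\<dots> = abs_trace p m R x"
  proof -
    have "(\<Oplus>i\<in>{..k}. x [^] (p ^ Suc i)) \<oplus> x [^] (p ^ 0) = (\<Oplus>i\<in>{..Suc k}. x [^] (p ^ i))"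
      by (rule finsum_Suc2[symmetric]) (use x in auto)
    also have "\<dots> = x [^] (p ^ Suc k) \<oplus> (\<Oplus>i\<in>{..k}. x [^] (p ^ i))"
      by (rule finsum_Suc) (use x in auto)
    also have "\<dots> = abs_trace p m R x \<oplus> x [^] (p ^ 0)"
      unfolding abs_trace_def k lessThan_Suc_atMost
      using pow_card[OF x] finsum_closed[of "\<lambda>i. x [^] (p ^ i)" "{..k}"] x by (simp add: k a_comm Pi_def del: power_Suc)
    finally show ?thesis
      using x finsum_closed[of "\<lambda>i. x [^] (p ^ Suc i)" "{..k}"] by (subst (asm) add.right_cancel) (auto simp: Pi_def simp del: power_Suc)
  qed
  finally show ?thesis using x by (simp add: prime_field_eq)
qed

text \<open>The trace is given by a nonzero polynomial of degree less than the number of elements of the field,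
hence it does not vanish identically.\<close>

lemma trace_polynomial:
  "\<exists>f \<in> carrier (UP R). f \<noteq> \<zero>\<^bsub>UP R\<^esub> \<and> deg R f \<le> p ^ k \<and>
     (\<forall>x\<in>carrier R. eval R R id x f = (\<Oplus>i\<in>{..k}. x [^] (p ^ i)))"
proof -
  interpret U: UP_domain R "UP R" by unfold_locales
  have "\<exists>f \<in> carrier (UP R). coeff (UP R) f (p ^ k) = \<one> \<and> deg R f \<le> p ^ k \<and>
     (\<forall>x\<in>carrier R. eval R R id x f = (\<Oplus>i\<in>{..k}. x [^] (p ^ i)))"
  proof (induction k)
    case 0
    show ?case
    proof (rule bexI[of _ "monom (UP R) \<one> 1"], intro conjI ballI)
      fix x assume x: "x \<in> carrier R"
      show "eval R R id x (monom (UP R) \<one> 1) = (\<Oplus>i\<in>{..0}. x [^] (p ^ i))"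
        using U.evalRR_monom[of \<one> x 1] x by simp
    qed auto
  next
    case (Suc k)
    then obtain f where f: "f \<in> carrier (UP R)" "deg R f \<le> p ^ k"
      "\<forall>x\<in>carrier R. eval R R id x f = (\<Oplus>i\<in>{..k}. x [^] (p ^ i))" by blast
    have lt: "p ^ k < p ^ Suc k" using p1 by simp
    let ?g = "monom (UP R) \<one> (p ^ Suc k) \<oplus>\<^bsub>UP R\<^esub> f"
    have "coeff (UP R) f (p ^ Suc k) = \<zero>" using f lt by (intro U.deg_aboveD) (auto simp del: power_Suc)
    then have "coeff (UP R) ?g (p ^ Suc k) = \<one>" using f by (simp del: power_Suc)
    moreover have "deg R ?g \<le> p ^ Suc k"
      using U.deg_add[of "monom (UP R) \<one> (p ^ Suc k)" f] f lt by (simp del: power_Suc)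
    moreover have "eval R R id x ?g = (\<Oplus>i\<in>{..Suc k}. x [^] (p ^ i))" if x: "x \<in> carrier R" for x
    proof -
      have "(\<Oplus>i\<in>{..Suc k}. x [^] (p ^ i)) = x [^] (p ^ Suc k) \<oplus> (\<Oplus>i\<in>{..k}. x [^] (p ^ i))"
        by (rule finsum_Suc) (use x in auto)
      then show ?thesis using f x by (simp add: U.evalRR_simps del: power_Suc)
    qed
    moreover have "?g \<in> carrier (UP R)" using f by simp
    ultimately show ?case by blast
  qed
  then show ?thesis by (metis U.coeff_zero zero_not_one)
qed

lemma trace_nonzero: "\<exists>x\<in>carrier R. abs_trace p m R x \<noteq> \<zero>"
proof (rule ccontr)
  assume neg: "\<not> ?thesis"
  interpret U: UP_domain R "UP R" by unfold_locales
  obtain k where k: "m = Suc k" using m by (cases m) auto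
  obtain f where f: "f \<in> carrier (UP R)" "f \<noteq> \<zero>\<^bsub>UP R\<^esub>" "deg R f \<le> p ^ k"
     "\<forall>x\<in>carrier R. eval R R id x f = (\<Oplus>i\<in>{..k}. x [^] (p ^ i))"
    using trace_polynomial[of k] by blast
  have "{a \<in> carrier R. eval R R id a f = \<zero>} = carrier R"
    using neg f(4) by (auto simp: abs_trace_def k lessThan_Suc_atMost)
  then have "card (carrier R) \<le> p ^ k" using U.roots_bound[OF f(1,2) fin] f(3) by simp
  then show False using p1 by (simp add: card k)
qed

lemma add_char_add:
  assumes "a \<in> carrier R" "x \<in> carrier R" "y \<in> carrier R"
  shows "add_char p m R a (x \<oplus> y) = add_char p m R a x * add_char p m R a y"
  using assms by (simp add: add_char_def r_distr trace_add e_p_add trace_in_prime_field)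

lemma cmod_add_char: "cmod (add_char p m R a x) = 1"
proof -
  have "cmod (exp (\<i> * of_real r)) = 1" for r by (simp add: norm_exp_i_times)
  from this[of "2 * pi * real (prime_field_rep p R (abs_trace p m R (a \<otimes> x))) / real p"]
  show ?thesis by (simp add: add_char_def e_p_def mult_ac)
qed

lemma sum_add_char: "(\<Sum>x\<in>carrier R. add_char p m R \<one> x) = 0"
proof -
  obtain c where c: "c \<in> carrier R" "abs_trace p m R c \<noteq> \<zero>" using trace_nonzero by auto
  define \<psi> where "\<psi> = add_char p m R \<one>"
  have "\<psi> c \<noteq> 1"
    using e_p_nontrivial[OF trace_in_prime_field[OF c(1)] c(2)] c by (simp add: \<psi>_def add_char_def)
  have "(\<Sum>x\<in>carrier R. \<psi> x) = (\<Sum>x\<in>carrier R. \<psi> (c \<oplus> x))"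
  proof (rule sum.reindex_bij_witness[of _ "\<lambda>x. c \<oplus> x" "\<lambda>x. \<ominus> c \<oplus> x"])
    fix x assume x: "x \<in> carrier R"
    show "c \<oplus> (\<ominus> c \<oplus> x) = x" "\<ominus> c \<oplus> (c \<oplus> x) = x" using x c(1) by (auto simp: r_neg1 r_neg2)
  qed (use c in \<open>auto simp: r_neg2\<close>)
  also have "\<dots> = \<psi> c * (\<Sum>x\<in>carrier R. \<psi> x)"
    unfolding sum_distrib_left \<psi>_def by (intro sum.cong) (use c in \<open>auto simp: add_char_add\<close>)
  finally have "(1 - \<psi> c) * (\<Sum>x\<in>carrier R. \<psi> x) = 0" by (simp add: algebra_simps)
  then show ?thesis using \<open>\<psi> c \<noteq> 1\<close> by (simp add: \<psi>_def)
qed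

end

section \<open>Exponential sums over a multiplicative subgroup\<close>

text \<open>Only these three properties of the character enter the analytic estimates.\<close>

locale subgroup_character = finite_field_subgroup +
  fixes \<psi> :: "'a \<Rightarrow> complex"
  assumes psi_add: "\<And>x y. x \<in> carrier R \<Longrightarrow> y \<in> carrier R \<Longrightarrow> \<psi> (x \<oplus> y) = \<psi> x * \<psi> y"
    and norm_psi: "\<And>x. x \<in> carrier R \<Longrightarrow> cmod (\<psi> x) = 1"
    and sum_psi: "(\<Sum>x\<in>carrier R. \<psi> x) = 0"
begin

lemma psi_zero: "\<psi> \<zero> = 1"
proof -
  have "\<psi> \<zero> * \<psi> \<zero> = \<psi> \<zero> * 1" using psi_add[of \<zero> \<zero>] by simp
  moreover have "\<psi> \<zero> \<noteq> 0" using norm_psi[of \<zero>] by auto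
  ultimately show ?thesis by (metis mult_cancel_left)
qed

lemma psi_diff:
  assumes "x \<in> carrier R" "y \<in> carrier R"
  shows "\<psi> (x \<ominus> y) = \<psi> x * cnj (\<psi> y)"
proof -
  have "\<psi> (x \<ominus> y) * \<psi> y = \<psi> (x \<ominus> y \<oplus> y)" using assms by (intro psi_add[symmetric]) auto
  also have "x \<ominus> y \<oplus> y = x" using assms by algebra
  finally have "\<psi> (x \<ominus> y) * (\<psi> y * cnj (\<psi> y)) = \<psi> x * cnj (\<psi> y)" by (simp add: mult.assoc[symmetric])
  moreover have "\<psi> y * cnj (\<psi> y) = 1" using norm_psi[OF assms(2)] by (simp add: complex_norm_square[symmetric])
  ultimately show ?thesis by simp
qed

lemma mult_bij:
  assumes "z \<in> carrier R" "z \<noteq> \<zero>"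
  shows "bij_betw (\<lambda>a. a \<otimes> z) (carrier R) (carrier R)"
proof -
  have "inj_on (\<lambda>a. a \<otimes> z) (carrier R)" using assms by (auto simp: inj_on_def m_rcancel)
  moreover have "(\<lambda>a. a \<otimes> z) ` carrier R \<subseteq> carrier R" using assms by auto
  ultimately show ?thesis using fin by (simp add: bij_betw_def endo_inj_surj)
qed

lemma orthogonality:
  assumes "z \<in> carrier R"
  shows "(\<Sum>a\<in>carrier R. \<psi> (a \<otimes> z)) = (if z = \<zero> then of_nat (card (carrier R)) else 0)"
  using sum.reindex_bij_betw[OF mult_bij[OF assms], of \<psi>] assms by (auto simp: psi_zero sum_psi)

definition char_sum where "char_sum a = (\<Sum>h\<in>H. \<psi> (a \<otimes> h))"

lemma char_sum_scale:
  assumes "h \<in> H" "a \<in> carrier R"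
  shows "char_sum (a \<otimes> h) = char_sum a"
  unfolding char_sum_def
  by (rule sum.reindex_bij_witness[of _ "\<lambda>k. inv h \<otimes> k" "\<lambda>k. h \<otimes> k"]) (use assms in \<open>auto simp: m_assoc\<close>)

lemma norm_char_sum_sq:
  assumes a: "a \<in> carrier R"
  shows "of_real ((cmod (char_sum a))\<^sup>2) = (\<Sum>z\<in>carrier R. of_nat (diff_reps H z) * \<psi> (a \<otimes> z))"
proof -
  have "of_real ((cmod (char_sum a))\<^sup>2) = char_sum a * cnj (char_sum a)" by (rule complex_norm_square)
  also have "\<dots> = (\<Sum>h\<in>H. \<Sum>k\<in>H. \<psi> (a \<otimes> h) * cnj (\<psi> (a \<otimes> k)))"
    by (simp add: char_sum_def sum_product)
  also have "\<dots> = (\<Sum>p\<in>H \<times> H. \<psi> (a \<otimes> fst p) * cnj (\<psi> (a \<otimes> snd p)))"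
    by (simp add: sum.cartesian_product case_prod_unfold)
  also have "\<dots> = (\<Sum>p\<in>H \<times> H. \<psi> (a \<otimes> (fst p \<ominus> snd p)))"
  proof (rule sum.cong)
    fix p assume "p \<in> H \<times> H"
    then have c: "fst p \<in> carrier R" "snd p \<in> carrier R" by auto
    have "a \<otimes> (fst p \<ominus> snd p) = a \<otimes> fst p \<ominus> a \<otimes> snd p" using c a by algebra
    then show "\<psi> (a \<otimes> fst p) * cnj (\<psi> (a \<otimes> snd p)) = \<psi> (a \<otimes> (fst p \<ominus> snd p))"
      using psi_diff[of "a \<otimes> fst p" "a \<otimes> snd p"] c a by simp
  qed simp
  also have "\<dots> = (\<Sum>z\<in>carrier R. \<Sum>p\<in>{p \<in> H \<times> H. fst p \<ominus> snd p = z}. \<psi> (a \<otimes> (fst p \<ominus> snd p)))"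
    using fin by (intro sum.group[symmetric]) auto
  also have "\<dots> = (\<Sum>z\<in>carrier R. of_nat (diff_reps H z) * \<psi> (a \<otimes> z))"
  proof (rule sum.cong)
    fix z assume z: "z \<in> carrier R"
    have "(\<Sum>p\<in>{p \<in> H \<times> H. fst p \<ominus> snd p = z}. \<psi> (a \<otimes> (fst p \<ominus> snd p))) = (\<Sum>p\<in>{p \<in> H \<times> H. fst p \<ominus> snd p = z}. \<psi> (a \<otimes> z))"
      by (intro sum.cong) auto
    then show "(\<Sum>p\<in>{p \<in> H \<times> H. fst p \<ominus> snd p = z}. \<psi> (a \<otimes> (fst p \<ominus> snd p))) = of_nat (diff_reps H z) * \<psi> (a \<otimes> z)"
      using diff_reps_diff_fibre[OF H_car' z] by simp
  qed simp
  finally show ?thesis .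
qed

lemma energy_eq: "(\<Sum>z\<in>carrier R. (real (diff_reps H z))\<^sup>2) = avg_energy * (real t)\<^sup>2"
  using t_pos by (simp add: avg_energy_def)

lemma fourth_moment:
  "(\<Sum>a\<in>carrier R. (cmod (char_sum a)) ^ 4) = card (carrier R) * (avg_energy * (real t)\<^sup>2)"
proof -
  let ?q = "of_nat (card (carrier R)) :: complex"
  have "of_real (\<Sum>a\<in>carrier R. (cmod (char_sum a)) ^ 4) = (\<Sum>a\<in>carrier R. of_real ((cmod (char_sum a))\<^sup>2) * cnj (of_real ((cmod (char_sum a))\<^sup>2)))"
    unfolding of_real_sum by (intro sum.cong) (auto simp flip: of_real_mult power_add simp: power2_eq_square power4_eq_xxxx)
  also have "\<dots> = (\<Sum>a\<in>carrier R. \<Sum>z\<in>carrier R. \<Sum>w\<in>carrier R. of_nat (diff_reps H z) * of_nat (diff_reps H w) * \<psi> (a \<otimes> (z \<ominus> w)))"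
  proof (rule sum.cong)
    fix a assume a: "a \<in> carrier R"
    show "of_real ((cmod (char_sum a))\<^sup>2) * cnj (of_real ((cmod (char_sum a))\<^sup>2)) = (\<Sum>z\<in>carrier R. \<Sum>w\<in>carrier R. of_nat (diff_reps H z) * of_nat (diff_reps H w) * \<psi> (a \<otimes> (z \<ominus> w)))"
      unfolding norm_char_sum_sq[OF a] cnj_sum sum_product
    proof (intro sum.cong refl)
      fix z w assume zw: "z \<in> carrier R" "w \<in> carrier R"
      have "a \<otimes> (z \<ominus> w) = a \<otimes> z \<ominus> a \<otimes> w" using zw a by algebra
      then show "of_nat (diff_reps H z) * \<psi> (a \<otimes> z) * cnj (of_nat (diff_reps H w) * \<psi> (a \<otimes> w)) = of_nat (diff_reps H z) * of_nat (diff_reps H w) * \<psi> (a \<otimes> (z \<ominus> w))"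
        using psi_diff[of "a \<otimes> z" "a \<otimes> w"] zw a by simp
    qed
  qed simp
  also have "\<dots> = (\<Sum>z\<in>carrier R. \<Sum>a\<in>carrier R. \<Sum>w\<in>carrier R. of_nat (diff_reps H z) * of_nat (diff_reps H w) * \<psi> (a \<otimes> (z \<ominus> w)))"
    by (rule sum.swap)
  also have "\<dots> = (\<Sum>z\<in>carrier R. \<Sum>w\<in>carrier R. \<Sum>a\<in>carrier R. of_nat (diff_reps H z) * of_nat (diff_reps H w) * \<psi> (a \<otimes> (z \<ominus> w)))"
    by (intro sum.cong refl sum.swap)
  also have "\<dots> = (\<Sum>z\<in>carrier R. \<Sum>w\<in>carrier R. if z = w then of_nat (diff_reps H z) * of_nat (diff_reps H w) * ?q else 0)"
    by (intro sum.cong refl) (auto simp: orthogonality r_right_minus_eq simp flip: sum_distrib_left)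
  also have "\<dots> = (\<Sum>z\<in>carrier R. of_nat (diff_reps H z) * of_nat (diff_reps H z) * ?q)"
    using fin by (intro sum.cong refl) (simp add: sum.delta')
  also have "\<dots> = of_real (card (carrier R) * (\<Sum>z\<in>carrier R. (real (diff_reps H z))\<^sup>2))"
    by (simp add: sum_distrib_left power2_eq_square mult_ac)
  finally show ?thesis unfolding energy_eq of_real_eq_iff .
qed

text \<open>The sum is constant on the \<open>t\<close> elements of \<open>a H\<close>, each of which contributes to the fourth moment.\<close>

lemma norm_char_sum_fourth:
  assumes a: "a \<in> carrier R" "a \<noteq> \<zero>"
  shows "(cmod (char_sum a)) ^ 4 \<le> card (carrier R) * avg_energy * t"
proof -
  have "real t * (cmod (char_sum a)) ^ 4 = (\<Sum>h\<in>H. (cmod (char_sum (a \<otimes> h))) ^ 4)"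
    using a by (simp add: char_sum_scale t_def)
  also have "\<dots> = (\<Sum>b\<in>(\<lambda>h. a \<otimes> h) ` H. (cmod (char_sum b)) ^ 4)"
    by (subst sum.reindex) (use a in \<open>auto simp: inj_on_def m_lcancel\<close>)
  also have "\<dots> \<le> (\<Sum>b\<in>carrier R. (cmod (char_sum b)) ^ 4)"
    using fin a by (intro sum_mono2) auto
  also have "\<dots> = real t * (card (carrier R) * avg_energy * t)"
    unfolding fourth_moment by (simp add: power2_eq_square)
  finally show ?thesis using t_pos by simp
qed

text \<open>By \<open>norm_char_sum_sq\<close> and invariance, \<open>t \<bar>T(a)\<bar>\<^sup>2\<close> is the sum of \<open>T(a z)\<close> weighted by the number of
representations of \<open>z\<close>.  Two Cauchy--Schwarz steps separate the weights, whose first two moments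
are \<open>t\<^sup>2\<close> and the energy, from the fourth moment of \<open>T\<close>.\<close>

lemma norm_char_sum_eighth:
  assumes a: "a \<in> carrier R" "a \<noteq> \<zero>"
  shows "(cmod (char_sum a)) ^ 8 \<le> card (carrier R) * avg_energy\<^sup>2 * real t ^ 4"
proof -
  let ?r = "\<lambda>z. real (diff_reps H z)"
  let ?v = "\<lambda>z. cmod (char_sum (z \<otimes> a))"
  have "of_real (real t * (cmod (char_sum a))\<^sup>2) = (\<Sum>h\<in>H. of_real ((cmod (char_sum (a \<otimes> h)))\<^sup>2) :: complex)"
    using a by (simp add: char_sum_scale t_def)
  also have "\<dots> = (\<Sum>h\<in>H. \<Sum>z\<in>carrier R. of_nat (diff_reps H z) * \<psi> (a \<otimes> h \<otimes> z))"
    using a by (intro sum.cong refl norm_char_sum_sq) auto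
  also have "\<dots> = (\<Sum>z\<in>carrier R. \<Sum>h\<in>H. of_nat (diff_reps H z) * \<psi> (a \<otimes> h \<otimes> z))" by (rule sum.swap)
  also have "\<dots> = (\<Sum>z\<in>carrier R. of_nat (diff_reps H z) * char_sum (z \<otimes> a))"
    unfolding char_sum_def sum_distrib_left using a by (intro sum.cong refl) (auto simp: m_ac)
  finally have 0: "of_real (real t * (cmod (char_sum a))\<^sup>2) = (\<Sum>z\<in>carrier R. of_nat (diff_reps H z) * char_sum (z \<otimes> a))" .
  have "real t * (cmod (char_sum a))\<^sup>2 = cmod (of_real (real t * (cmod (char_sum a))\<^sup>2))"
    by (simp add: norm_mult norm_power)
  also have "\<dots> \<le> (\<Sum>z\<in>carrier R. cmod (of_nat (diff_reps H z) * char_sum (z \<otimes> a)))" unfolding 0 by (rule norm_sum)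
  also have "\<dots> = (\<Sum>z\<in>carrier R. ?r z * ?v z)" by (simp add: norm_mult)
  finally have 1: "real t * (cmod (char_sum a))\<^sup>2 \<le> (\<Sum>z\<in>carrier R. ?r z * ?v z)" .
  have sr: "(\<Sum>z\<in>carrier R. ?r z) = (real t)\<^sup>2"
    using sum_diff_reps[OF H_car'] by (simp add: t_def flip: of_nat_sum)
  have "(\<Sum>z\<in>carrier R. ?r z * ?v z)\<^sup>2 = (\<Sum>z\<in>carrier R. sqrt (?r z) * (sqrt (?r z) * ?v z))\<^sup>2"
    by (intro arg_cong[where f = "\<lambda>x. x\<^sup>2"] sum.cong refl) (simp flip: mult.assoc)
  also have "\<dots> \<le> (\<Sum>z\<in>carrier R. (sqrt (?r z))\<^sup>2) * (\<Sum>z\<in>carrier R. (sqrt (?r z) * ?v z)\<^sup>2)"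
    by (rule Cauchy_Schwarz_ineq_sum)
  also have "\<dots> = (real t)\<^sup>2 * (\<Sum>z\<in>carrier R. ?r z * (?v z)\<^sup>2)" by (simp add: sr power_mult_distrib)
  finally have 2: "(\<Sum>z\<in>carrier R. ?r z * ?v z)\<^sup>2 \<le> (real t)\<^sup>2 * (\<Sum>z\<in>carrier R. ?r z * (?v z)\<^sup>2)" .
  have "(\<Sum>z\<in>carrier R. ?r z * (?v z)\<^sup>2)\<^sup>2 \<le> (\<Sum>z\<in>carrier R. (?r z)\<^sup>2) * (\<Sum>z\<in>carrier R. ((?v z)\<^sup>2)\<^sup>2)"
    by (rule Cauchy_Schwarz_ineq_sum)
  also have "(\<Sum>z\<in>carrier R. ((?v z)\<^sup>2)\<^sup>2) = (\<Sum>b\<in>carrier R. (cmod (char_sum b)) ^ 4)"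
    using sum.reindex_bij_betw[OF mult_bij[OF a], of "\<lambda>b. (cmod (char_sum b)) ^ 4"] by (simp flip: power_mult)
  also have "(\<Sum>z\<in>carrier R. (?r z)\<^sup>2) * \<dots> = card (carrier R) * (avg_energy * (real t)\<^sup>2)\<^sup>2"
    unfolding fourth_moment energy_eq by (simp add: power2_eq_square)
  finally have 3: "(\<Sum>z\<in>carrier R. ?r z * (?v z)\<^sup>2)\<^sup>2 \<le> card (carrier R) * (avg_energy * (real t)\<^sup>2)\<^sup>2" .
  have "(real t * (cmod (char_sum a))\<^sup>2) ^ 4 \<le> (\<Sum>z\<in>carrier R. ?r z * ?v z) ^ 4"
    using 1 by (intro power_mono) auto
  also have "\<dots> = ((\<Sum>z\<in>carrier R. ?r z * ?v z)\<^sup>2)\<^sup>2" by (simp flip: power_mult)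
  also have "\<dots> \<le> ((real t)\<^sup>2 * (\<Sum>z\<in>carrier R. ?r z * (?v z)\<^sup>2))\<^sup>2" using 2 by (intro power_mono) auto
  also have "\<dots> = real t ^ 4 * (\<Sum>z\<in>carrier R. ?r z * (?v z)\<^sup>2)\<^sup>2" by (simp add: power_mult_distrib flip: power_mult)
  also have "\<dots> \<le> real t ^ 4 * (card (carrier R) * (avg_energy * (real t)\<^sup>2)\<^sup>2)" using 3 by (intro mult_left_mono) auto
  finally have "real t ^ 4 * (cmod (char_sum a)) ^ 8 \<le> real t ^ 4 * (card (carrier R) * avg_energy\<^sup>2 * real t ^ 4)"
    by (simp add: power_mult_distrib flip: power_mult)
  then show ?thesis using t_pos by simp
qed

end

section \<open>Subfields and n-th powers\<close>

text \<open>The order of a subfield is \<open>p ^ \<nu>\<close> and its multiplicative group is a subgroup, which gives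
\<open>p ^ \<nu> - 1 dvd p ^ m - 1\<close>; the Euclidean algorithm on exponents turns this into \<open>\<nu> dvd m\<close>.\<close>

lemma pred_power_dvd_imp_dvd:
  fixes p k m :: nat
  assumes "1 < p" "(p ^ k - 1) dvd (p ^ m - 1)"
  shows "k dvd m"
  using assms(2)
proof (induction m rule: less_induct)
  case (less m)
  show ?case
  proof (cases "m < k")
    case True
    then have "p ^ m - 1 < p ^ k - 1" using assms(1) by (simp add: diff_less_mono power_strict_increasing)
    then have "p ^ m - 1 = 0" using less.prems by (meson dvd_imp_le leD neq0_conv)
    moreover have "1 < p ^ m" if "0 < m" using that assms(1) by (rule one_less_power[rotated])
    ultimately show ?thesis by (cases "m = 0") auto
  next
    case False
    show ?thesis
    proof (cases "k = 0")
      case True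
      then have "p ^ m \<le> 1" using less.prems by simp
      then have "\<not> 0 < m" using one_less_power[OF assms(1), of m] by linarith
      then show ?thesis by simp
    next
      case k: False
      have pk: "1 \<le> p ^ k" "1 \<le> p ^ (m - k)" using assms(1) by auto
      have "p ^ m = p ^ (m - k) * p ^ k" using False by (simp flip: power_add)
      then have "p ^ m - 1 = p ^ (m - k) * (p ^ k - 1) + (p ^ (m - k) - 1)"
        using pk by (simp add: diff_mult_distrib2)
      then have "(p ^ k - 1) dvd (p ^ (m - k) - 1)" using less.prems by (simp add: dvd_add_right_iff)
      then have "k dvd (m - k)" using less.IH[of "m - k"] False k by simp
      then have "k dvd (m - k) + k" by simp
      then show ?thesis using False by simp
    qed
  qed
qed

lemma gcd_cofactor:
  fixes n t s k :: nat
  assumes "n * t = s * k"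
  shows "n * gcd t s = s * gcd n k"
proof -
  have "n * gcd t s = gcd (n * t) (n * s)" by (simp add: gcd_mult_distrib_nat)
  also have "\<dots> = gcd (s * k) (s * n)" by (simp add: assms mult.commute)
  also have "\<dots> = s * gcd n k" by (simp add: gcd_mult_distrib_nat gcd.commute)
  finally show ?thesis .
qed

context field_of_prime_power begin

lemma subfield_card:
  assumes L: "subgroup L (add_monoid R)" "subgroup (L - {\<zero>}) (mult_of R)"
  obtains \<nu> where "1 \<le> \<nu>" "\<nu> \<le> m" "\<nu> dvd m" "card L = p ^ \<nu>" "card (L - {\<zero>}) = p ^ \<nu> - 1"
proof -
  have Lc: "L \<subseteq> carrier R" using subgroup.subset[OF L(1)] by simp
  have fL: "finite L" using fin Lc finite_subset by blast
  have zero: "\<zero> \<in> L" using subgroup.one_closed[OF L(1)] by simp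
  have one: "\<one> \<in> L" using subgroup.one_closed[OF L(2)] by simp
  have "card L dvd card (carrier R)"
    using add.lagrange[OF L(1)] by (metis dvd_triv_right monoid.select_convs(1) order_def partial_object.select_convs(1))
  then obtain \<nu> where \<nu>: "\<nu> \<le> m" "card L = p ^ \<nu>" using p by (auto simp: card divides_primepow_nat)
  have "card {\<zero>, \<one>} \<le> card L" using zero one fL by (intro card_mono) auto
  then have "1 \<le> \<nu>" using \<nu> by (cases \<nu>) auto
  have c1: "card (L - {\<zero>}) = p ^ \<nu> - 1" using zero \<nu>(2) by simp
  have "card (L - {\<zero>}) dvd order (mult_of R)"
    using group.lagrange[OF field_mult_group L(2)] by (metis dvd_triv_right)
  then have "(p ^ \<nu> - 1) dvd (p ^ m - 1)" using c1 order_mult_of[OF fin] by (simp add: order_def card)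
  then have "\<nu> dvd m" by (rule pred_power_dvd_imp_dvd[OF p1])
  then show ?thesis using that \<nu> \<open>1 \<le> \<nu>\<close> c1 by blast
qed

end

locale power_residues = field_of_prime_power R p m for R :: "'a ring" (structure) and p m +
  fixes n :: nat
  assumes n0: "0 < n" and n_dvd: "n dvd (p ^ m - 1)"
begin

definition nth_powers where "nth_powers = (\<lambda>x. x [^] n) ` (carrier R - {\<zero>})"

lemma pow_pred_card: "x \<in> carrier R \<Longrightarrow> x \<noteq> \<zero> \<Longrightarrow> x [^] (p ^ m - 1) = \<one>"
  using group.pow_order_eq_1[OF field_mult_group, of x] order_mult_of[OF fin]
  by (simp add: order_def card nat_pow_mult_of)

lemma pow_nonzero: "x \<in> carrier R \<Longrightarrow> x \<noteq> \<zero> \<Longrightarrow> x [^] (k::nat) \<noteq> \<zero>"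
  by (induction k) (auto simp: integral_iff)

lemma subgroup_nth_powers: "subgroup nth_powers (mult_of R)"
proof (rule group.subgroupI[OF field_mult_group])
  show "nth_powers \<subseteq> carrier (mult_of R)" using pow_nonzero by (auto simp: nth_powers_def)
  show "nth_powers \<noteq> {}" by (auto simp: nth_powers_def)
  show "inv\<^bsub>mult_of R\<^esub> a \<in> nth_powers" if a: "a \<in> nth_powers" for a
  proof -
    obtain x where x: "x \<in> carrier R - {\<zero>}" "a = x [^] n" using a unfolding nth_powers_def by blast
    have "inv\<^bsub>mult_of R\<^esub> (x [^]\<^bsub>mult_of R\<^esub> n) = (inv\<^bsub>mult_of R\<^esub> x) [^]\<^bsub>mult_of R\<^esub> n"
      using x by (intro group.nat_pow_inv[OF field_mult_group, symmetric]) auto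
    then have "inv\<^bsub>mult_of R\<^esub> a = (inv\<^bsub>mult_of R\<^esub> x) [^] n" using x by (simp add: nat_pow_mult_of)
    moreover have "inv\<^bsub>mult_of R\<^esub> x \<in> carrier R - {\<zero>}"
      using x group.inv_closed[OF field_mult_group, of x] by simp
    ultimately show ?thesis unfolding nth_powers_def by (rule image_eqI)
  qed
  show "a \<otimes>\<^bsub>mult_of R\<^esub> b \<in> nth_powers" if ab: "a \<in> nth_powers" "b \<in> nth_powers" for a b
  proof -
    obtain x y where x: "x \<in> carrier R - {\<zero>}" "a = x [^] n" and y: "y \<in> carrier R - {\<zero>}" "b = y [^] n"
      using ab unfolding nth_powers_def by blast
    have "a \<otimes> b = (x \<otimes> y) [^] n" using x y by (simp add: nat_pow_distrib)
    moreover have "x \<otimes> y \<in> carrier R - {\<zero>}" using x y by (auto simp: integral_iff)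
    ultimately show ?thesis unfolding nth_powers_def by auto
  qed
qed

text \<open>Fibres of \<open>x \<mapsto> x ^ n\<close> have at most \<open>n\<close> elements and the image consists of roots of
\<open>x ^ ((q - 1) / n) = 1\<close>.  The two resulting inequalities are complementary, so both are equalities.\<close>

lemma card_nth_powers:
  shows "card nth_powers * n = p ^ m - 1"
    and "\<And>h. h \<in> nth_powers \<Longrightarrow> card {x \<in> carrier R - {\<zero>}. x [^] n = h} = n"
proof -
  let ?X = "carrier R - {\<zero>}"
  let ?fib = "\<lambda>h. {x \<in> ?X. x [^] n = h}"
  obtain t where t: "p ^ m - 1 = n * t" using n_dvd by auto
  have cX: "card ?X = p ^ m - 1" using fin by (simp add: card)
  have pos: "0 < p ^ m - 1" using one_less_power[OF p1, of m] m by simp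
  then have "0 < n * t" unfolding t .
  then have t0: "t \<noteq> 0" by simp
  have fP: "finite nth_powers" using fin by (simp add: nth_powers_def)
  have fib: "card (?fib h) \<le> n" if h: "h \<in> nth_powers" for h
  proof -
    obtain y where y: "y \<in> ?X" "h = y [^] n" using h unfolding nth_powers_def by blast
    have yu: "y \<in> Units R" using y field_Units by auto
    have "card (?fib h) \<le> card {x \<in> carrier R. x [^] n = \<one>}"
    proof (rule card_inj_on_le[where f = "\<lambda>x. inv y \<otimes> x"])
      show "inj_on (\<lambda>x. inv y \<otimes> x) (?fib h)"
        using yu by (auto simp: inj_on_def)
      have "(inv y \<otimes> x) [^] n = \<one>" if "x \<in> ?fib h" for x
      proof -
        have "(inv y \<otimes> x) [^] n = inv y [^] n \<otimes> y [^] n" using that y yu by (simp add: nat_pow_distrib)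
        also have "\<dots> = (inv y \<otimes> y) [^] n" using y yu by (intro nat_pow_distrib[symmetric]) auto
        finally show ?thesis using yu by simp
      qed
      then show "(\<lambda>x. inv y \<otimes> x) ` ?fib h \<subseteq> {x \<in> carrier R. x [^] n = \<one>}" using yu by auto
    qed (use fin in auto)
    also have "\<dots> \<le> n" using num_roots_le_deg[OF fin, of n] n0 by simp
    finally show ?thesis .
  qed
  have "?X = (\<Union>h\<in>nth_powers. ?fib h)" by (auto simp: nth_powers_def)
  then have sum: "p ^ m - 1 = (\<Sum>h\<in>nth_powers. card (?fib h))"
    using fP fin cX by (subst (asm) arg_cong[where f = card], simp) (subst card_UN_disjoint[symmetric], auto)
  have "nth_powers \<subseteq> {x \<in> carrier R. x [^] t = \<one>}"
  proof
    fix h assume "h \<in> nth_powers"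
    then obtain x where x: "x \<in> ?X" "h = x [^] n" unfolding nth_powers_def by blast
    then show "h \<in> {x \<in> carrier R. x [^] t = \<one>}" using pow_pred_card[of x] t by (simp add: nat_pow_pow)
  qed
  then have "card nth_powers \<le> card {x \<in> carrier R. x [^] t = \<one>}" using fin by (intro card_mono) auto
  also have "\<dots> \<le> t" using num_roots_le_deg[OF fin t0] .
  finally have le: "card nth_powers * n \<le> p ^ m - 1" using t by simp
  have ge: "p ^ m - 1 \<le> card nth_powers * n"
    unfolding sum using fib sum_bounded_above[of nth_powers "\<lambda>h. card (?fib h)" n] by simp
  show eq: "card nth_powers * n = p ^ m - 1" using le ge by simp
  show "card (?fib h) = n" if h: "h \<in> nth_powers" for h
  proof (rule ccontr)
    assume "card (?fib h) \<noteq> n"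
    then have "card (?fib h) < n" using fib[OF h] by simp
    then have "(\<Sum>h\<in>nth_powers. card (?fib h)) < (\<Sum>h\<in>nth_powers. n)"
      using fP fib h by (intro sum_strict_mono_ex1) auto
    then show False using eq sum by simp
  qed
qed

sublocale subgroup_character R nth_powers "add_char p m R \<one>"
proof (intro subgroup_character.intro finite_field_subgroup.intro finite_field_subgroup_axioms.intro
    subgroup_character_axioms.intro)
  show "field R" by (rule field_axioms)
  show "finite (carrier R)" by (rule fin)
  show "subgroup nth_powers (mult_of R)" by (rule subgroup_nth_powers)
qed (auto simp: add_char_add cmod_add_char sum_add_char)

lemma gauss_sum_eq:
  assumes a: "a \<in> carrier R"
  shows "gauss_sum p m R n a = 1 + of_nat n * char_sum a"
proof -
  let ?X = "carrier R - {\<zero>}"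
  let ?\<psi> = "add_char p m R \<one>"
  have psi: "add_char p m R a x = ?\<psi> (a \<otimes> x)" if "x \<in> carrier R" for x
    using a that by (simp add: add_char_def)
  have "gauss_sum p m R n a = (\<Sum>x\<in>carrier R. ?\<psi> (a \<otimes> x [^] n))"
    unfolding gauss_sum_def by (intro sum.cong refl) (simp add: psi)
  also have "\<dots> = ?\<psi> (a \<otimes> \<zero> [^] n) + (\<Sum>x\<in>?X. ?\<psi> (a \<otimes> x [^] n))"
    using fin by (intro sum.remove) auto
  also have "?\<psi> (a \<otimes> \<zero> [^] n) = 1" using a n0 psi_zero by (simp add: nat_pow_zero)
  also have "(\<Sum>x\<in>?X. ?\<psi> (a \<otimes> x [^] n)) = (\<Sum>h\<in>nth_powers. \<Sum>x\<in>{x \<in> ?X. x [^] n = h}. ?\<psi> (a \<otimes> x [^] n))"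
  proof (rule sym, rule sum.group)
    show "finite ?X" using fin by simp
    show "finite nth_powers" by (rule H_fin)
    show "(\<lambda>x. x [^] n) ` ?X \<subseteq> nth_powers" unfolding nth_powers_def by (rule order_refl)
  qed
  also have "\<dots> = (\<Sum>h\<in>nth_powers. of_nat n * ?\<psi> (a \<otimes> h))"
  proof (rule sum.cong)
    fix h assume h: "h \<in> nth_powers"
    have "(\<Sum>x\<in>{x \<in> ?X. x [^] n = h}. ?\<psi> (a \<otimes> x [^] n)) = (\<Sum>x\<in>{x \<in> ?X. x [^] n = h}. ?\<psi> (a \<otimes> h))"
      by (intro sum.cong) auto
    then show "(\<Sum>x\<in>{x \<in> ?X. x [^] n = h}. ?\<psi> (a \<otimes> x [^] n)) = of_nat n * ?\<psi> (a \<otimes> h)"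
      using card_nth_powers(2)[OF h] by simp
  qed simp
  finally show ?thesis by (simp add: char_sum_def sum_distrib_left)
qed

text \<open>Elements of the intersection have order dividing both \<open>t\<close> and \<open>s = \<bar>L\<^sup>*\<bar>\<close>, so they are roots of
\<open>x ^ gcd t s = 1\<close>.\<close>

lemma card_powers_in_subfield:
  assumes L: "subgroup L (add_monoid R)" "subgroup (L - {\<zero>}) (mult_of R)" and c: "card (L - {\<zero>}) = s"
  shows "card (nth_powers \<inter> L) * n \<le> s * gcd n ((p ^ m - 1) div s)"
proof -
  have "s dvd order (mult_of R)"
    using group.lagrange[OF field_mult_group L(2)] c by (metis dvd_triv_right)
  then have sd: "s dvd p ^ m - 1" using order_mult_of[OF fin] by (simp add: order_def card)
  have tn: "n * t = s * ((p ^ m - 1) div s)" using card_nth_powers(1) sd by (simp add: t_def mult.commute)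
  have "nth_powers \<inter> L \<subseteq> {x \<in> carrier R. x [^] gcd t s = \<one>}"
  proof
    fix x assume x: "x \<in> nth_powers \<inter> L"
    then have xc: "x \<in> carrier (mult_of R)" using H_sub by auto
    have xL: "x \<in> L - {\<zero>}" using x by auto
    have pow: "x [^] card K = \<one>" if K: "subgroup K (mult_of R)" "x \<in> K" for K
    proof -
      interpret K: group "mult_of R\<lparr>carrier := K\<rparr>" by (rule group.subgroup_imp_group[OF field_mult_group K(1)])
      have "x [^]\<^bsub>mult_of R\<lparr>carrier := K\<rparr>\<^esub> card K = \<one>\<^bsub>mult_of R\<^esub>"
        using K.pow_order_eq_1[of x] K(2) by (simp add: order_def)
      then show ?thesis by (simp add: nat_pow_def mult_of_def)
    qed
    have "x [^]\<^bsub>mult_of R\<^esub> t = \<one>\<^bsub>mult_of R\<^esub>" "x [^]\<^bsub>mult_of R\<^esub> s = \<one>\<^bsub>mult_of R\<^esub>"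
      using pow[OF H] pow[OF L(2) xL] x c by (auto simp: nat_pow_mult_of[symmetric] t_def)
    then have "x [^]\<^bsub>mult_of R\<^esub> gcd t s = \<one>\<^bsub>mult_of R\<^esub>"
      using group.pow_eq_id[OF field_mult_group xc] by simp
    then show "x \<in> {x \<in> carrier R. x [^] gcd t s = \<one>}" using xc by (simp add: nat_pow_mult_of[symmetric])
  qed
  then have "card (nth_powers \<inter> L) \<le> card {x \<in> carrier R. x [^] gcd t s = \<one>}" using fin by (intro card_mono) auto
  also have "\<dots> \<le> gcd t s" using t_pos by (intro num_roots_le_deg[OF fin]) auto
  finally have "card (nth_powers \<inter> L) * n \<le> n * gcd t s" by (simp add: mult.commute)
  also have "\<dots> = s * gcd n ((p ^ m - 1) div s)" by (rule gcd_cofactor[OF tn])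
  finally show ?thesis .
qed

end

section \<open>Gauss sum bounds\<close>

lemma powr_combine:
  fixes q n :: real
  assumes "0 < q" "0 < n"
  shows "n * (q powr a * ((q / n) powr b * n powr c)) = q powr (a + b) * n powr (1 - b + c)"
proof -
  have "(q / n) powr b = q powr b * n powr (- b)"
    using assms by (simp add: powr_divide powr_minus_divide)
  moreover have "n powr (1 - b + c) = n * (n powr (- b) * n powr c)"
  proof -
    have "n powr (1 - b + c) = n powr (1 + (- b + c))" by (simp add: algebra_simps)
    also have "\<dots> = n powr 1 * (n powr (- b) * n powr c)" by (simp only: powr_add)
    finally show ?thesis using assms by simp
  qed
  ultimately show ?thesis by (simp only: powr_add[of q a b] mult_ac)
qed

lemma powr_combine_simple:
  fixes q n :: real
  assumes "0 < q" "0 < n"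
  shows "(q / n) powr b * n = q powr b * n powr (1 - b)"
  using powr_combine[OF assms, of 0 b 0] assms by (simp add: mult.commute)

lemma fourth_root_bound:
  fixes x y z K :: real
  assumes "0 \<le> z" "0 \<le> x" "0 \<le> y" "1 \<le> K" "z ^ 4 \<le> K * (x ^ 4 + y ^ 4)"
  shows "z \<le> K * (x + y)"
proof (rule power_le_imp_le_base[where n = 3])
  have "x ^ 4 + y ^ 4 \<le> (x + y) ^ 4"
  proof -
    have "(x + y) ^ 4 = x ^ 4 + y ^ 4 + (4 * x ^ 3 * y + 6 * x\<^sup>2 * y\<^sup>2 + 4 * x * y ^ 3)"
      by (simp add: power4_eq_xxxx power3_eq_cube power2_eq_square algebra_simps)
    then show ?thesis using assms by simp
  qed
  then have "K * (x ^ 4 + y ^ 4) \<le> K * (x + y) ^ 4" using assms by (intro mult_left_mono) auto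
  also have "\<dots> \<le> K ^ 4 * (x + y) ^ 4" using assms by (intro mult_right_mono self_le_power) auto
  finally have "z ^ 4 \<le> (K * (x + y)) ^ 4" using assms(5) by (simp add: power_mult_distrib)
  then show "z ^ Suc 3 \<le> (K * (x + y)) ^ Suc 3" by (simp add: eval_nat_numeral)
  show "0 \<le> K * (x + y)" using assms by simp
qed

text \<open>Inserts a bound for the normalised energy \<open>e\<close> into the two character sum estimates; \<open>z\<close> is the
modulus of the character sum over the subgroup and \<open>S\<close> that of the Gauss sum.\<close>

lemma energy_to_gauss_bounds:
  fixes q n t e \<delta> K z S :: real
  assumes q: "1 \<le> q" and n: "1 \<le> n" and t: "0 < t" "t * n \<le> q" and e: "0 \<le> e"
    and K: "1 \<le> K" "e \<le> K * ((q / n) powr (1 - \<delta>) + q / n * n powr (- 1 / 33))"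
    and z: "0 \<le> z" "z ^ 4 \<le> q * e * t" "z ^ 8 \<le> q * e\<^sup>2 * t ^ 4"
    and S: "S \<le> 1 + n * z"
  shows "S \<le> (K + 1) * (q powr ((3 - \<delta>) / 4) * n powr ((2 + \<delta>) / 4) + q powr (3 / 4) * n powr (65 / 132))" (is ?A)
    and "S \<le> (K + 1) * (q powr ((7 - 2 * \<delta>) / 8) * n powr ((1 + \<delta>) / 4) + q powr (7 / 8) * n powr (8 / 33))" (is ?B)
proof -
  define u where "u = q / n"
  have u: "t \<le> u" "0 < u" using t n q by (auto simp: u_def le_divide_eq)
  have qn: "0 < q" "0 < n" using q n by auto
  define w where "w = u powr (1 - \<delta>) + u * n powr (- 1 / 33)"
  have w: "0 \<le> w" using u by (simp add: w_def)
  have ew: "e \<le> K * w" using K by (simp add: w_def u_def)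
  have fin: "S \<le> (K + 1) * (X + Y)" if "z \<le> K * (x + y)" "X = n * x" "Y = n * y" "1 \<le> Y" "0 \<le> X" for x y X Y
  proof -
    have "n * z \<le> n * (K * (x + y))" using that qn by (intro mult_left_mono) auto
    also have "\<dots> = K * (X + Y)" by (simp add: that algebra_simps)
    finally show ?thesis using S that(4,5) by (simp add: distrib_right)
  qed
  have p4: "(a powr b) ^ 4 = a powr (4 * b)" if "0 < a" for a b :: real
    using that by (simp add: powr_realpow[symmetric] powr_powr mult.commute del: powr_realpow)
  have uw1: "u powr b * u powr (1 - \<delta>) = u powr (b + 1 - \<delta>)" "u powr b * u = u powr (b + 1)" for b
    using u by (auto simp: powr_add powr_diff)
  have e4: "(8 - 4 * \<delta>) / 4 = 2 - \<delta>" "(12 - 4 * \<delta>) / 4 = 3 - \<delta>" by simp_all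
  show ?A
  proof (rule fin)
    let ?x = "q powr (1/4) * ((q / n) powr ((2 - \<delta>) / 4) * n powr 0)"
    let ?y = "q powr (1/4) * ((q / n) powr (1/2) * n powr (- 1/132))"
    have "z ^ 4 \<le> q * (K * w) * u"
      using z(2) by (rule order_trans) (use u ew e qn t K w in \<open>intro mult_mono, auto\<close>)
    also have "\<dots> = K * (?x ^ 4 + ?y ^ 4)"
    proof -
      have "?x ^ 4 = q * u powr (2 - \<delta>)" using qn u by (simp add: power_mult_distrib p4 u_def e4)
      moreover have "?y ^ 4 = q * (u powr 2 * n powr (- 1/33))" using qn u by (simp add: power_mult_distrib p4 u_def)
      moreover have "w * u = u powr (2 - \<delta>) + u powr 2 * n powr (- 1/33)"
        using uw1(1)[of 1] u by (simp add: w_def distrib_left mult_ac power2_eq_square)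
      ultimately show ?thesis by (simp add: algebra_simps)
    qed
    finally have z4: "z ^ 4 \<le> K * (?x ^ 4 + ?y ^ 4)" .
    show "z \<le> K * (?x + ?y)" by (rule fourth_root_bound[OF z(1) _ _ K(1) z4]) simp_all
    show "q powr ((3 - \<delta>) / 4) * n powr ((2 + \<delta>) / 4) = n * ?x"
      unfolding powr_combine[OF qn] by (intro arg_cong2[where f = "(*)"] arg_cong2[where f = "(powr)"]) (auto simp: field_simps)
    show "q powr (3 / 4) * n powr (65 / 132) = n * ?y"
      unfolding powr_combine[OF qn] by (intro arg_cong2[where f = "(*)"] arg_cong2[where f = "(powr)"]) auto
    have "1 * 1 \<le> q powr (3 / 4) * n powr (65 / 132)"
      using q n by (intro mult_mono ge_one_powr_ge_zero) auto
    then show "1 \<le> q powr (3 / 4) * n powr (65 / 132)" by simp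
  qed simp
  show ?B
  proof (rule fin)
    let ?x = "q powr (1/8) * ((q / n) powr ((3 - \<delta>) / 4) * n powr 0)"
    let ?y = "q powr (1/8) * ((q / n) powr (3/4) * n powr (- 1/132))"
    have "z ^ 4 \<le> q powr (1/2) * e * t\<^sup>2"
    proof (rule power_le_imp_le_base[where n = 1])
      have "(q powr (1/2))\<^sup>2 = q" using qn by (simp add: powr_half_sqrt)
      then show "(z ^ 4) ^ Suc 1 \<le> (q powr (1/2) * e * t\<^sup>2) ^ Suc 1"
        using z(3) by (simp add: power_mult_distrib flip: power_mult power2_eq_square)
    qed (use e in auto)
    also have "\<dots> \<le> q powr (1/2) * (K * w) * u\<^sup>2"
      using u ew e qn t K w by (intro mult_mono power_mono) auto
    also have "\<dots> = K * (?x ^ 4 + ?y ^ 4)"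
    proof -
      have "?x ^ 4 = q powr (1/2) * u powr (3 - \<delta>)" using qn u by (simp add: power_mult_distrib p4 u_def e4)
      moreover have "?y ^ 4 = q powr (1/2) * (u powr 3 * n powr (- 1/33))" using qn u by (simp add: power_mult_distrib p4 u_def)
      moreover have "w * u\<^sup>2 = u powr (3 - \<delta>) + u powr 3 * n powr (- 1/33)"
        using uw1(1)[of 2] u by (simp add: w_def distrib_left mult_ac power2_eq_square power3_eq_cube)
      moreover have "q powr (1/2) * (K * w) * u\<^sup>2 = K * (q powr (1/2) * (w * u\<^sup>2))" by simp
      ultimately show ?thesis by (simp only: distrib_left)
    qed
    finally have z4: "z ^ 4 \<le> K * (?x ^ 4 + ?y ^ 4)" .
    show "z \<le> K * (?x + ?y)" by (rule fourth_root_bound[OF z(1) _ _ K(1) z4]) simp_all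
    show "q powr ((7 - 2 * \<delta>) / 8) * n powr ((1 + \<delta>) / 4) = n * ?x"
      unfolding powr_combine[OF qn] by (intro arg_cong2[where f = "(*)"] arg_cong2[where f = "(powr)"]) (auto simp: field_simps)
    show "q powr (7 / 8) * n powr (8 / 33) = n * ?y"
      unfolding powr_combine[OF qn] by (intro arg_cong2[where f = "(*)"] arg_cong2[where f = "(powr)"]) auto
    have "1 * 1 \<le> q powr (7 / 8) * n powr (8 / 33)"
      using q n by (intro mult_mono ge_one_powr_ge_zero) auto
    then show "1 \<le> q powr (7 / 8) * n powr (8 / 33)" by simp
  qed simp
qed

text \<open>The case in which no subfield is produced; \<open>128 ^ 33 = 2 ^ 231\<close> absorbs the constant \<open>2 ^ 224\<close>.\<close>

lemma small_energy_arith: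
  fixes e t u \<delta> :: real
  assumes "1 \<le> t" "t \<le> u" "0 \<le> e" "e ^ 33 \<le> 2 ^ 224 * t ^ 32" "\<delta> \<le> 1 / 33"
  shows "e \<le> 128 * u powr (1 - \<delta>)"
proof -
  have "(t powr (32 / 33)) ^ 33 = t ^ 32"
    using assms by (simp add: powr_power)
  then have "(128 * t powr (32 / 33)) ^ 33 = 2 ^ 231 * t ^ 32" by (simp add: power_mult_distrib)
  moreover have "2 ^ 224 * t ^ 32 \<le> 2 ^ 231 * t ^ 32" using assms by (intro mult_right_mono) auto
  ultimately have "e ^ 33 \<le> (128 * t powr (32 / 33)) ^ 33" using assms(4) by linarith
  then have "e \<le> 128 * t powr (32 / 33)" using assms(3) by (subst (asm) power_mono_iff) auto
  also have "\<dots> \<le> 128 * u powr (32 / 33)" using assms by (intro mult_left_mono powr_mono2) auto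
  also have "\<dots> \<le> 128 * u powr (1 - \<delta>)" using assms by (intro mult_left_mono powr_mono) auto
  finally show ?thesis .
qed

text \<open>The case in which the subfield is the whole field: its size bound reads \<open>e ^ 6 \<lless> t ^ 7 / q \<le> t ^ 6 / n\<close>.\<close>

lemma whole_field_arith:
  fixes e t q n :: real
  assumes "0 < e" "0 < t" "1 \<le> n" "t * n \<le> q" "q \<le> 2 ^ 40 * t ^ 7 / e ^ 6"
  shows "e \<le> 128 * (q / n * n powr (- 1 / 33))"
proof -
  have "0 < t * n" using assms by simp
  then have q0: "0 < q" using assms(4) by linarith
  have "t * n * e ^ 6 \<le> q * e ^ 6" using assms by (intro mult_right_mono) auto
  also have "\<dots> \<le> 2 ^ 40 * t ^ 7" using assms by (simp add: le_divide_eq)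
  finally have "t * (n * e ^ 6) \<le> t * (2 ^ 40 * t ^ 6)" by (simp add: eval_nat_numeral mult_ac)
  then have ne: "n * e ^ 6 \<le> 2 ^ 40 * t ^ 6" using assms by simp
  have one: "(n powr (- 1 / 6)) ^ 6 * n = 1"
    using assms by (subst powr_power) (auto simp: powr_minus)
  have "e ^ 6 = e ^ 6 * ((n powr (- 1 / 6)) ^ 6 * n)" unfolding one by simp
  also have "\<dots> = n * e ^ 6 * (n powr (- 1 / 6)) ^ 6" by (simp only: mult_ac)
  also have "\<dots> \<le> 2 ^ 40 * t ^ 6 * (n powr (- 1 / 6)) ^ 6" using ne by (intro mult_right_mono) auto
  also have "\<dots> \<le> (128 * t * n powr (- 1 / 6)) ^ 6"
    using assms by (simp add: power_mult_distrib)
  finally have "e \<le> 128 * t * n powr (- 1 / 6)"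
    using assms by (subst (asm) power_mono_iff) auto
  also have "\<dots> \<le> 128 * (q / n) * n powr (- 1 / 33)"
    using assms q0 by (intro mult_mono powr_mono) (auto simp: le_divide_eq)
  finally show ?thesis by simp
qed

text \<open>A subgroup that meets a subfield of size \<open>s\<close> in \<open>O(s powr (1/2))\<close> elements: combined with the upper
bound for \<open>s\<close> this gives \<open>e ^ 8 \<lless> t ^ 7\<close>, more than enough since \<open>7/8 < 32/33\<close>.\<close>

lemma half_dimension_arith:
  fixes e t u C :: real
  assumes "1 \<le> t" "t \<le> u" "0 < e" "1 \<le> C" "e / 4 \<le> h" "h\<^sup>2 \<le> C\<^sup>2 * s" "s \<le> 2 ^ 40 * t ^ 7 / e ^ 6"
  shows "e \<le> 128 * C * u powr (1 - 1 / 33)"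
proof -
  have "(e / 4)\<^sup>2 \<le> h\<^sup>2" using assms by (intro power_mono) auto
  also have "\<dots> \<le> C\<^sup>2 * (2 ^ 40 * t ^ 7 / e ^ 6)"
    using assms(6) by (rule order_trans) (use assms in \<open>intro mult_left_mono, auto\<close>)
  finally have "e\<^sup>2 * e ^ 6 \<le> C\<^sup>2 * (2 ^ 44 * t ^ 7)" using assms by (simp add: power_divide field_simps)
  then have "e ^ 8 \<le> C\<^sup>2 * (2 ^ 44 * t ^ 7)" by (simp flip: power_add)
  also have "\<dots> \<le> C ^ 8 * (2 ^ 56 * t ^ 7)"
    using assms by (intro mult_mono power_increasing) auto
  also have "\<dots> = (128 * C * t powr (7 / 8)) ^ 8"
    using assms by (simp add: power_mult_distrib powr_power)
  finally have "e \<le> 128 * C * t powr (7 / 8)" using assms by (subst (asm) power_mono_iff) auto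
  also have "\<dots> \<le> 128 * C * u powr (7 / 8)" using assms by (intro mult_left_mono powr_mono2) auto
  also have "\<dots> \<le> 128 * C * u powr (1 - 1 / 33)" using assms by (intro mult_left_mono powr_mono) auto
  finally show ?thesis .
qed

context power_residues begin

text \<open>Both versions of the gcd hypothesis enter only through the assumption on proper subfields: from
the order \<open>p ^ \<nu>\<close> of the subfield and a lower bound \<open>h\<close> for its intersection with the \<open>n\<close>-th powers
it has to deduce the required bound for \<open>avg_energy\<close>.\<close>

lemma max_gauss_sum_bounds:
  fixes \<delta> K :: real
  defines "q \<equiv> p ^ m"
  assumes \<delta>: "\<delta> \<le> 1 / 33" and K: "128 \<le> K"
    and sub: "\<And>\<nu> h. 1 \<le> \<nu> \<Longrightarrow> \<nu> < m \<Longrightarrow> \<nu> dvd m \<Longrightarrow> avg_energy / 4 \<le> h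
      \<Longrightarrow> h * real n \<le> real p ^ \<nu> * real (gcd n ((q - 1) div (p ^ \<nu> - 1)))
      \<Longrightarrow> real p ^ \<nu> \<le> 2 ^ 40 * real t ^ 7 / avg_energy ^ 6
      \<Longrightarrow> avg_energy \<le> K * (real q / real n) powr (1 - \<delta>)"
  shows "max_gauss_sum p m R n
            \<le> (K + 1) * (real q powr ((3 - \<delta>) / 4) * real n powr ((2 + \<delta>) / 4)
                    + real q powr (3 / 4) * real n powr (65 / 132)) \<and>
         max_gauss_sum p m R n
            \<le> (K + 1) * (real q powr ((7 - 2 * \<delta>) / 8) * real n powr ((1 + \<delta>) / 4)
                    + real q powr (7 / 8) * real n powr (8 / 33))"
proof -
  define u where "u = real q / real n"
  have q1: "1 \<le> q" using p0 by (simp add: q_def Suc_leI)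
  have tn: "t * n = q - 1" using card_nth_powers(1) by (simp add: t_def q_def)
  then have "t * n \<le> q" by simp
  then have tq: "real t * real n \<le> real q" by (metis of_nat_le_iff of_nat_mult)
  have n1: "1 \<le> real n" using n0 by simp
  have t1: "1 \<le> real t" using t_pos by simp
  have tu: "real t \<le> u" using tq n1 by (simp add: u_def le_divide_eq)
  have u0: "0 < u" using tu t1 by linarith
  have en: "avg_energy \<le> K * (u powr (1 - \<delta>) + u * real n powr (- 1 / 33))"
  proof (cases "avg_energy ^ 33 \<le> 2 ^ 224 * real t ^ 32")
    case True
    have "avg_energy \<le> 128 * u powr (1 - \<delta>)"
      using small_energy_arith[OF t1 tu _ True \<delta>] avg_energy_pos by simp
    also have "\<dots> \<le> K * (u powr (1 - \<delta>) + u * real n powr (- 1 / 33))"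
      using K u0 by (intro mult_mono) auto
    finally show ?thesis .
  next
    case False
    then have "2 ^ 224 * real t ^ 32 < avg_energy ^ 33" by simp
    from large_energy_imp_subfield[OF this]
    obtain L where L: "subgroup L (add_monoid R)" "subgroup (L - {\<zero>}) (mult_of R)"
      "real (card L) \<le> 2 ^ 40 * real t ^ 7 / avg_energy ^ 6" "avg_energy / 4 \<le> card (nth_powers \<inter> L)"
      by blast
    obtain \<nu> where \<nu>: "1 \<le> \<nu>" "\<nu> \<le> m" "\<nu> dvd m" "card L = p ^ \<nu>" "card (L - {\<zero>}) = p ^ \<nu> - 1"
      using subfield_card[OF L(1,2)] by blast
    show ?thesis
    proof (cases "\<nu> = m")
      case True
      have "avg_energy \<le> 128 * (u * real n powr (- 1 / 33))"
        unfolding u_def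
        by (rule whole_field_arith[OF avg_energy_pos _ n1 tq]) (use t1 L(3) \<nu>(4) True in \<open>auto simp: q_def\<close>)
      also have "\<dots> \<le> K * (u powr (1 - \<delta>) + u * real n powr (- 1 / 33))"
        using K u0 by (intro mult_mono) auto
      finally show ?thesis .
    next
      case False
      have "card (nth_powers \<inter> L) * n \<le> (p ^ \<nu> - 1) * gcd n ((q - 1) div (p ^ \<nu> - 1))"
        unfolding q_def by (rule card_powers_in_subfield[OF L(1,2) \<nu>(5)])
      also have "\<dots> \<le> p ^ \<nu> * gcd n ((q - 1) div (p ^ \<nu> - 1))" by (intro mult_right_mono) auto
      finally have "real (card (nth_powers \<inter> L)) * real n \<le> real p ^ \<nu> * real (gcd n ((q - 1) div (p ^ \<nu> - 1)))"
        by (metis of_nat_le_iff of_nat_mult of_nat_power)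
      then have "avg_energy \<le> K * u powr (1 - \<delta>)"
        unfolding u_def using False \<nu> L(3,4) by (intro sub[of \<nu> "real (card (nth_powers \<inter> L))"]) auto
      also have "\<dots> \<le> K * (u powr (1 - \<delta>) + u * real n powr (- 1 / 33))"
        using K u0 by (intro mult_left_mono) auto
      finally show ?thesis .
    qed
  qed
  have each: "cmod (gauss_sum p m R n a)
            \<le> (K + 1) * (real q powr ((3 - \<delta>) / 4) * real n powr ((2 + \<delta>) / 4)
                    + real q powr (3 / 4) * real n powr (65 / 132)) \<and>
         cmod (gauss_sum p m R n a)
            \<le> (K + 1) * (real q powr ((7 - 2 * \<delta>) / 8) * real n powr ((1 + \<delta>) / 4)
                    + real q powr (7 / 8) * real n powr (8 / 33))"
    if a: "a \<in> carrier R - {\<zero>}" for a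
  proof -
    have ac: "a \<in> carrier R" "a \<noteq> \<zero>" using a by auto
    have cq: "real (card (carrier R)) = real q" by (simp add: card q_def)
    have "cmod (gauss_sum p m R n a) \<le> cmod 1 + cmod (of_nat n * char_sum a)"
      unfolding gauss_sum_eq[OF ac(1)] by (rule norm_triangle_ineq)
    then have S: "cmod (gauss_sum p m R n a) \<le> 1 + real n * cmod (char_sum a)" by (simp add: norm_mult)
    note b = energy_to_gauss_bounds[OF _ n1 _ tq _ _ en[unfolded u_def] _ norm_char_sum_fourth[OF ac, unfolded cq] norm_char_sum_eighth[OF ac, unfolded cq] S]
    show ?thesis using q1 t1 avg_energy_pos K by (intro conjI b) auto
  qed
  have ne: "(\<lambda>a. cmod (gauss_sum p m R n a)) ` (carrier R - {\<zero>}) \<noteq> {}"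
  proof -
    have "\<one> \<in> carrier R - {\<zero>}" by simp
    then show ?thesis by (metis empty_iff image_eqI)
  qed
  have bounded: "max_gauss_sum p m R n \<le> X" if "\<And>a. a \<in> carrier R - {\<zero>} \<Longrightarrow> cmod (gauss_sum p m R n a) \<le> X" for X
    unfolding max_gauss_sum_def
  proof (rule Max.boundedI[OF _ ne])
    show "finite ((\<lambda>a. cmod (gauss_sum p m R n a)) ` (carrier R - {\<zero>}))" using fin by simp
    show "y \<le> X" if "y \<in> (\<lambda>a. cmod (gauss_sum p m R n a)) ` (carrier R - {\<zero>})" for y
      using that \<open>\<And>a. a \<in> carrier R - {\<zero>} \<Longrightarrow> cmod (gauss_sum p m R n a) \<le> X\<close> by (elim imageE) simp
  qed
  show ?thesis by (intro conjI bounded) (use each in blast)+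
qed

end

lemma power_residues_intro:
  fixes F :: "'a ring"
  assumes "Factorial_Ring.prime p" "1 \<le> m" "field F" "card (carrier F) = p ^ m" "0 < n" "n dvd (p ^ m - 1)"
  shows "power_residues F p m n"
  using assms by (intro power_residues.intro field_of_prime_power.intro field_of_prime_power_axioms.intro power_residues_axioms.intro)

theorem theorem2:
  shows
    "(\<exists>l>0::real. \<exists>c>0::real. \<forall>\<delta>::real. \<delta> \<le> 1/33 \<longrightarrow>
       (\<forall>(p::nat) (m::nat) (q::nat) (n::nat) (F :: 'a ring).
          Factorial_Ring.prime p \<and> 1 \<le> m \<and> q = p ^ m \<and> field F \<and> card (carrier F) = q \<and>
          0 < n \<and> n dvd (q - 1) \<and>
          (\<forall>\<nu>::nat. 1 \<le> \<nu> \<and> \<nu> < m \<and> \<nu> dvd m \<longrightarrow>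
             real (gcd n ((q - 1) div (p ^ \<nu> - 1)))
               \<le> l * (real n powr \<delta> * real q powr (1 - \<delta>) / real p ^ \<nu>)) \<longrightarrow>
          max_gauss_sum p m F n
            \<le> c * (real q powr ((3 - \<delta>) / 4) * real n powr ((2 + \<delta>) / 4)
                    + real q powr (3 / 4) * real n powr (65 / 132)) \<and>
          max_gauss_sum p m F n
            \<le> c * (real q powr ((7 - 2 * \<delta>) / 8) * real n powr ((1 + \<delta>) / 4)
                    + real q powr (7 / 8) * real n powr (8 / 33))))
     \<and>
     (\<forall>C>0::real. \<exists>c>0::real. \<forall>\<delta>::real. \<delta> = 1/33 \<longrightarrow>
       (\<forall>(p::nat) (m::nat) (q::nat) (n::nat) (F :: 'a ring).
          Factorial_Ring.prime p \<and> 1 \<le> m \<and> q = p ^ m \<and> field F \<and> card (carrier F) = q \<and>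
          0 < n \<and> n dvd (q - 1) \<and>
          (\<forall>\<nu>::nat. 1 \<le> \<nu> \<and> \<nu> < m \<and> \<nu> dvd m \<longrightarrow>
             real (gcd n ((q - 1) div (p ^ \<nu> - 1)))
               \<le> C * (real n / real p powr (real \<nu> / 2))) \<longrightarrow>
          max_gauss_sum p m F n
            \<le> c * (real q powr ((3 - \<delta>) / 4) * real n powr ((2 + \<delta>) / 4)
                    + real q powr (3 / 4) * real n powr (65 / 132)) \<and>
          max_gauss_sum p m F n
            \<le> c * (real q powr ((7 - 2 * \<delta>) / 8) * real n powr ((1 + \<delta>) / 4)
                    + real q powr (7 / 8) * real n powr (8 / 33))))"
proof (rule conjI, goal_cases)
  case 1
  show ?case
  proof (rule exI[of _ 1], rule conjI, simp, rule exI[of _ "128 + 1"], rule conjI, simp, intro allI impI, elim conjE)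
    fix \<delta> :: real and p m q n :: nat and F :: "'a ring"
    assume \<delta>: "\<delta> \<le> 1 / 33" and p: "Factorial_Ring.prime p" "1 \<le> m" and q: "q = p ^ m"
      and F: "field F" "card (carrier F) = q" and n: "0 < n" "n dvd (q - 1)"
      and gcd_le: "\<forall>\<nu>::nat. 1 \<le> \<nu> \<and> \<nu> < m \<and> \<nu> dvd m \<longrightarrow>
             real (gcd n ((q - 1) div (p ^ \<nu> - 1)))
               \<le> 1 * (real n powr \<delta> * real q powr (1 - \<delta>) / real p ^ \<nu>)"
    interpret power_residues F p m n
      using p F n unfolding q by (intro power_residues_intro)
    show "max_gauss_sum p m F n
            \<le> (128 + 1) * (real q powr ((3 - \<delta>) / 4) * real n powr ((2 + \<delta>) / 4)
                    + real q powr (3 / 4) * real n powr (65 / 132)) \<and>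
          max_gauss_sum p m F n
            \<le> (128 + 1) * (real q powr ((7 - 2 * \<delta>) / 8) * real n powr ((1 + \<delta>) / 4)
                    + real q powr (7 / 8) * real n powr (8 / 33))"
      unfolding q
    proof (rule max_gauss_sum_bounds[OF \<delta> order_refl])
      fix \<nu> h
      assume \<nu>: "1 \<le> \<nu>" "\<nu> < m" "\<nu> dvd m" and h: "avg_energy / 4 \<le> h"
        "h * real n \<le> real p ^ \<nu> * real (gcd n ((p ^ m - 1) div (p ^ \<nu> - 1)))"
      have n': "0 < real n" using n by simp
      have pp: "0 < real p ^ \<nu>" using p0 by simp
      have q': "0 < real (p ^ m)" using p0 by simp
      have "h * real n \<le> real p ^ \<nu> * (real n powr \<delta> * real (p ^ m) powr (1 - \<delta>) / real p ^ \<nu>)"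
      proof (rule order_trans[OF h(2)], rule mult_left_mono)
        show "real (gcd n ((p ^ m - 1) div (p ^ \<nu> - 1))) \<le> real n powr \<delta> * real (p ^ m) powr (1 - \<delta>) / real p ^ \<nu>"
          using gcd_le[rule_format, of \<nu>] \<nu> unfolding q mult_1 by blast
      qed (use pp in simp)
      also have "\<dots> = real n powr \<delta> * real (p ^ m) powr (1 - \<delta>)" using pp by simp
      also have "\<dots> = (real (p ^ m) / real n) powr (1 - \<delta>) * real n"
        using powr_combine_simple[OF q' n', of "1 - \<delta>"] by (simp only: mult.commute diff_diff_eq2 add_diff_cancel_left')
      finally have "h \<le> (real (p ^ m) / real n) powr (1 - \<delta>)" using n' by simp
      then have "avg_energy \<le> 4 * (real (p ^ m) / real n) powr (1 - \<delta>)" using h(1) by linarith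
      also have "\<dots> \<le> 128 * (real (p ^ m) / real n) powr (1 - \<delta>)" by (intro mult_right_mono) auto
      finally show "avg_energy \<le> 128 * (real (p ^ m) / real n) powr (1 - \<delta>)" .
    qed
  qed
next
  case 2
  show ?case
  proof (intro allI impI)
    fix C :: real assume C: "0 < C"
    define C' where "C' = max 1 C"
    have C': "1 \<le> C'" "C \<le> C'" by (auto simp: C'_def)
    show "\<exists>c>0::real. \<forall>\<delta>::real. \<delta> = 1/33 \<longrightarrow>
       (\<forall>(p::nat) (m::nat) (q::nat) (n::nat) (F :: 'a ring).
          Factorial_Ring.prime p \<and> 1 \<le> m \<and> q = p ^ m \<and> field F \<and> card (carrier F) = q \<and>
          0 < n \<and> n dvd (q - 1) \<and>
          (\<forall>\<nu>::nat. 1 \<le> \<nu> \<and> \<nu> < m \<and> \<nu> dvd m \<longrightarrow>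
             real (gcd n ((q - 1) div (p ^ \<nu> - 1)))
               \<le> C * (real n / real p powr (real \<nu> / 2))) \<longrightarrow>
          max_gauss_sum p m F n
            \<le> c * (real q powr ((3 - \<delta>) / 4) * real n powr ((2 + \<delta>) / 4)
                    + real q powr (3 / 4) * real n powr (65 / 132)) \<and>
          max_gauss_sum p m F n
            \<le> c * (real q powr ((7 - 2 * \<delta>) / 8) * real n powr ((1 + \<delta>) / 4)
                    + real q powr (7 / 8) * real n powr (8 / 33)))"
    proof (rule exI[of _ "128 * C' + 1"], rule conjI, use C' in simp, intro allI impI, elim conjE)
      fix \<delta> :: real and p m q n :: nat and F :: "'a ring"
      assume \<delta>: "\<delta> = 1 / 33" and p: "Factorial_Ring.prime p" "1 \<le> m" and q: "q = p ^ m"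
        and F: "field F" "card (carrier F) = q" and n: "0 < n" "n dvd (q - 1)"
        and gcd_le: "\<forall>\<nu>::nat. 1 \<le> \<nu> \<and> \<nu> < m \<and> \<nu> dvd m \<longrightarrow>
             real (gcd n ((q - 1) div (p ^ \<nu> - 1)))
               \<le> C * (real n / real p powr (real \<nu> / 2))"
      interpret power_residues F p m n
        using p F n unfolding q by (intro power_residues_intro)
      have \<delta>': "\<delta> \<le> 1 / 33" using \<delta> by simp
      have K: "128 \<le> 128 * C'" using C' by simp
      show "max_gauss_sum p m F n
            \<le> (128 * C' + 1) * (real q powr ((3 - \<delta>) / 4) * real n powr ((2 + \<delta>) / 4)
                    + real q powr (3 / 4) * real n powr (65 / 132)) \<and>
          max_gauss_sum p m F n
            \<le> (128 * C' + 1) * (real q powr ((7 - 2 * \<delta>) / 8) * real n powr ((1 + \<delta>) / 4)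
                    + real q powr (7 / 8) * real n powr (8 / 33))"
        unfolding q
      proof (rule max_gauss_sum_bounds[OF \<delta>' K])
        fix \<nu> h
        assume \<nu>: "1 \<le> \<nu>" "\<nu> < m" "\<nu> dvd m" and h: "avg_energy / 4 \<le> h"
          "h * real n \<le> real p ^ \<nu> * real (gcd n ((p ^ m - 1) div (p ^ \<nu> - 1)))"
          and s: "real p ^ \<nu> \<le> 2 ^ 40 * real t ^ 7 / avg_energy ^ 6"
        have n': "0 < real n" using n by simp
        define r where "r = real p powr (real \<nu> / 2)"
        have r: "0 < r" "r\<^sup>2 = real p ^ \<nu>"
          using p0 by (auto simp: r_def powr_power powr_realpow)
        have "h * real n \<le> real p ^ \<nu> * (C * (real n / r))"
        proof (rule order_trans[OF h(2)], rule mult_left_mono)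
          show "real (gcd n ((p ^ m - 1) div (p ^ \<nu> - 1))) \<le> C * (real n / r)"
            using gcd_le[rule_format, of \<nu>] \<nu> unfolding q r_def by blast
        qed simp
        also have "\<dots> = C * r * real n" using r(1) by (simp add: r(2)[symmetric] power2_eq_square)
        finally have "h \<le> C * r" using n' by simp
        also have "\<dots> \<le> C' * r" using C' r by (intro mult_right_mono) auto
        finally have "h \<le> C' * r" .
        moreover have "0 \<le> h" using h(1) avg_energy_pos by linarith
        ultimately have "h\<^sup>2 \<le> (C' * r)\<^sup>2" by (intro power_mono) auto
        then have h2: "h\<^sup>2 \<le> C'\<^sup>2 * real p ^ \<nu>" by (simp add: power_mult_distrib r(2))
        have t1: "1 \<le> real t" using t_pos by simp
        have "t * n \<le> p ^ m" using card_nth_powers(1) by (simp add: t_def)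
        then have "real t * real n \<le> real (p ^ m)" by (metis of_nat_le_iff of_nat_mult)
        then have tu: "real t \<le> real (p ^ m) / real n" using n' by (simp add: le_divide_eq)
        show "avg_energy \<le> 128 * C' * (real (p ^ m) / real n) powr (1 - \<delta>)"
          unfolding \<delta> by (rule half_dimension_arith[OF t1 tu avg_energy_pos C'(1) h(1) h2 s])
      qed
    qed
  qed
qed

end
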